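(* Let $\tilde{X}=[1,\infty]$ be the Alexandroff (one-point) compactification of the interval $X=[1,\infty)$, let $B=C(\tilde{X},\mathrm{M}_2(\mathbb{C}))$, and let $A$ be the $C^*$-subalgebra of $B$ consisting of all $a\in B$ such that $$a(n)=\begin{pmatrix}\lambda_n(a)&0\\0&\lambda_{n+1}(a)\end{pmatrix}\ (n\in\mathbb{N})\quad\text{and}\quad a(\infty)=\begin{pmatrix}\lambda(a)&0\\0&\lambda(a)\end{pmatrix},$$ for some convergent sequence $(\lambda_n(a))_{n\in\mathbb{N}}$ of complex numbers with $\lim_n\lambda_n(a)=\lambda(a)$. Then $\mathrm{Orc}(A)=\infty$ and $\mathrm{E}(A)$ is a cb-closed subspace of $\mathrm{ICB}(A)$. Consequently, $A$ has outer elementary derivations, i.e. there is a derivation on $A$ which is an elementary operator on $A$ but is not an inner derivation of $A$.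
   Context: $\mathbb{N}=\{1,2,3,\dots\}$. "Ideal" means closed two-sided ideal. $\mathrm{Prim}(A)$ is the set of primitive ideals of $A$ with the Jacobson (hull-kernel) topology. Two primitive ideals $P,Q$ are adjacent, $P\sim Q$, if they cannot be separated by disjoint open subsets of $\mathrm{Prim}(A)$. A path of length $n$ from $P$ to $Q$ is a sequence $P=P_0,P_1,\dots,P_n=Q$ in $\mathrm{Prim}(A)$ with $P_{i-1}\sim P_i$ for $1\le i\le n$. The distance $d(P,Q)$ is: $1$ if $P=Q$; the minimal length of a path from $P$ to $Q$ if $P\ne Q$ and such a path exists; $\infty$ if no path exists. The connecting order is $\mathrm{Orc}(A)=\sup\{d(P,Q): P,Q\in\mathrm{Prim}(A),\ d(P,Q)<\infty\}$. $\mathrm{ICB}(A)$ is the space of all completely bounded maps $T:A\to A$ with $T(J)\subseteq J$ for every ideal $J$ of $A$, with the cb-norm; "cb-closed" means closed in the cb-norm. For unital $A$, $\mathrm{E}(A)$ is the space of elementary operators on $A$, i.e. maps $x\mapsto\sum_{k=1}^d a_kxb_k$ with $d\in\mathbb{N}$, $a_k,b_k\in A$. A derivation on $A$ is a linear map $\delta:A\to A$ with $\delta(ab)=\delta(a)b+a\delta(b)$; it is inner if $\delta(x)=ax-xa$ for some $a\in A$, outer if it is not inner, and elementary if $\delta\in\mathrm{E}(A)$. *)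

theory Defs
  imports
    "HOL-Algebra.Module"
    "HOL-Algebra.Ideal"
    "HOL-Analysis.Analysis"
    "HOL-Library.Extended_Nat"
begin

text \<open>
  The field \<open>mat_norm\<close> holds the C*-norms of the algebras of n by n matrices over the algebra:
  \<open>mat_norm A n a\<close> is the norm of the matrix with entries \<open>a i j\<close>, where \<open>i, j < n\<close>.
\<close>

record 'a cstar = "(complex, 'a) module" +
  adj :: "'a \<Rightarrow> 'a"
  mat_norm :: "nat \<Rightarrow> (nat \<Rightarrow> nat \<Rightarrow> 'a) \<Rightarrow> real"

definition cstar_norm :: "('a, 'm) cstar_scheme \<Rightarrow> 'a \<Rightarrow> real" where
  "cstar_norm A a = mat_norm A 1 (\<lambda>_ _. a)"

definition closed_ideal :: "('a, 'm) cstar_scheme \<Rightarrow> 'a set \<Rightarrow> bool" where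
  "closed_ideal A J \<longleftrightarrow>
     ideal J A \<and>
     (\<forall>c. \<forall>x\<in>J. c \<odot>\<^bsub>A\<^esub> x \<in> J) \<and>
     (\<forall>f x. (\<forall>n. f n \<in> J) \<and> x \<in> carrier A \<and>
        (\<lambda>n. cstar_norm A (f n \<ominus>\<^bsub>A\<^esub> x)) \<longlonglongrightarrow> 0 \<longrightarrow> x \<in> J)"

text \<open>The Hilbert space of square-summable families indexed by \<open>S\<close> (extended by 0 outside \<open>S\<close>).\<close>

definition l2 :: "'i set \<Rightarrow> ('i \<Rightarrow> complex) set" where
  "l2 S = {v. (\<forall>i. i \<notin> S \<longrightarrow> v i = 0) \<and> (\<lambda>i. (cmod (v i))\<^sup>2) summable_on UNIV}"

definition l2_inner :: "('i \<Rightarrow> complex) \<Rightarrow> ('i \<Rightarrow> complex) \<Rightarrow> complex" where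
  "l2_inner v w = (\<Sum>\<^sub>\<infinity>i. v i * cnj (w i))"

definition l2_norm :: "('i \<Rightarrow> complex) \<Rightarrow> real" where
  "l2_norm v = sqrt (\<Sum>\<^sub>\<infinity>i. (cmod (v i))\<^sup>2)"

definition bounded_operator :: "'i set \<Rightarrow> (('i \<Rightarrow> complex) \<Rightarrow> ('i \<Rightarrow> complex)) \<Rightarrow> bool" where
  "bounded_operator S T \<longleftrightarrow>
     T \<in> l2 S \<rightarrow> l2 S \<and>
     (\<forall>v\<in>l2 S. \<forall>w\<in>l2 S. T (\<lambda>i. v i + w i) = (\<lambda>i. T v i + T w i)) \<and>
     (\<forall>c. \<forall>v\<in>l2 S. T (\<lambda>i. c * v i) = (\<lambda>i. c * T v i)) \<and>
     (\<exists>C. \<forall>v\<in>l2 S. l2_norm (T v) \<le> C * l2_norm v)"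

definition closed_subspace :: "'i set \<Rightarrow> ('i \<Rightarrow> complex) set \<Rightarrow> bool" where
  "closed_subspace S K \<longleftrightarrow>
     K \<subseteq> l2 S \<and> (\<lambda>_. 0) \<in> K \<and>
     (\<forall>v\<in>K. \<forall>w\<in>K. (\<lambda>i. v i + w i) \<in> K) \<and>
     (\<forall>c. \<forall>v\<in>K. (\<lambda>i. c * v i) \<in> K) \<and>
     (\<forall>f v. (\<forall>n. f n \<in> K) \<and> v \<in> l2 S \<and>
        (\<lambda>n. l2_norm (\<lambda>i. f n i - v i)) \<longlonglongrightarrow> 0 \<longrightarrow> v \<in> K)"

definition star_rep ::
  "('a, 'm) cstar_scheme \<Rightarrow> 'i set \<Rightarrow> ('a \<Rightarrow> ('i \<Rightarrow> complex) \<Rightarrow> ('i \<Rightarrow> complex)) \<Rightarrow> bool" where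
  "star_rep A S \<pi> \<longleftrightarrow>
     (\<forall>a\<in>carrier A. bounded_operator S (\<pi> a)) \<and>
     (\<forall>v\<in>l2 S.
        (\<forall>a\<in>carrier A. \<forall>b\<in>carrier A. \<pi> (a \<oplus>\<^bsub>A\<^esub> b) v = (\<lambda>i. \<pi> a v i + \<pi> b v i)) \<and>
        (\<forall>c. \<forall>a\<in>carrier A. \<pi> (c \<odot>\<^bsub>A\<^esub> a) v = (\<lambda>i. c * \<pi> a v i)) \<and>
        (\<forall>a\<in>carrier A. \<forall>b\<in>carrier A. \<pi> (a \<otimes>\<^bsub>A\<^esub> b) v = \<pi> a (\<pi> b v)) \<and>
        (\<forall>a\<in>carrier A. \<forall>w\<in>l2 S. l2_inner (\<pi> (adj A a) v) w = l2_inner v (\<pi> a w)))"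

definition irreducible_rep ::
  "('a, 'm) cstar_scheme \<Rightarrow> 'i set \<Rightarrow> ('a \<Rightarrow> ('i \<Rightarrow> complex) \<Rightarrow> ('i \<Rightarrow> complex)) \<Rightarrow> bool" where
  "irreducible_rep A S \<pi> \<longleftrightarrow>
     star_rep A S \<pi> \<and>
     (\<exists>a\<in>carrier A. \<exists>v\<in>l2 S. \<pi> a v \<noteq> (\<lambda>_. 0)) \<and>
     (\<forall>K. closed_subspace S K \<and> (\<forall>a\<in>carrier A. \<forall>v\<in>K. \<pi> a v \<in> K) \<longrightarrow>
        K = {\<lambda>_. 0} \<or> K = l2 S)"

definition rep_kernel ::
  "('a, 'm) cstar_scheme \<Rightarrow> 'i set \<Rightarrow> ('a \<Rightarrow> ('i \<Rightarrow> complex) \<Rightarrow> ('i \<Rightarrow> complex)) \<Rightarrow> 'a set" where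
  "rep_kernel A S \<pi> = {a \<in> carrier A. \<forall>v\<in>l2 S. \<pi> a v = (\<lambda>_. 0)}"

text \<open>
  It is no restriction to let \<open>S\<close> range over sets of elements of type \<open>'a\<close>: an irreducible
  representation on \<open>H\<close> is cyclic, so \<open>H\<close> has an orthonormal basis whose cardinality is at most
  that of the algebra, and the representation is unitarily equivalent to one on such an \<open>l2 S\<close>.
\<close>

definition Prim :: "('a, 'm) cstar_scheme \<Rightarrow> 'a set set" where
  "Prim A = {P. closed_ideal A P \<and>
     (\<exists>(S :: 'a set) \<pi>. irreducible_rep A S \<pi> \<and> P = rep_kernel A S \<pi>)}"

definition hull_kernel_topology :: "('a, 'm) cstar_scheme \<Rightarrow> 'a set topology" where
  "hull_kernel_topology A =
     topology (\<lambda>U. \<exists>I. closed_ideal A I \<and> U = {P \<in> Prim A. \<not> I \<subseteq> P})"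

definition adjacent :: "('a, 'm) cstar_scheme \<Rightarrow> 'a set \<Rightarrow> 'a set \<Rightarrow> bool" where
  "adjacent A P Q \<longleftrightarrow> P \<in> Prim A \<and> Q \<in> Prim A \<and>
     \<not> (\<exists>U V. openin (hull_kernel_topology A) U \<and> openin (hull_kernel_topology A) V \<and>
           P \<in> U \<and> Q \<in> V \<and> disjnt U V)"

definition prim_path ::
  "('a, 'm) cstar_scheme \<Rightarrow> nat \<Rightarrow> 'a set \<Rightarrow> 'a set \<Rightarrow> (nat \<Rightarrow> 'a set) \<Rightarrow> bool" where
  "prim_path A n P Q p \<longleftrightarrow> p 0 = P \<and> p n = Q \<and>
     (\<forall>i\<le>n. p i \<in> Prim A) \<and> (\<forall>i<n. adjacent A (p i) (p (Suc i)))"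

text \<open>The infimum of the empty set in \<^typ>\<open>enat\<close> is \<open>\<infinity>\<close>.\<close>

definition prim_dist :: "('a, 'm) cstar_scheme \<Rightarrow> 'a set \<Rightarrow> 'a set \<Rightarrow> enat" where
  "prim_dist A P Q = (if P = Q then 1 else Inf {enat n |n. \<exists>p. prim_path A n P Q p})"

definition Orc :: "('a, 'm) cstar_scheme \<Rightarrow> enat" where
  "Orc A = Sup {prim_dist A P Q |P Q. P \<in> Prim A \<and> Q \<in> Prim A \<and> prim_dist A P Q < \<infinity>}"

text \<open>Maps on the algebra are functions on the carrier, normalised to \<open>undefined\<close> outside it.\<close>

definition linear_maps :: "('a, 'm) cstar_scheme \<Rightarrow> ('a \<Rightarrow> 'a) set" where
  "linear_maps A = {T \<in> carrier A \<rightarrow>\<^sub>E carrier A.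
     (\<forall>x\<in>carrier A. \<forall>y\<in>carrier A. T (x \<oplus>\<^bsub>A\<^esub> y) = T x \<oplus>\<^bsub>A\<^esub> T y) \<and>
     (\<forall>c. \<forall>x\<in>carrier A. T (c \<odot>\<^bsub>A\<^esub> x) = c \<odot>\<^bsub>A\<^esub> T x)}"

definition amplification_norms :: "('a, 'm) cstar_scheme \<Rightarrow> ('a \<Rightarrow> 'a) \<Rightarrow> real set" where
  "amplification_norms A T = {mat_norm A n (\<lambda>i j. T (a i j)) |n a.
     1 \<le> n \<and> (\<forall>i<n. \<forall>j<n. a i j \<in> carrier A) \<and> mat_norm A n a \<le> 1}"

definition cb_norm :: "('a, 'm) cstar_scheme \<Rightarrow> ('a \<Rightarrow> 'a) \<Rightarrow> real" where
  "cb_norm A T = Sup (amplification_norms A T)"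

definition CB :: "('a, 'm) cstar_scheme \<Rightarrow> ('a \<Rightarrow> 'a) set" where
  "CB A = {T \<in> linear_maps A. bdd_above (amplification_norms A T)}"

definition ICB :: "('a, 'm) cstar_scheme \<Rightarrow> ('a \<Rightarrow> 'a) set" where
  "ICB A = {T \<in> CB A. \<forall>J. closed_ideal A J \<longrightarrow> T ` J \<subseteq> J}"

definition elementary_operators :: "('a, 'm) cstar_scheme \<Rightarrow> ('a \<Rightarrow> 'a) set" where
  "elementary_operators A =
     {\<lambda>x\<in>carrier A. (\<Oplus>\<^bsub>A\<^esub>k\<in>{1..d}. a k \<otimes>\<^bsub>A\<^esub> x \<otimes>\<^bsub>A\<^esub> b k) |(d::nat) a b.
        1 \<le> d \<and> a \<in> {1..d} \<rightarrow> carrier A \<and> b \<in> {1..d} \<rightarrow> carrier A}"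

definition map_subspace ::
  "('a, 'm) cstar_scheme \<Rightarrow> ('a \<Rightarrow> 'a) set \<Rightarrow> ('a \<Rightarrow> 'a) set \<Rightarrow> bool" where
  "map_subspace A N M \<longleftrightarrow> N \<subseteq> M \<and>
     (\<lambda>x\<in>carrier A. \<zero>\<^bsub>A\<^esub>) \<in> N \<and>
     (\<forall>S\<in>N. \<forall>T\<in>N. (\<lambda>x\<in>carrier A. S x \<oplus>\<^bsub>A\<^esub> T x) \<in> N) \<and>
     (\<forall>c. \<forall>T\<in>N. (\<lambda>x\<in>carrier A. c \<odot>\<^bsub>A\<^esub> T x) \<in> N)"

definition cb_closed_in ::
  "('a, 'm) cstar_scheme \<Rightarrow> ('a \<Rightarrow> 'a) set \<Rightarrow> ('a \<Rightarrow> 'a) set \<Rightarrow> bool" where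
  "cb_closed_in A N M \<longleftrightarrow> N \<subseteq> M \<and>
     (\<forall>S T. (\<forall>n. S n \<in> N) \<and> T \<in> M \<and>
        (\<lambda>n. cb_norm A (\<lambda>x\<in>carrier A. S n x \<ominus>\<^bsub>A\<^esub> T x)) \<longlonglongrightarrow> 0 \<longrightarrow> T \<in> N)"

definition derivations :: "('a, 'm) cstar_scheme \<Rightarrow> ('a \<Rightarrow> 'a) set" where
  "derivations A = {\<delta> \<in> linear_maps A. \<forall>a\<in>carrier A. \<forall>b\<in>carrier A.
     \<delta> (a \<otimes>\<^bsub>A\<^esub> b) = \<delta> a \<otimes>\<^bsub>A\<^esub> b \<oplus>\<^bsub>A\<^esub> a \<otimes>\<^bsub>A\<^esub> \<delta> b}"

definition inner_derivation :: "('a, 'm) cstar_scheme \<Rightarrow> ('a \<Rightarrow> 'a) \<Rightarrow> bool" where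
  "inner_derivation A \<delta> \<longleftrightarrow> \<delta> \<in> derivations A \<and>
     (\<exists>a\<in>carrier A. \<forall>x\<in>carrier A. \<delta> x = a \<otimes>\<^bsub>A\<^esub> x \<ominus>\<^bsub>A\<^esub> x \<otimes>\<^bsub>A\<^esub> a)"

type_synonym m2 = "complex^2^2"

definition Xt :: "real option topology" where
  "Xt = Alexandroff_compactification (top_of_set {1..})"

text \<open>
  The norm of the operator on the Hilbert space sum of \<open>n\<close> copies of \<^typ>\<open>complex^2\<close> given by an
  \<open>n\<close> by \<open>n\<close> block matrix; the norm on \<^typ>\<open>complex^2\<close> is the Hilbert space norm.
\<close>

definition block_norm :: "nat \<Rightarrow> (nat \<Rightarrow> nat \<Rightarrow> m2) \<Rightarrow> real" where
  "block_norm n M =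
     (SUP v \<in> {v :: nat \<Rightarrow> complex^2. L2_set (\<lambda>j. norm (v j)) {..<n} \<le> 1}.
        L2_set (\<lambda>i. norm (\<Sum>j<n. M i j *v v j)) {..<n})"

text \<open>
  The algebra of continuous functions from \<open>Xt\<close> to the 2 by 2 matrices.  The n by n matrices over
  it are the continuous functions from \<open>Xt\<close> to the 2n by 2n matrices, with the supremum norm.
  Products of matrices are \<open>**\<close>, since \<open>*\<close> is the entrywise product.
\<close>

definition alg_B :: "(real option \<Rightarrow> m2) cstar" where
  "alg_B = \<lparr>
     carrier = {a \<in> extensional (topspace Xt). continuous_map Xt euclidean a},
     monoid.mult = (\<lambda>a b. \<lambda>x\<in>topspace Xt. a x ** b x),
     one = (\<lambda>x\<in>topspace Xt. mat 1),
     zero = (\<lambda>x\<in>topspace Xt. 0),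
     add = (\<lambda>a b. \<lambda>x\<in>topspace Xt. a x + b x),
     module.smult = (\<lambda>c a. \<lambda>x\<in>topspace Xt. \<chi> i j. c * a x $ i $ j),
     adj = (\<lambda>a. \<lambda>x\<in>topspace Xt. \<chi> i j. cnj (a x $ j $ i)),
     mat_norm = (\<lambda>n a. SUP x\<in>topspace Xt. block_norm n (\<lambda>i j. a i j x)) \<rparr>"

definition diag2 :: "complex \<Rightarrow> complex \<Rightarrow> m2" where
  "diag2 z w = vector [vector [z, 0], vector [0, w]]"

definition alg_A :: "(real option \<Rightarrow> m2) cstar" where
  "alg_A = alg_B \<lparr> carrier := {a \<in> carrier alg_B.
     \<exists>(lam :: nat \<Rightarrow> complex) l. lam \<longlonglongrightarrow> l \<and>
       (\<forall>n\<ge>1. a (Some (real n)) = diag2 (lam n) (lam (n + 1))) \<and>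
       a None = diag2 l l} \<rparr>"

text \<open>
  The locale predicate \<open>ideal\<close> used in \<open>closed_ideal\<close> includes that the ambient structure is a ring;
  this is checked here, together with closure under scalar multiples and adjoints.
\<close>

lemma alg_A_sel:
  "x \<otimes>\<^bsub>alg_A\<^esub> y = (\<lambda>t\<in>topspace Xt. x t ** y t)"
  "x \<oplus>\<^bsub>alg_A\<^esub> y = (\<lambda>t\<in>topspace Xt. x t + y t)"
  "\<zero>\<^bsub>alg_A\<^esub> = (\<lambda>t\<in>topspace Xt. 0)" "\<one>\<^bsub>alg_A\<^esub> = (\<lambda>t\<in>topspace Xt. mat 1)"
  "c \<odot>\<^bsub>alg_A\<^esub> x = (\<lambda>t\<in>topspace Xt. \<chi> i j. c * x t $ i $ j)"
  "adj alg_A x = (\<lambda>t\<in>topspace Xt. \<chi> i j. cnj (x t $ j $ i))"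
  by (simp_all add: alg_A_def alg_B_def)

lemma topspace_Xt: "topspace Xt = insert None (Some ` {1..})"
  by (simp add: Xt_def)

lemma diag2_arith:
  "diag2 a b + diag2 c d = diag2 (a + c) (b + d)"
  "diag2 a b ** diag2 c d = diag2 (a * c) (b * d)"
  "diag2 1 1 = mat 1" "diag2 0 0 = 0"
  "- diag2 a b = diag2 (- a) (- b)"
  "(\<chi> i j. c * diag2 a b $ i $ j) = diag2 (c * a) (c * b)"
  "(\<chi> i j. cnj (diag2 a b $ j $ i)) = diag2 (cnj a) (cnj b)"
  by (simp_all add: diag2_def vec_eq_iff forall_2 matrix_matrix_mult_def sum_2 mat_def)

lemma mult_m2_nth: "((a :: m2) ** b) $ i $ j = a $ i $ 1 * b $ 1 $ j + a $ i $ 2 * b $ 2 $ j"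
  by (simp add: matrix_matrix_mult_def sum_2)

lemma continuous_restrict_iff:
  "continuous_map Xt euclidean (restrict f (topspace Xt)) \<longleftrightarrow> continuous_map Xt euclidean f"
proof
  show "continuous_map Xt euclidean (restrict f (topspace Xt))" if "continuous_map Xt euclidean f"
    by (rule continuous_map_eq[OF that]) simp
  show "continuous_map Xt euclidean f" if "continuous_map Xt euclidean (restrict f (topspace Xt))"
    by (rule continuous_map_eq[OF that]) simp
qed

lemma continuous_m2_iff:
  "continuous_map T euclidean (f :: _ \<Rightarrow> m2) \<longleftrightarrow>
   (\<forall>i j. continuous_map T euclidean (\<lambda>x. f x $ i $ j))"
proof
  show "\<forall>i j. continuous_map T euclidean (\<lambda>x. f x $ i $ j)" if "continuous_map T euclidean f"
    using that unfolding continuous_map_atin limitin_canonical_iff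
    by (intro allI ballI tendsto_vec_nth) blast
  show "continuous_map T euclidean f" if "\<forall>i j. continuous_map T euclidean (\<lambda>x. f x $ i $ j)"
    unfolding continuous_map_atin limitin_canonical_iff
  proof (intro ballI vec_tendstoI)
    show "((\<lambda>y. f y $ i $ j) \<longlongrightarrow> f x $ i $ j) (atin T x)" if "x \<in> topspace T" for x i j
      using \<open>\<forall>i j. _\<close> that unfolding continuous_map_atin limitin_canonical_iff by blast
  qed
qed

lemma carrier_alg_A:
  "a \<in> carrier alg_A \<longleftrightarrow> a \<in> extensional (topspace Xt) \<and>
    (\<forall>i j. continuous_map Xt euclidean (\<lambda>x. a x $ i $ j)) \<and>
     (\<exists>(lam :: nat \<Rightarrow> complex) l. lam \<longlonglongrightarrow> l \<and>
       (\<forall>n\<ge>1. a (Some (real n)) = diag2 (lam n) (lam (n + 1))) \<and>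
       a None = diag2 l l)"
  by (simp add: alg_A_def alg_B_def continuous_m2_iff)

lemma continuous_restrict_m2_iff:
  "(\<forall>i j. continuous_map Xt euclidean (\<lambda>x. restrict f (topspace Xt) x $ i $ j)) \<longleftrightarrow>
   (\<forall>i j. continuous_map Xt euclidean (\<lambda>x. (f x :: m2) $ i $ j))"
  using continuous_m2_iff[of Xt f] continuous_m2_iff[of Xt "restrict f (topspace Xt)"]
    continuous_restrict_iff[of f] by blast

lemma alg_A_intro:
  assumes "\<And>i j. continuous_map Xt euclidean (\<lambda>x. (f x :: m2) $ i $ j)"
   "lam \<longlonglongrightarrow> l" "\<And>n. n\<ge>1 \<Longrightarrow> f (Some (real n)) = diag2 (lam n) (lam (n + 1))" "f None = diag2 l l"
  shows "restrict f (topspace Xt) \<in> carrier alg_A"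
  unfolding carrier_alg_A continuous_restrict_m2_iff
proof (intro conjI exI)
  show "\<forall>n\<ge>1. restrict f (topspace Xt) (Some (real n)) = diag2 (lam n) (lam (n + 1))"
    using assms(3) by (simp add: topspace_Xt)
  show "restrict f (topspace Xt) None = diag2 l l"
    using assms(4) by (simp add: topspace_Xt)
qed (use assms(1,2) in simp_all)

lemma alg_A_elim:
  assumes "x \<in> carrier alg_A"
  obtains p pl where "\<And>i j. continuous_map Xt euclidean (\<lambda>t. x t $ i $ j)"
    "p \<longlonglongrightarrow> pl" "\<And>n. n \<ge> 1 \<Longrightarrow> x (Some (real n)) = diag2 (p n) (p (n + 1))" "x None = diag2 pl pl"
  using assms unfolding carrier_alg_A by blast

lemma alg_A_mult_closed:
  assumes "x \<in> carrier alg_A" "y \<in> carrier alg_A"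
  shows "x \<otimes>\<^bsub>alg_A\<^esub> y \<in> carrier alg_A"
proof (rule alg_A_elim[OF assms(1)], rule alg_A_elim[OF assms(2)])
  fix p pl q ql
  assume x: "\<And>i j. continuous_map Xt euclidean (\<lambda>t. x t $ i $ j)"
    "p \<longlonglongrightarrow> pl" "\<And>n. n \<ge> 1 \<Longrightarrow> x (Some (real n)) = diag2 (p n) (p (n + 1))" "x None = diag2 pl pl"
  assume y: "\<And>i j. continuous_map Xt euclidean (\<lambda>t. y t $ i $ j)"
    "q \<longlonglongrightarrow> ql" "\<And>n. n \<ge> 1 \<Longrightarrow> y (Some (real n)) = diag2 (q n) (q (n + 1))" "y None = diag2 ql ql"
  show ?thesis
    unfolding alg_A_sel
  proof (rule alg_A_intro)
    show "continuous_map Xt euclidean (\<lambda>t. (x t ** y t) $ i $ j)" for i j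
      using x(1) y(1) unfolding mult_m2_nth continuous_map_atin limitin_canonical_iff
      by (intro ballI tendsto_add tendsto_mult tendsto_cnj tendsto_const) auto
    show "(\<lambda>n. p n * q n) \<longlonglongrightarrow> pl * ql"
      by (intro tendsto_mult x y)
  qed (simp_all add: x(3,4) y(3,4) diag2_arith)
qed

lemma alg_A_add_closed:
  assumes "x \<in> carrier alg_A" "y \<in> carrier alg_A"
  shows "x \<oplus>\<^bsub>alg_A\<^esub> y \<in> carrier alg_A"
proof (rule alg_A_elim[OF assms(1)], rule alg_A_elim[OF assms(2)])
  fix p pl q ql
  assume x: "\<And>i j. continuous_map Xt euclidean (\<lambda>t. x t $ i $ j)"
    "p \<longlonglongrightarrow> pl" "\<And>n. n \<ge> 1 \<Longrightarrow> x (Some (real n)) = diag2 (p n) (p (n + 1))" "x None = diag2 pl pl"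
  assume y: "\<And>i j. continuous_map Xt euclidean (\<lambda>t. y t $ i $ j)"
    "q \<longlonglongrightarrow> ql" "\<And>n. n \<ge> 1 \<Longrightarrow> y (Some (real n)) = diag2 (q n) (q (n + 1))" "y None = diag2 ql ql"
  show ?thesis
    unfolding alg_A_sel
  proof (rule alg_A_intro)
    show "continuous_map Xt euclidean (\<lambda>t. (x t + y t) $ i $ j)" for i j
      using x(1) y(1) unfolding vector_add_component continuous_map_atin limitin_canonical_iff
      by (intro ballI tendsto_add tendsto_mult tendsto_cnj tendsto_const) auto
    show "(\<lambda>n. p n + q n) \<longlonglongrightarrow> pl + ql"
      by (intro tendsto_add x y)
  qed (simp_all add: x(3,4) y(3,4) diag2_arith)
qed

lemma alg_A_smult_closed:
  assumes "x \<in> carrier alg_A"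
  shows "c \<odot>\<^bsub>alg_A\<^esub> x \<in> carrier alg_A"
proof (rule alg_A_elim[OF assms])
  fix p pl
  assume x: "\<And>i j. continuous_map Xt euclidean (\<lambda>t. x t $ i $ j)"
    "p \<longlonglongrightarrow> pl" "\<And>n. n \<ge> 1 \<Longrightarrow> x (Some (real n)) = diag2 (p n) (p (n + 1))" "x None = diag2 pl pl"
  show ?thesis
    unfolding alg_A_sel
  proof (rule alg_A_intro)
    show "continuous_map Xt euclidean (\<lambda>t. (\<chi> i j. c * x t $ i $ j) $ i $ j)" for i j
      using x(1) unfolding vec_lambda_beta continuous_map_atin limitin_canonical_iff
      by (intro ballI tendsto_add tendsto_mult tendsto_cnj tendsto_const) auto
    show "(\<lambda>n. c * p n) \<longlonglongrightarrow> c * pl"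
      by (intro tendsto_mult tendsto_const x)
  qed (simp_all only: x(3,4) diag2_arith)
qed

lemma alg_A_adj_closed:
  assumes "x \<in> carrier alg_A"
  shows "adj alg_A x \<in> carrier alg_A"
proof (rule alg_A_elim[OF assms])
  fix p pl
  assume x: "\<And>i j. continuous_map Xt euclidean (\<lambda>t. x t $ i $ j)"
    "p \<longlonglongrightarrow> pl" "\<And>n. n \<ge> 1 \<Longrightarrow> x (Some (real n)) = diag2 (p n) (p (n + 1))" "x None = diag2 pl pl"
  show ?thesis
    unfolding alg_A_sel
  proof (rule alg_A_intro)
    show "continuous_map Xt euclidean (\<lambda>t. (\<chi> i j. cnj (x t $ j $ i)) $ i $ j)" for i j
      using x(1) unfolding vec_lambda_beta continuous_map_atin limitin_canonical_iff
      by (intro ballI tendsto_add tendsto_mult tendsto_cnj tendsto_const) auto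
    show "(\<lambda>n. cnj (p n)) \<longlonglongrightarrow> cnj pl"
      by (intro tendsto_cnj x)
  qed (simp_all only: x(3,4) diag2_arith)
qed

lemma alg_A_zero_closed: "\<zero>\<^bsub>alg_A\<^esub> \<in> carrier alg_A"
  unfolding alg_A_sel
  by (rule alg_A_intro[where lam = "\<lambda>n. 0" and l = 0]) (simp_all add: diag2_arith)

lemma alg_A_one_closed: "\<one>\<^bsub>alg_A\<^esub> \<in> carrier alg_A"
  unfolding alg_A_sel
  by (rule alg_A_intro[where lam = "\<lambda>n. 1" and l = 1]) (simp_all add: diag2_arith)

lemma extensional_alg_A: "x \<in> carrier alg_A \<Longrightarrow> x \<in> extensional (topspace Xt)"
  by (simp add: carrier_alg_A)

lemma ring_alg_A: "ring alg_A"
proof (rule ringI)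
  show "abelian_group alg_A"
  proof (rule abelian_groupI)
    fix x assume x: "x \<in> carrier alg_A"
    show "\<exists>y\<in>carrier alg_A. y \<oplus>\<^bsub>alg_A\<^esub> x = \<zero>\<^bsub>alg_A\<^esub>"
      by (rule bexI[OF _ alg_A_smult_closed[OF x, of "-1"]])
        (auto simp: alg_A_sel fun_eq_iff vec_eq_iff restrict_def)
    show "\<zero>\<^bsub>alg_A\<^esub> \<oplus>\<^bsub>alg_A\<^esub> x = x"
      unfolding alg_A_sel
      by (rule extensionalityI[OF _ extensional_alg_A[OF x]]) auto
  qed (simp_all only: alg_A_add_closed alg_A_zero_closed,
       simp_all add: alg_A_sel fun_eq_iff restrict_def add_ac)
  show "monoid alg_A"
  proof (rule monoidI)
    fix x assume x: "x \<in> carrier alg_A"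
    show "\<one>\<^bsub>alg_A\<^esub> \<otimes>\<^bsub>alg_A\<^esub> x = x" "x \<otimes>\<^bsub>alg_A\<^esub> \<one>\<^bsub>alg_A\<^esub> = x"
      unfolding alg_A_sel
      by (rule extensionalityI[OF _ extensional_alg_A[OF x]]; auto)+
  qed (simp_all only: alg_A_mult_closed alg_A_one_closed,
       simp_all add: alg_A_sel fun_eq_iff restrict_def matrix_mul_assoc)
qed (simp_all add: alg_A_sel fun_eq_iff restrict_def matrix_matrix_mult_def vec_eq_iff sum_2 algebra_simps)

end

theory Submission
  imports Defs
begin

text \<open>
  The connecting order is infinite because the characters \<open>\<lambda>\<^sub>n\<close> form a chain.  Their kernels for
  \<open>n\<close> and \<open>n + 1\<close> cannot be separated, since both are limits of the two-dimensional
  representations at non-integer points near \<open>n\<close>; but every step of a path moves the support by at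
  most 2, as a partition of unity \<open>diag (\<phi> s) (\<phi> (s + 1))\<close> shows together with primeness of the
  kernels.

  An elementary operator acts at \<open>t\<close> by an element of \<open>M\<^sub>2 \<otimes> M\<^sub>2\<close> that depends continuously on
  \<open>t\<close>.  At an integer \<open>n\<close> it lies in \<open>D \<otimes> D\<close>, where \<open>D\<close> is the diagonal algebra, with
  compatible entries \<open>f\<^sub>n, g\<^sub>n, h\<^sub>n, f\<^sub>n\<^sub>+\<^sub>1\<close>, and at infinity it is a scalar.  Conversely every such
  continuous function comes from an elementary operator: after subtracting the scalar one factors
  \<open>z = \<surd>\<bar>z\<bar> \<cdot> (z / \<surd>\<bar>z\<bar>)\<close> and separates \<open>f\<close>, \<open>g\<close>, \<open>h\<close> by cutoffs supported on the residue
  classes modulo 3.  The coefficients at a non-integer \<open>t\<close> are values of the operator at elements of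
  norm at most 1, and the non-integers are dense, so these functions are closed under limits of
  operators.

  The commutator with \<open>(1 / t) e\<^sub>1\<^sub>1\<close> is such an operator.  An element \<open>a\<close> implementing it would
  satisfy \<open>\<lambda>\<^sub>n(a) - \<lambda>\<^sub>n\<^sub>+\<^sub>1(a) = 1 / n\<close>, so \<open>\<lambda>\<^sub>n(a)\<close> would diverge.
\<close>

section \<open>Continuous functions on the compactified half-line\<close>

text \<open>The delicate direction is from continuous functions to finite sums of tensors, because
  both factors of each tensor must lie in the algebra. A coefficient \<open>z\<close> on
  \<open>e_ij \<otimes> e_kl\<close> cannot be split as \<open>z\<close> times 1: a constant matrix
  unit violates the condition at infinity. Both factors have to vanish where \<open>z\<close> does,
  so its modulus is shared evenly between them, and this is why the scalar at infinity is removed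
  beforehand. The modulus 3 comes from the pairs \<open>(u, w)\<close> with entries in
  \<open>{n, n + 1}\<close>: the difference \<open>w - u\<close> is 0, 1 or -1. These are distinct
  modulo 3, while modulo 2 the pairs \<open>(n, n + 1)\<close> and \<open>(n + 1, n)\<close> would
  be confused. A sum over three residues then treats all integers at once, so the number of tensors
  does not grow with the infinitely many prescribed values. As a result the symbols are cut out by
  continuity and pointwise linear equations alone, and such conditions survive uniform
  limits.\<close>

lemma continuous_Xt_iff:
  fixes f :: "real option \<Rightarrow> 'b::topological_space"
  shows "continuous_map Xt euclidean f \<longleftrightarrow>
    continuous_on {1..} (\<lambda>s. f (Some s)) \<and> ((\<lambda>s. f (Some s)) \<longlongrightarrow> f None) at_top"
proof (intro iffI conjI)
  assume f: "continuous_map Xt euclidean f"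
  have "continuous_map (top_of_set {1..}) euclidean (f \<circ> Some)"
    using continuous_map_compose[OF continuous_map_Some f[unfolded Xt_def]] .
  then show "continuous_on {1..} (\<lambda>s. f (Some s))"
    by (simp add: o_def)
  show "((\<lambda>s. f (Some s)) \<longlongrightarrow> f None) at_top"
  proof (rule topological_tendstoI)
    fix U assume U: "open U" "f None \<in> U"
    have "openin Xt {x \<in> topspace Xt. f x \<in> U}"
      using f U openin_continuous_map_preimage by fastforce
    moreover have "None \<in> {x \<in> topspace Xt. f x \<in> U}"
      using U by (simp add: topspace_Xt)
    \<comment> \<open>A neighbourhood of \<open>None\<close> omits only a compact, hence bounded,
      part of the half-line, so it contains a final ray.\<close>
    ultimately obtain C where C: "compactin (top_of_set {1..}) C"
      and eq: "{x \<in> topspace Xt. f x \<in> U} = insert None (Some ` ({1..} - C))"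
      unfolding Xt_def openin_Alexandroff_compactification by auto
    have "bounded C"
      using C by (simp add: compactin_subtopology compact_imp_bounded)
    then obtain B where B: "\<And>x. x \<in> C \<Longrightarrow> \<bar>x\<bar> \<le> B"
      unfolding bounded_iff by auto
    show "\<forall>\<^sub>F s in at_top. f (Some s) \<in> U"
      using eventually_gt_at_top[of "max 1 B"]
    proof eventually_elim
      case (elim s)
      then have "s \<in> {1..} - C"
        using B[of s] by auto
      then have "Some s \<in> {x \<in> topspace Xt. f x \<in> U}"
        unfolding eq by simp
      then show ?case by simp
    qed
  qed
next
  assume *: "continuous_on {1..} (\<lambda>s. f (Some s)) \<and> ((\<lambda>s. f (Some s)) \<longlongrightarrow> f None) at_top"
  show "continuous_map Xt euclidean f"
    unfolding continuous_map_def
  proof (intro conjI allI impI)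
    fix U :: "'b set" assume "openin euclidean U"
    then have U: "open U" by simp
    have op: "openin (top_of_set {1..}) ({1..} \<inter> (\<lambda>s. f (Some s)) -` U)"
      using * U continuous_openin_preimage_gen by blast
    show "openin Xt {x \<in> topspace Xt. f x \<in> U}"
    proof (cases "f None \<in> U")
      case False
      then have "{x \<in> topspace Xt. f x \<in> U} = Some ` ({1..} \<inter> (\<lambda>s. f (Some s)) -` U)"
        by (auto simp: topspace_Xt)
      then show ?thesis
        using op unfolding Xt_def by simp
    next
      case True
      \<comment> \<open>The points of the half-line outside the preimage are relatively closed, and
        the limit at infinity bounds them; together this gives the compact complement that the
        topology asks for.\<close>
      define C where "C = {1..} - ({1..} \<inter> (\<lambda>s. f (Some s)) -` U)"
      have cl: "closedin (top_of_set {1..}) C"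
        unfolding C_def using op by (metis closedin_def double_diff openin_subset order_refl
            openin_closedin_eq topspace_euclidean_subtopology)
      have "\<forall>\<^sub>F s in at_top. f (Some s) \<in> U"
        using * U True topological_tendstoD by blast
      then obtain N where "\<And>s. s \<ge> N \<Longrightarrow> f (Some s) \<in> U"
        unfolding eventually_at_top_linorder by blast
      then have sub: "C \<subseteq> {1..N}"
        unfolding C_def by (auto simp: not_le[symmetric])
      have "closed C"
        using cl closedin_closed_trans closed_atLeast by blast
      then have "compact C"
        using sub bounded_subset compact_eq_bounded_closed bounded_closed_interval by blast
      then have "compactin (top_of_set {1..}) C"
        using sub by (auto simp: compactin_subtopology C_def)
      moreover have "{x \<in> topspace Xt. f x \<in> U} = insert None (Some ` ({1..} - C))"
        using True by (auto simp: topspace_Xt C_def)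
      ultimately show ?thesis
        using cl unfolding Xt_def openin_Alexandroff_compactification by auto
    qed
  qed simp
qed

text \<open>A single sequence serves every continuous \<open>f\<close>, so several matrix entries
  can be passed to the limit along it simultaneously. Non-integers matter because there the algebra
  attains every 2 by 2 matrix.\<close>

lemma Xt_nonintegers_dense:
  assumes "t \<in> topspace Xt"
  obtains s where "\<And>k::nat. s k > 1" "\<And>k. s k \<notin> \<int>"
    "\<And>f :: real option \<Rightarrow> complex. continuous_map Xt euclidean f \<Longrightarrow> (\<lambda>k. f (Some (s k))) \<longlonglongrightarrow> f t"
proof (cases t)
  case None
  have "(\<lambda>k. f (Some (real k + 3/2))) \<longlonglongrightarrow> f t" if "continuous_map Xt euclidean f"
    for f :: "real option \<Rightarrow> complex"
  proof -
    have "((\<lambda>s. f (Some s)) \<longlongrightarrow> f t) at_top"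
      using that None by (simp add: continuous_Xt_iff)
    moreover have "filterlim (\<lambda>k. real k + 3/2) at_top sequentially"
      by (rule filterlim_at_top_mono[OF filterlim_real_sequentially]) simp
    ultimately show ?thesis
      by (rule filterlim_compose)
  qed
  moreover have "real k + 3/2 \<notin> \<int>" for k
  proof
    assume "real k + 3/2 \<in> \<int>"
    then obtain i :: int where "real k + 3/2 = of_int i"
      by (auto elim: Ints_cases)
    then have "real_of_int (2 * int k + 3) = real_of_int (2 * i)"
      by simp
    then have "2 * int k + 3 = 2 * i"
      by linarith
    then show False by presburger
  qed
  ultimately show ?thesis
    using that[of "\<lambda>k. real k + 3/2"] by simp
next
  case (Some r)
  then have r: "r \<ge> 1"
    using assms by (auto simp: topspace_Xt)
  \<comment> \<open>The distance from \<open>r\<close> to the next integer on its right. Approaching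
    from the right keeps the sequence above 1 even for \<open>r = 1\<close>, and the denominators
    \<open>k + 2\<close> keep it strictly below that integer.\<close>
  define \<epsilon> where "\<epsilon> = 1 - frac r"
  have eps: "\<epsilon> > 0"
    unfolding \<epsilon>_def using frac_lt_1[of r] by simp
  define s where "s k = r + \<epsilon> / (real k + 2)" for k
  have lt: "0 < \<epsilon> / (real k + 2)" "\<epsilon> / (real k + 2) < \<epsilon>" for k
    using eps by (simp_all add: field_simps add_pos_nonneg)
  have "s k \<notin> \<int>" for k
  proof
    assume "s k \<in> \<int>"
    then obtain i :: int where i: "s k = of_int i"
      by (auto elim: Ints_cases)
    have "of_int \<lfloor>r\<rfloor> < s k" "s k < of_int \<lfloor>r\<rfloor> + 1"
      using lt[of k] unfolding s_def \<epsilon>_def frac_def by linarith+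
    then have "\<lfloor>r\<rfloor> < i \<and> i < \<lfloor>r\<rfloor> + 1"
      unfolding i by (metis of_int_1 of_int_add of_int_less_iff)
    then show False
      by linarith
  qed
  moreover have "(\<lambda>k. f (Some (s k))) \<longlonglongrightarrow> f t" if "continuous_map Xt euclidean f"
    for f :: "real option \<Rightarrow> complex"
  proof -
    have "continuous_on {1..} (\<lambda>s. f (Some s))"
      using that by (simp add: continuous_Xt_iff)
    moreover have "s \<longlonglongrightarrow> r"
    proof -
      have "(\<lambda>k. \<epsilon> / (real k + 2)) \<longlonglongrightarrow> 0"
        by (rule tendsto_divide_0[OF tendsto_const])
          (auto intro!: filterlim_at_top_imp_at_infinity
            filterlim_at_top_mono[OF filterlim_real_sequentially])
      then show ?thesis
        unfolding s_def using tendsto_add[OF tendsto_const, of _ 0 _ r] by fastforce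
    qed
    moreover have "s k \<ge> 1" for k
      using lt[of k] r unfolding s_def by linarith
    ultimately show ?thesis
      using Some r continuous_on_tendsto_compose[of "{1..}" "\<lambda>s. f (Some s)" s r sequentially] by simp
  qed
  moreover have "s k > 1" for k
    using lt[of k] r unfolding s_def by linarith
  ultimately show ?thesis
    using that by blast
qed

section \<open>Elements of the algebra with prescribed values\<close>

lemma alg_A_memI:
  fixes f :: "real option \<Rightarrow> m2"
  assumes cont: "\<And>i j. continuous_map Xt euclidean (\<lambda>t. f t $ i $ j)"
    and off: "\<And>n::nat. n \<ge> 1 \<Longrightarrow> f (Some n) $ 1 $ 2 = 0" "\<And>n::nat. n \<ge> 1 \<Longrightarrow> f (Some n) $ 2 $ 1 = 0"
    and shift: "\<And>n::nat. n \<ge> 1 \<Longrightarrow> f (Some n) $ 2 $ 2 = f (Some (real n + 1)) $ 1 $ 1"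
    and None: "f None = diag2 l l"
  shows "restrict f (topspace Xt) \<in> carrier alg_A"
proof (rule alg_A_intro[OF cont])
  \<comment> \<open>The sequence required by the algebra is that of the upper entries; its
    convergence is already contained in continuity at infinity.\<close>
  have "((\<lambda>s. f (Some s) $ 1 $ 1) \<longlongrightarrow> f None $ 1 $ 1) at_top"
    using cont[of 1 1] by (simp add: continuous_Xt_iff)
  then show "(\<lambda>n. f (Some (real n)) $ 1 $ 1) \<longlonglongrightarrow> l"
    using filterlim_compose[OF _ filterlim_real_sequentially] unfolding None diag2_def by auto
  show "f (Some (real n)) = diag2 (f (Some (real n)) $ 1 $ 1) (f (Some (real (n + 1))) $ 1 $ 1)"
    if "n \<ge> 1" for n
    using off[of n] shift[of n] that by (simp add: vec_eq_iff forall_2 diag2_def add.commute)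
qed fact

lemma diag2_nth: "diag2 z w $ i $ j = (if i = j then if i = 1 then z else w else 0)"
  using exhaust_2[of i] exhaust_2[of j] by (auto simp: diag2_def)

lemma
  assumes "a \<in> carrier alg_A"
  shows alg_A_continuous: "continuous_map Xt euclidean (\<lambda>t. a t $ i $ j)"
    and alg_A_off_diag: "n \<ge> 1 \<Longrightarrow> i \<noteq> j \<Longrightarrow> a (Some (real n)) $ i $ j = 0"
    and alg_A_shift: "n \<ge> 1 \<Longrightarrow> a (Some (real n)) $ 2 $ 2 = a (Some (real n + 1)) $ 1 $ 1"
    and alg_A_None: "a None $ i $ j = (if i = j then a None $ 1 $ 1 else 0)"
proof -
  obtain p pl where x: "\<And>i j. continuous_map Xt euclidean (\<lambda>t. a t $ i $ j)"
    "p \<longlonglongrightarrow> pl" "\<And>n. n \<ge> 1 \<Longrightarrow> a (Some (real n)) = diag2 (p n) (p (n + 1))" "a None = diag2 pl pl"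
    using alg_A_elim[OF assms] by metis
  show "continuous_map Xt euclidean (\<lambda>t. a t $ i $ j)"
    by (rule x)
  show "n \<ge> 1 \<Longrightarrow> i \<noteq> j \<Longrightarrow> a (Some (real n)) $ i $ j = 0"
    by (simp add: x(3) diag2_nth)
  show "n \<ge> 1 \<Longrightarrow> a (Some (real n)) $ 2 $ 2 = a (Some (real n + 1)) $ 1 $ 1"
    using x(3)[of n] x(3)[of "n + 1"] by (simp add: diag2_nth add.commute)
  show "a None $ i $ j = (if i = j then a None $ 1 $ 1 else 0)"
    by (simp add: x(4) diag2_nth)
qed

text \<open>Shifting the argument in the lower corner makes the compatibility between
  \<open>n\<close> and \<open>n + 1\<close> automatic, for any \<open>\<phi>\<close>.\<close>

definition diag_element :: "(real \<Rightarrow> complex) \<Rightarrow> real option \<Rightarrow> m2" where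
  "diag_element \<phi> = (\<lambda>t\<in>topspace Xt. case t of None \<Rightarrow> 0 | Some s \<Rightarrow> diag2 (\<phi> s) (\<phi> (s + 1)))"

lemma diag_element_simps:
  "diag_element \<phi> None = 0"
  "s \<ge> 1 \<Longrightarrow> diag_element \<phi> (Some s) = diag2 (\<phi> s) (\<phi> (s + 1))"
  by (simp_all add: diag_element_def topspace_Xt)

lemma diag_element_closed:
  assumes "continuous_on {1..} \<phi>" "(\<phi> \<longlongrightarrow> 0) at_top"
  shows "diag_element \<phi> \<in> carrier alg_A"
  unfolding diag_element_def
proof (rule alg_A_memI[where l = 0])
  have c: "continuous_on {1..} (\<lambda>s. \<phi> (s + 1))"
    by (rule continuous_on_compose2[OF assms(1)]) (auto intro!: continuous_intros)
  have "filterlim (\<lambda>s::real. s + 1) at_top at_top"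
    by (rule filterlim_at_top_mono[OF filterlim_ident]) simp
  then have l: "((\<lambda>s. \<phi> (s + 1)) \<longlongrightarrow> 0) at_top"
    by (rule filterlim_compose[OF assms(2)])
  show "continuous_map Xt euclidean
    (\<lambda>t. (case t of None \<Rightarrow> 0 | Some s \<Rightarrow> diag2 (\<phi> s) (\<phi> (s + 1))) $ i $ j)" for i j
    using assms c l by (cases "i = j"; cases "i = 1") (auto simp: continuous_Xt_iff diag2_nth)
qed (simp_all add: diag2_nth diag2_arith)

definition matrix_unit :: "2 \<Rightarrow> 2 \<Rightarrow> complex \<Rightarrow> m2" where
  "matrix_unit i j z = (\<chi> i' j'. if i' = i \<and> j' = j then z else 0)"

lemma matrix_unit_nth: "matrix_unit i j z $ i' $ j' = (if i' = i \<and> j' = j then z else 0)"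
  by (simp add: matrix_unit_def)

definition unit_element :: "2 \<Rightarrow> 2 \<Rightarrow> (real option \<Rightarrow> complex) \<Rightarrow> real option \<Rightarrow> m2" where
  "unit_element i j \<phi> = (\<lambda>t\<in>topspace Xt. matrix_unit i j (\<phi> t))"

lemma unit_element_nth:
  "t \<in> topspace Xt \<Longrightarrow> unit_element i j \<phi> t $ i' $ j' = (if i' = i \<and> j' = j then \<phi> t else 0)"
  by (simp add: unit_element_def matrix_unit_nth)

lemma unit_element_closed:
  assumes "continuous_map Xt euclidean \<phi>" "\<phi> None = 0" "\<And>n::nat. n \<ge> 1 \<Longrightarrow> \<phi> (Some n) = 0"
  shows "unit_element i j \<phi> \<in> carrier alg_A"
  unfolding unit_element_def
proof (rule alg_A_memI[where l = 0])
  show "continuous_map Xt euclidean (\<lambda>t. matrix_unit i j (\<phi> t) $ i' $ j')" for i' j'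
    unfolding matrix_unit_nth using assms(1) by (cases "i' = i \<and> j' = j") auto
qed (use assms(3)[of "_ + 1"] in \<open>simp_all add: assms matrix_unit_nth vec_eq_iff diag2_nth add.commute\<close>)

text \<open>A tent around \<open>s\<close> whose radius is the distance from \<open>s\<close> to the
  integers. Through \<open>unit_element\<close> it realises each matrix unit at \<open>s\<close> by
  an element of the algebra; the bound 1 is what lets such elements be inserted into a cb-norm
  estimate.\<close>

lemma bump_exists:
  fixes s :: real
  assumes "s \<notin> \<int>"
  obtains \<phi> :: "real option \<Rightarrow> complex" where
    "continuous_map Xt euclidean \<phi>" "\<phi> None = 0" "\<And>n::nat. \<phi> (Some n) = 0" "\<phi> (Some s) = 1"
    "\<And>t. cmod (\<phi> t) \<le> 1"
proof -
  define r where "r = infdist s \<int>"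
  have r: "r > 0"
    using assms infdist_pos_not_in_closed[OF closed_Ints, of s] unfolding r_def
    by (metis Ints_0 empty_iff)
  define \<psi> where "\<psi> u = max 0 (1 - \<bar>u - s\<bar> / r)" for u
  define \<phi> where "\<phi> t = (case t of None \<Rightarrow> 0 | Some u \<Rightarrow> complex_of_real (\<psi> u))" for t
  show ?thesis
  proof (rule that[of \<phi>])
    have "\<forall>\<^sub>F u in at_top. \<psi> u = 0"
      using eventually_gt_at_top[of "s + r"]
      by eventually_elim (use r in \<open>auto simp: \<psi>_def field_simps\<close>)
    then have "\<forall>\<^sub>F u in at_top. complex_of_real (\<psi> u) = 0"
      by eventually_elim simp
    then have "((\<lambda>u. complex_of_real (\<psi> u)) \<longlongrightarrow> 0) at_top"
      by (rule tendsto_eventually)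
    moreover have "continuous_on {1..} (\<lambda>u. complex_of_real (\<psi> u))"
      unfolding \<psi>_def using r by (intro continuous_intros) auto
    ultimately show "continuous_map Xt euclidean \<phi>"
      by (simp add: continuous_Xt_iff \<phi>_def)
    show "\<phi> (Some n) = 0" for n :: nat
    proof -
      have "r \<le> dist s (real n)"
        unfolding r_def by (rule infdist_le) simp
      then show ?thesis
        using r by (simp add: \<phi>_def \<psi>_def dist_real_def field_simps abs_minus_commute)
    qed
    show "\<phi> (Some s) = 1"
      by (simp add: \<phi>_def \<psi>_def)
    show "cmod (\<phi> t) \<le> 1" for t
      using r by (auto simp: \<phi>_def \<psi>_def split: option.split)
  qed (simp add: \<phi>_def)
qed

section \<open>Norms of block matrices\<close>

text \<open>A substitute for the operator norm of a 2 by 2 matrix: it dominates that norm and is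
  visibly continuous in the entries.\<close>

definition entry_sum :: "m2 \<Rightarrow> real" where
  "entry_sum M = (\<Sum>i\<in>UNIV. \<Sum>j\<in>UNIV. cmod (M $ i $ j))"

lemma entry_sum_nonneg: "0 \<le> entry_sum M"
  by (simp add: entry_sum_def sum_nonneg)

lemma norm_mult_vec_le: "norm (M *v v) \<le> entry_sum M * norm (v :: complex^2)"
proof -
  have "norm (M *v v) \<le> (\<Sum>i\<in>UNIV. norm ((M *v v) $ i))"
    unfolding norm_vec_def by (rule L2_set_le_sum) simp
  also have "\<dots> \<le> (\<Sum>i\<in>UNIV. \<Sum>j\<in>UNIV. cmod (M $ i $ j) * norm v)"
  proof (rule sum_mono)
    fix i :: 2
    have "norm ((M *v v) $ i) \<le> (\<Sum>j\<in>UNIV. cmod (M $ i $ j * v $ j))"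
      unfolding matrix_vector_mult_def by (simp add: norm_sum)
    also have "\<dots> \<le> (\<Sum>j\<in>UNIV. cmod (M $ i $ j) * norm v)"
      by (intro sum_mono) (simp add: norm_mult mult_left_mono Finite_Cartesian_Product.norm_nth_le)
    finally show "norm ((M *v v) $ i) \<le> (\<Sum>j\<in>UNIV. cmod (M $ i $ j) * norm v)" .
  qed
  finally show ?thesis
    by (simp add: entry_sum_def sum_distrib_right)
qed

text \<open>Compactness of \<open>Xt\<close>. This is what makes the supremum over all points in
  \<open>mat_norm\<close> finite.\<close>

lemma entry_sum_bounded:
  assumes "\<And>i j. continuous_map Xt euclidean (\<lambda>t. a t $ i $ j)"
  obtains K where "K \<ge> 0" "\<And>t. t \<in> topspace Xt \<Longrightarrow> entry_sum (a t) \<le> K"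
proof -
  have "continuous_map Xt euclidean (\<lambda>t. entry_sum (a t))"
    using assms unfolding entry_sum_def continuous_map_atin limitin_canonical_iff
    by (intro ballI tendsto_sum tendsto_norm) auto
  moreover have "compactin Xt (topspace Xt)"
    using compact_space_Alexandroff_compactification unfolding Xt_def compact_space_def by blast
  ultimately have "compact ((\<lambda>t. entry_sum (a t)) ` topspace Xt)"
    using image_compactin by fastforce
  then have "bounded ((\<lambda>t. entry_sum (a t)) ` topspace Xt)"
    by (rule compact_imp_bounded)
  then obtain K where K: "\<And>t. t \<in> topspace Xt \<Longrightarrow> \<bar>entry_sum (a t)\<bar> \<le> K"
    unfolding bounded_iff by auto
  show ?thesis
  proof (rule that[of "max K 0"])
    show "entry_sum (a t) \<le> max K 0" if "t \<in> topspace Xt" for t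
      using K[OF that] by linarith
  qed simp
qed

text \<open>\<open>block_norm\<close> is a supremum of reals, so it is an upper bound only after the
  set behind it has been bounded.\<close>

lemma block_vec_le:
  fixes n :: nat
  assumes "L2_set (\<lambda>j. norm (v j)) {..<n} \<le> 1"
  shows "L2_set (\<lambda>i. norm (\<Sum>j<n. M i j *v v j)) {..<n} \<le> (\<Sum>i<n. \<Sum>j<n. entry_sum (M i j))"
proof -
  have "L2_set (\<lambda>i. norm (\<Sum>j<n. M i j *v v j)) {..<n} \<le> (\<Sum>i<n. norm (\<Sum>j<n. M i j *v v j))"
    by (rule L2_set_le_sum) simp
  also have "\<dots> \<le> (\<Sum>i<n. \<Sum>j<n. entry_sum (M i j))"
  proof (intro sum_mono order_trans[OF norm_sum])
    fix i j assume "j \<in> {..<n}"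
    then have "norm (v j) \<le> 1"
      using member_le_L2_set[OF finite_lessThan, of j n "\<lambda>j. norm (v j)"] assms by linarith
    then have "entry_sum (M i j) * norm (v j) \<le> entry_sum (M i j)"
      using mult_left_mono[OF _ entry_sum_nonneg, of "norm (v j)" 1] by simp
    then show "norm (M i j *v v j) \<le> entry_sum (M i j)"
      using norm_mult_vec_le order_trans by blast
  qed
  finally show ?thesis .
qed

lemma block_norm_upper:
  assumes "L2_set (\<lambda>j. norm (v j)) {..<n} \<le> 1"
  shows "L2_set (\<lambda>i. norm (\<Sum>j<n. M i j *v v j)) {..<n} \<le> block_norm n M"
  unfolding block_norm_def
proof (rule cSUP_upper)
  show "v \<in> {v. L2_set (\<lambda>j. norm (v j)) {..<n} \<le> 1}"
    using assms by simp
  show "bdd_above ((\<lambda>v. L2_set (\<lambda>i. norm (\<Sum>j<n. M i j *v v j)) {..<n})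
      ` {v. L2_set (\<lambda>j. norm (v j)) {..<n} \<le> 1})"
    by (rule bdd_aboveI2[OF block_vec_le]) simp
qed

lemma block_norm_least:
  assumes "\<And>v. L2_set (\<lambda>j. norm (v j)) {..<n} \<le> 1 \<Longrightarrow>
    L2_set (\<lambda>i. norm (\<Sum>j<n. M i j *v v j)) {..<n} \<le> c"
  shows "block_norm n M \<le> c"
  unfolding block_norm_def
proof (rule cSUP_least)
  show "{v :: nat \<Rightarrow> complex^2. L2_set (\<lambda>j. norm (v j)) {..<n} \<le> 1} \<noteq> {}"
    by (auto intro!: exI[of _ "\<lambda>_. 0"] simp: L2_set_0')
qed (use assms in auto)

lemma block_norm_nonneg: "0 \<le> block_norm n M"
  using block_norm_upper[of "\<lambda>_. 0" n M] by (auto simp: L2_set_0')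

lemma block_norm_le_entry_sum: "block_norm n M \<le> (\<Sum>i<n. \<Sum>j<n. entry_sum (M i j))"
  by (rule block_norm_least) (rule block_vec_le)

text \<open>The homogeneous form, for vectors such as \<open>b *v v j\<close> that need not lie in
  the unit ball.\<close>

lemma block_norm_scaled:
  shows "L2_set (\<lambda>i. norm (\<Sum>j<n. M i j *v v j)) {..<n} \<le> block_norm n M * L2_set (\<lambda>j. norm (v j)) {..<n}"
    (is "?l v \<le> _ * ?r v")
proof (cases "?r v = 0")
  case True
  then have "\<And>j. j < n \<Longrightarrow> v j = 0"
    by (simp add: L2_set_eq_0_iff)
  then have "?l v = 0"
    by (intro L2_set_0') simp
  with True show ?thesis by simp
next
  case False
  define c where "c = ?r v"
  have c: "c > 0"
    using False L2_set_nonneg[of "\<lambda>j. norm (v j)" "{..<n}"] unfolding c_def by linarith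
  define k where "k = inverse c"
  have k: "k \<ge> 0" "k * c = 1"
    using c by (simp_all add: k_def)
  have sc: "M i j *v (k *\<^sub>R v j) = k *\<^sub>R (M i j *v v j)" for i j
    by (simp add: matrix_vector_mult_def vec_eq_iff scaleR_sum_right)
  have "?r (\<lambda>j. k *\<^sub>R v j) = 1"
    using k by (simp add: L2_set_right_distrib[symmetric] c_def[symmetric])
  then have "?l (\<lambda>j. k *\<^sub>R v j) \<le> block_norm n M"
    by (intro block_norm_upper) simp
  moreover have "?l (\<lambda>j. k *\<^sub>R v j) = k * ?l v"
    unfolding sc scaleR_sum_right[symmetric] using k by (simp add: L2_set_right_distrib[symmetric])
  ultimately have "c * (k * ?l v) \<le> c * block_norm n M"
    using c by (intro mult_left_mono) auto
  moreover have "c * (k * x) = x" for x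
    using k(2) by (metis mult.assoc mult.commute mult_1)
  ultimately show ?thesis
    unfolding c_def[symmetric] by (simp only: mult.commute[of c "block_norm n M"])
qed

lemma block_norm_add: "block_norm n (\<lambda>i j. M i j + N i j) \<le> block_norm n M + block_norm n N"
proof (rule block_norm_least)
  fix v :: "nat \<Rightarrow> complex^2" assume v: "L2_set (\<lambda>j. norm (v j)) {..<n} \<le> 1"
  have "L2_set (\<lambda>i. norm (\<Sum>j<n. (M i j + N i j) *v v j)) {..<n}
    \<le> L2_set (\<lambda>i. norm (\<Sum>j<n. M i j *v v j) + norm (\<Sum>j<n. N i j *v v j)) {..<n}"
    by (intro L2_set_mono)
      (simp_all add: matrix_vector_mult_add_rdistrib sum.distrib norm_triangle_ineq)
  also have "\<dots> \<le> L2_set (\<lambda>i. norm (\<Sum>j<n. M i j *v v j)) {..<n} + L2_set (\<lambda>i. norm (\<Sum>j<n. N i j *v v j)) {..<n}"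
    by (rule L2_set_triangle_ineq)
  also have "\<dots> \<le> block_norm n M + block_norm n N"
    by (intro add_mono block_norm_upper v)
  finally show "L2_set (\<lambda>i. norm (\<Sum>j<n. (M i j + N i j) *v v j)) {..<n} \<le> block_norm n M + block_norm n N" .
qed

lemma block_norm_minus: "block_norm n (\<lambda>i j. - M i j) = block_norm n M"
proof -
  have "(- A) *v (v :: complex^2) = - (A *v v)" for A :: m2 and v
    by (simp add: matrix_vector_mult_def vec_eq_iff sum_negf)
  then show ?thesis
    by (simp add: block_norm_def sum_negf)
qed

text \<open>The same \<open>a\<close> and \<open>b\<close> act on each of the \<open>n\<close>
  summands, so the constant does not depend on \<open>n\<close>. This uniformity is the source of
  complete boundedness.\<close>

lemma block_norm_sandwich:
  "block_norm n (\<lambda>i j. a ** M i j ** b) \<le> entry_sum a * entry_sum b * block_norm n M"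
proof (rule block_norm_least)
  fix v :: "nat \<Rightarrow> complex^2" assume v: "L2_set (\<lambda>j. norm (v j)) {..<n} \<le> 1"
  have eq: "(\<Sum>j<n. (a ** M i j ** b) *v v j) = a *v (\<Sum>j<n. M i j *v (b *v v j))" for i
    by (simp add: matrix_vector_mul_assoc matrix_mul_assoc linear_sum[OF bounded_linear.linear[OF matrix_vector_mul_bounded_linear]])
  have "L2_set (\<lambda>i. norm (\<Sum>j<n. (a ** M i j ** b) *v v j)) {..<n}
    \<le> L2_set (\<lambda>i. entry_sum a * norm (\<Sum>j<n. M i j *v (b *v v j))) {..<n}"
    unfolding eq by (intro L2_set_mono norm_mult_vec_le) simp
  also have "\<dots> = entry_sum a * L2_set (\<lambda>i. norm (\<Sum>j<n. M i j *v (b *v v j))) {..<n}"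
    by (rule L2_set_right_distrib[OF entry_sum_nonneg, symmetric])
  also have "\<dots> \<le> entry_sum a * (block_norm n M * L2_set (\<lambda>j. norm (b *v v j)) {..<n})"
    by (intro mult_left_mono block_norm_scaled entry_sum_nonneg)
  also have "\<dots> \<le> entry_sum a * (block_norm n M * (entry_sum b * 1))"
  proof (intro mult_left_mono entry_sum_nonneg block_norm_nonneg)
    have "L2_set (\<lambda>j. norm (b *v v j)) {..<n} \<le> L2_set (\<lambda>j. entry_sum b * norm (v j)) {..<n}"
      by (intro L2_set_mono norm_mult_vec_le) simp
    also have "\<dots> = entry_sum b * L2_set (\<lambda>j. norm (v j)) {..<n}"
      by (rule L2_set_right_distrib[OF entry_sum_nonneg, symmetric])
    also have "\<dots> \<le> entry_sum b * 1"
      by (intro mult_left_mono v entry_sum_nonneg)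
    finally show "L2_set (\<lambda>j. norm (b *v v j)) {..<n} \<le> entry_sum b * 1" .
  qed
  finally show "L2_set (\<lambda>i. norm (\<Sum>j<n. (a ** M i j ** b) *v v j)) {..<n}
    \<le> entry_sum a * entry_sum b * block_norm n M"
    by (simp add: mult_ac)
qed

lemma entry_le_block_norm: "cmod (M $ i $ j) \<le> block_norm 1 (\<lambda>_ _. M)"
proof -
  have "cmod (M $ i $ j) = norm ((M *v axis j 1) $ i)"
    by (simp add: matrix_vector_mult_def axis_def if_distrib cong: if_cong)
  also have "\<dots> \<le> norm (M *v axis j 1)"
    by (rule Finite_Cartesian_Product.norm_nth_le)
  also have "\<dots> \<le> block_norm 1 (\<lambda>_ _. M)"
    using block_norm_upper[of "\<lambda>_. axis j 1" 1 "\<lambda>_ _. M"]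
    by (simp add: norm_axis_1 L2_set_def lessThan_Suc)
  finally show ?thesis .
qed

section \<open>Norms and subtraction in the algebra\<close>

lemma alg_A_mat_norm: "mat_norm alg_A n a = (SUP t\<in>topspace Xt. block_norm n (\<lambda>i j. a i j t))"
  by (simp add: alg_A_def alg_B_def)

lemma Xt_nonempty: "topspace Xt \<noteq> {}"
  by (simp add: topspace_Xt)

lemma block_norm_le_mat_norm:
  assumes "\<And>i j. i < n \<Longrightarrow> j < n \<Longrightarrow> a i j \<in> carrier alg_A" "t \<in> topspace Xt"
  shows "block_norm n (\<lambda>i j. a i j t) \<le> mat_norm alg_A n a"
  unfolding alg_A_mat_norm
proof (rule cSUP_upper[OF assms(2)])
  have "\<exists>K. \<forall>t\<in>topspace Xt. entry_sum (a i j t) \<le> K" if "i < n" "j < n" for i j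
    using entry_sum_bounded[OF alg_A_continuous[OF assms(1)[OF that]]] by metis
  then obtain K where K: "\<And>i j t. i < n \<Longrightarrow> j < n \<Longrightarrow> t \<in> topspace Xt \<Longrightarrow> entry_sum (a i j t) \<le> K i j"
    by metis
  show "bdd_above ((\<lambda>t. block_norm n (\<lambda>i j. a i j t)) ` topspace Xt)"
  proof (rule bdd_aboveI2)
    fix t assume "t \<in> topspace Xt"
    then show "block_norm n (\<lambda>i j. a i j t) \<le> (\<Sum>i<n. \<Sum>j<n. K i j)"
      by (intro order_trans[OF block_norm_le_entry_sum] sum_mono) (simp add: K)
  qed
qed

lemma mat_norm_least:
  "(\<And>t. t \<in> topspace Xt \<Longrightarrow> block_norm n (\<lambda>i j. a i j t) \<le> c) \<Longrightarrow> mat_norm alg_A n a \<le> c"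
  unfolding alg_A_mat_norm by (rule cSUP_least[OF Xt_nonempty])

lemma entry_le_norm:
  assumes "a \<in> carrier alg_A" "t \<in> topspace Xt"
  shows "cmod (a t $ i $ j) \<le> cstar_norm alg_A a"
  unfolding cstar_norm_def
  by (rule order_trans[OF entry_le_block_norm block_norm_le_mat_norm]) (rule assms)+

text \<open>Subtraction in a ring structure is derived from additive inverses, so its pointwise form
  is recovered from their uniqueness.\<close>

lemma alg_A_minus:
  assumes "x \<in> carrier alg_A" "y \<in> carrier alg_A"
  shows "x \<ominus>\<^bsub>alg_A\<^esub> y = (\<lambda>t\<in>topspace Xt. x t - y t)"
proof -
  interpret A: ring alg_A by (rule ring_alg_A)
  define z where "z = (\<lambda>t\<in>topspace Xt. - y t)"
  have z: "z = (-1) \<odot>\<^bsub>alg_A\<^esub> y"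
    by (simp add: z_def alg_A_sel vec_eq_iff fun_eq_iff restrict_def)
  have "z \<oplus>\<^bsub>alg_A\<^esub> y = \<zero>\<^bsub>alg_A\<^esub>"
    by (simp add: z_def alg_A_sel fun_eq_iff restrict_def)
  moreover have "z \<in> carrier alg_A"
    unfolding z using alg_A_smult_closed assms by blast
  ultimately have "\<ominus>\<^bsub>alg_A\<^esub> y = z"
    using assms(2) A.minus_equality by blast
  then show ?thesis
    by (simp add: a_minus_def z_def alg_A_sel fun_eq_iff restrict_def)
qed

lemma alg_A_minus_closed:
  "x \<in> carrier alg_A \<Longrightarrow> y \<in> carrier alg_A \<Longrightarrow> x \<ominus>\<^bsub>alg_A\<^esub> y \<in> carrier alg_A"
  by (rule abelian_group.minus_closed[OF ring.is_abelian_group[OF ring_alg_A]])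

section \<open>The primitive ideal space\<close>

lemma l2_add:
  assumes "v \<in> l2 S" "w \<in> l2 S"
  shows "(\<lambda>i. v i + w i) \<in> l2 S"
proof -
  have "(\<lambda>i. 2 * (cmod (v i))\<^sup>2 + 2 * (cmod (w i))\<^sup>2) summable_on UNIV"
    using assms by (intro summable_on_add summable_on_cmult_right) (auto simp: l2_def)
  then have "(\<lambda>i. (cmod (v i + w i))\<^sup>2) summable_on UNIV"
  proof (rule summable_on_comparison_test)
    fix i
    have "(cmod (v i + w i))\<^sup>2 \<le> (cmod (v i) + cmod (w i))\<^sup>2"
      by (intro power_mono norm_triangle_ineq) simp
    also have "\<dots> \<le> 2 * (cmod (v i))\<^sup>2 + 2 * (cmod (w i))\<^sup>2"
      using zero_le_power2[of "cmod (v i) - cmod (w i)"] by (simp add: power2_sum power2_diff)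
    finally show "(cmod (v i + w i))\<^sup>2 \<le> 2 * (cmod (v i))\<^sup>2 + 2 * (cmod (w i))\<^sup>2" .
  qed simp
  then show ?thesis
    using assms by (simp add: l2_def)
qed

lemma l2_scale: "v \<in> l2 S \<Longrightarrow> (\<lambda>i. c * v i) \<in> l2 S"
  by (simp add: l2_def norm_mult power_mult_distrib summable_on_cmult_right)

lemma l2_diff: "v \<in> l2 S \<Longrightarrow> w \<in> l2 S \<Longrightarrow> (\<lambda>i. v i - w i) \<in> l2 S"
  using l2_add[OF _ l2_scale[of w S "-1"], of v] by simp

lemma l2_zero: "(\<lambda>_. 0) \<in> l2 S"
  by (simp add: l2_def)

lemma l2_norm_nonneg: "0 \<le> l2_norm v"
  by (simp add: l2_norm_def infsum_nonneg)

lemma l2_norm_eq_0D: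
  assumes "v \<in> l2 S" "l2_norm v = 0"
  shows "v = (\<lambda>_. 0)"
proof
  fix i
  have "(cmod (v i))\<^sup>2 = 0"
    by (rule nonneg_infsum_le_0D[of "\<lambda>i. (cmod (v i))\<^sup>2" UNIV])
      (use assms in \<open>auto simp: l2_def l2_norm_def\<close>)
  then show "v i = 0" by simp
qed

text \<open>Irreducibility speaks only of closed subspaces; a joint kernel of bounded operators is
  one, and it is the subspace on which the primeness argument turns.\<close>

lemma closed_subspace_annihilated:
  assumes B: "\<And>i. i \<in> I \<Longrightarrow> bounded_operator S (\<pi> i)"
  shows "closed_subspace S {v \<in> l2 S. \<forall>i\<in>I. \<pi> i v = (\<lambda>_. 0)}"
  unfolding closed_subspace_def
proof (intro conjI allI ballI impI)
  let ?K = "{v \<in> l2 S. \<forall>i\<in>I. \<pi> i v = (\<lambda>_. 0)}"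
  have add: "\<pi> i (\<lambda>x. v x + w x) = (\<lambda>x. \<pi> i v x + \<pi> i w x)"
    if "i \<in> I" "v \<in> l2 S" "w \<in> l2 S" for i v w
    using B[OF that(1)] that(2,3) by (auto simp: bounded_operator_def)
  have scale: "\<pi> i (\<lambda>x. c * v x) = (\<lambda>x. c * \<pi> i v x)" if "i \<in> I" "v \<in> l2 S" for i v c
    using B[OF that(1)] that(2) by (auto simp: bounded_operator_def)
  show "?K \<subseteq> l2 S" by blast
  show "(\<lambda>_. 0) \<in> ?K"
    using scale[OF _ l2_zero, of _ 0] by (simp add: l2_zero)
  show "(\<lambda>i. v i + w i) \<in> ?K" if "v \<in> ?K" "w \<in> ?K" for v w
    using that by (simp add: add l2_add)
  show "(\<lambda>i. c * v i) \<in> ?K" if "v \<in> ?K" for v c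
    using that by (simp add: scale l2_scale)
  fix f v assume fv: "(\<forall>n. f n \<in> ?K) \<and> v \<in> l2 S \<and> (\<lambda>n. l2_norm (\<lambda>i. f n i - v i)) \<longlonglongrightarrow> 0"
  have "\<pi> i v = (\<lambda>_. 0)" if i: "i \<in> I" for i
  proof -
    obtain C where C: "\<And>w. w \<in> l2 S \<Longrightarrow> l2_norm (\<pi> i w) \<le> C * l2_norm w"
      using B[OF i] unfolding bounded_operator_def by blast
    have "l2_norm (\<pi> i v) \<le> C * l2_norm (\<lambda>x. f n x - v x)" for n
    proof -
      have fn: "f n \<in> l2 S" "\<pi> i (f n) = (\<lambda>_. 0)"
        using fv i by auto
      \<comment> \<open>Since \<open>\<pi> i\<close> kills \<open>f n\<close>, the fixed norm of
        \<open>\<pi> i v\<close> is at most \<open>C\<close> times the norm of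
        \<open>f n - v\<close>, which tends to 0.\<close>
      have eq: "\<pi> i (\<lambda>x. f n x + (-1) * v x) = (\<lambda>x. (-1) * \<pi> i v x)"
        using add[OF i fn(1) l2_scale, of v "-1"] scale[OF i, of v "-1"] fv fn(2) by simp
      have "l2_norm (\<pi> i (\<lambda>x. f n x - v x)) = l2_norm (\<pi> i v)"
        using arg_cong[OF eq, of l2_norm] by (simp add: l2_norm_def)
      then show ?thesis
        using C[OF l2_diff[OF fn(1), of v]] fv by simp
    qed
    moreover have "(\<lambda>n. C * l2_norm (\<lambda>x. f n x - v x)) \<longlonglongrightarrow> 0"
      using tendsto_mult_left[of _ 0 _ C] fv by fastforce
    ultimately have "l2_norm (\<pi> i v) \<le> 0"
      by (intro LIMSEQ_le_const[of _ 0]) auto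
    then have "l2_norm (\<pi> i v) = 0"
      using l2_norm_nonneg[of "\<pi> i v"] by linarith
    moreover have "\<pi> i v \<in> l2 S"
      using B[OF i] fv by (auto simp: bounded_operator_def)
    ultimately show ?thesis
      by (rule l2_norm_eq_0D[rotated])
  qed
  then show "v \<in> ?K"
    using fv by simp
qed

text \<open>The vectors killed by \<open>I\<close> form a closed subspace, invariant because
  \<open>I\<close> absorbs multiplication on the right. If some \<open>j\<close> in \<open>J\<close>
  acts nontrivially, then \<open>\<pi> j v\<close> is a nonzero vector in it, as products from
  \<open>I\<close> and \<open>J\<close> act as 0. By irreducibility the subspace is everything, so
  \<open>I\<close> acts as 0.\<close>

lemma rep_kernel_prime:
  assumes irr: "irreducible_rep A S \<pi>" and I: "ideal I A" and J: "ideal J A"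
    and IJ: "\<And>i j. i \<in> I \<Longrightarrow> j \<in> J \<Longrightarrow> i \<otimes>\<^bsub>A\<^esub> j \<in> rep_kernel A S \<pi>"
  shows "I \<subseteq> rep_kernel A S \<pi> \<or> J \<subseteq> rep_kernel A S \<pi>"
proof (rule disjCI)
  assume "\<not> J \<subseteq> rep_kernel A S \<pi>"
  then obtain j v where j: "j \<in> J" "v \<in> l2 S" "\<pi> j v \<noteq> (\<lambda>_. 0)"
    using ideal.Icarr[OF J] unfolding rep_kernel_def by blast
  define K where "K = {v \<in> l2 S. \<forall>i\<in>I. \<pi> i v = (\<lambda>_. 0)}"
  have rep: "star_rep A S \<pi>"
    using irr by (simp add: irreducible_rep_def)
  have Ic: "\<And>i. i \<in> I \<Longrightarrow> i \<in> carrier A" and Jc: "\<And>i. i \<in> J \<Longrightarrow> i \<in> carrier A"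
    using I J ideal.Icarr by metis+
  have B: "bounded_operator S (\<pi> a)" if "a \<in> carrier A" for a
    using rep that by (simp add: star_rep_def)
  have mult: "\<pi> (a \<otimes>\<^bsub>A\<^esub> b) v = \<pi> a (\<pi> b v)" if "a \<in> carrier A" "b \<in> carrier A" "v \<in> l2 S" for a b v
    using rep that unfolding star_rep_def by blast
  have range: "\<pi> a v \<in> l2 S" if "a \<in> carrier A" "v \<in> l2 S" for a v
    using B[OF that(1)] that(2) by (auto simp: bounded_operator_def)
  have "closed_subspace S K"
    unfolding K_def by (rule closed_subspace_annihilated) (rule B[OF Ic])
  moreover have "\<forall>a\<in>carrier A. \<forall>v\<in>K. \<pi> a v \<in> K"
  proof (intro ballI)
    fix a v assume a: "a \<in> carrier A" and v: "v \<in> K"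
    have "\<pi> i (\<pi> a v) = (\<lambda>_. 0)" if "i \<in> I" for i
    proof -
      have "\<pi> i (\<pi> a v) = \<pi> (i \<otimes>\<^bsub>A\<^esub> a) v"
        using mult[of i a v] Ic[OF that] a v by (simp add: K_def)
      also have "\<dots> = (\<lambda>_. 0)"
        using ideal.I_r_closed[OF I that a] v by (simp add: K_def)
      finally show ?thesis .
    qed
    then show "\<pi> a v \<in> K"
      using range[OF a, of v] v by (simp add: K_def)
  qed
  moreover have "\<pi> j v \<in> K"
  proof -
    have "\<pi> i (\<pi> j v) = (\<lambda>_. 0)" if "i \<in> I" for i
    proof -
      have "\<pi> i (\<pi> j v) = \<pi> (i \<otimes>\<^bsub>A\<^esub> j) v"
        using mult[of i j v] Ic[OF that] Jc[OF j(1)] j(2) by simp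
      also have "\<dots> = (\<lambda>_. 0)"
        using IJ[OF that j(1)] j(2) by (simp add: rep_kernel_def)
      finally show ?thesis .
    qed
    then show ?thesis
      using range[OF Jc[OF j(1)] j(2)] by (simp add: K_def)
  qed
  ultimately have "K = l2 S"
    using irr j(3) unfolding irreducible_rep_def by blast
  then show "I \<subseteq> rep_kernel A S \<pi>"
    using Ic unfolding K_def rep_kernel_def by blast
qed

lemma Prim_prime:
  fixes A :: "('a, 'm) cstar_scheme"
  assumes "P \<in> Prim A" "ideal I A" "ideal J A" "\<And>i j. i \<in> I \<Longrightarrow> j \<in> J \<Longrightarrow> i \<otimes>\<^bsub>A\<^esub> j \<in> P"
  shows "I \<subseteq> P \<or> J \<subseteq> P"
proof -
  obtain S :: "'a set" and \<pi> where "irreducible_rep A S \<pi>" "P = rep_kernel A S \<pi>"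
    using assms(1) unfolding Prim_def by blast
  then show ?thesis
    using rep_kernel_prime[of A S \<pi> I J] assms(2-4) by simp
qed

section \<open>The hull-kernel topology\<close>

lemma Prim_closed_ideal: "P \<in> Prim A \<Longrightarrow> closed_ideal A P"
  by (simp add: Prim_def)

lemma closed_ideal_ideal: "closed_ideal A I \<Longrightarrow> ideal I A"
  by (simp add: closed_ideal_def)

lemma Prim_proper: "P \<in> Prim A \<Longrightarrow> P \<noteq> carrier A"
  by (fastforce simp: Prim_def irreducible_rep_def rep_kernel_def)

lemma carrier_closed_ideal: "closed_ideal alg_A (carrier alg_A)"
  unfolding closed_ideal_def
  by (auto simp: ring.oneideal[OF ring_alg_A] alg_A_smult_closed)

lemma closed_ideal_Inter:
  assumes "\<And>I. I \<in> F \<Longrightarrow> closed_ideal alg_A I" "F \<noteq> {}"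
  shows "closed_ideal alg_A (\<Inter>F)"
  unfolding closed_ideal_def
proof (intro conjI allI ballI impI)
  show "ideal (\<Inter>F) alg_A"
    using assms closed_ideal_ideal by (intro ring.i_Intersect[OF ring_alg_A]) auto
  show "c \<odot>\<^bsub>alg_A\<^esub> x \<in> \<Inter>F" if "x \<in> \<Inter>F" for c x
    using assms(1) that unfolding closed_ideal_def by blast
  show "x \<in> \<Inter>F" if "(\<forall>n. f n \<in> \<Inter>F) \<and> x \<in> carrier alg_A \<and>
    (\<lambda>n. cstar_norm alg_A (f n \<ominus>\<^bsub>alg_A\<^esub> x)) \<longlonglongrightarrow> 0" for f x
    using assms(1) that unfolding closed_ideal_def by (meson Inter_iff)
qed

lemma closed_ideal_Int:
  "closed_ideal alg_A I \<Longrightarrow> closed_ideal alg_A J \<Longrightarrow> closed_ideal alg_A (I \<inter> J)"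
  using closed_ideal_Inter[of "{I, J}"] by auto

definition hk_open :: "(real option \<Rightarrow> m2) set \<Rightarrow> (real option \<Rightarrow> m2) set set" where
  "hk_open I = {P \<in> Prim alg_A. \<not> I \<subseteq> P}"

text \<open>Products from \<open>I\<close> and \<open>J\<close> lie in \<open>I \<inter> J\<close>,
  so a primitive ideal containing the intersection contains one of the two by primeness.\<close>

lemma hk_open_Int:
  assumes I: "closed_ideal alg_A I" and J: "closed_ideal alg_A J"
  shows "hk_open I \<inter> hk_open J = hk_open (I \<inter> J)"
proof
  show "hk_open I \<inter> hk_open J \<subseteq> hk_open (I \<inter> J)"
  proof
    fix P assume P: "P \<in> hk_open I \<inter> hk_open J"
    have "i \<otimes>\<^bsub>alg_A\<^esub> j \<in> I \<inter> J" if "i \<in> I" "j \<in> J" for i j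
      using that ideal.I_l_closed[OF closed_ideal_ideal[OF J]] ideal.I_r_closed[OF closed_ideal_ideal[OF I]]
        ideal.Icarr[OF closed_ideal_ideal[OF I]] ideal.Icarr[OF closed_ideal_ideal[OF J]] by blast
    then show "P \<in> hk_open (I \<inter> J)"
      using P Prim_prime[OF _ closed_ideal_ideal[OF I] closed_ideal_ideal[OF J], of P]
      unfolding hk_open_def by blast
  qed
qed (auto simp: hk_open_def)

text \<open>The constructor \<open>topology\<close> returns the given family only if it satisfies
  the axioms of a topology, which is what has to be verified.\<close>

lemma openin_Prim_iff:
  "openin (hull_kernel_topology alg_A) U \<longleftrightarrow> (\<exists>I. closed_ideal alg_A I \<and> U = hk_open I)"
proof -
  have "istopology (\<lambda>U. \<exists>I. closed_ideal alg_A I \<and> U = hk_open I)"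
    unfolding istopology_def
  proof (intro conjI allI impI)
    fix U V assume "\<exists>I. closed_ideal alg_A I \<and> U = hk_open I" "\<exists>I. closed_ideal alg_A I \<and> V = hk_open I"
    then show "\<exists>I. closed_ideal alg_A I \<and> U \<inter> V = hk_open I"
      using hk_open_Int closed_ideal_Int by metis
  next
    fix F assume F: "\<forall>U\<in>F. \<exists>I. closed_ideal alg_A I \<and> U = hk_open I"
    define G where "G = {I. closed_ideal alg_A I \<and> hk_open I \<in> F}"
    \<comment> \<open>The intersection of \<open>H\<close> is the closed ideal generated by the
      members of \<open>G\<close>; the whole algebra belongs to \<open>H\<close>, so it is not an
      empty intersection. A primitive ideal is closed, hence if it contained all of \<open>G\<close>
      it would itself belong to \<open>H\<close>.\<close>
    define H where "H = {L. closed_ideal alg_A L \<and> \<Union>G \<subseteq> L}"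
    have "I \<subseteq> carrier alg_A" if "closed_ideal alg_A I" for I
      using ideal.Icarr[OF closed_ideal_ideal[OF that]] by (rule subsetI)
    then have "carrier alg_A \<in> H"
      using carrier_closed_ideal by (auto simp: H_def G_def)
    then have H: "closed_ideal alg_A (\<Inter>H)"
      by (intro closed_ideal_Inter) (auto simp: H_def)
    have "\<Union>F = hk_open (\<Inter>H)"
    proof (intro equalityI subsetI)
      fix P assume "P \<in> \<Union>F"
      then obtain U where U: "U \<in> F" "P \<in> U" by blast
      obtain I where I: "closed_ideal alg_A I" "U = hk_open I"
        using F U(1) by auto
      then have "I \<in> G"
        using U(1) by (simp add: G_def)
      then have "I \<subseteq> \<Inter>H"
        by (auto simp: H_def)
      then have "\<not> \<Inter>H \<subseteq> P" if "\<not> I \<subseteq> P"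
        using that by (meson order_trans)
      then show "P \<in> hk_open (\<Inter>H)"
        using U(2) by (simp add: hk_open_def I(2))
    next
      fix P assume P: "P \<in> hk_open (\<Inter>H)"
      then have PP: "P \<in> Prim alg_A" "P \<notin> H"
        by (auto simp: hk_open_def)
      then have "\<not> \<Union>G \<subseteq> P"
        using Prim_closed_ideal[OF PP(1)] by (simp add: H_def)
      then obtain I where "I \<in> G" "\<not> I \<subseteq> P"
        by auto
      then have "hk_open I \<in> F" "P \<in> hk_open I"
        using PP(1) by (simp_all add: G_def hk_open_def)
      then show "P \<in> \<Union>F"
        by (rule UnionI)
    qed
    then show "\<exists>I. closed_ideal alg_A I \<and> \<Union>F = hk_open I"
      using H by (intro exI conjI)
  qed
  then show ?thesis
    unfolding hull_kernel_topology_def hk_open_def[symmetric] by (simp add: topology_inverse')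
qed

section \<open>Ideals given by vanishing entries\<close>

lemma alg_A_a_inv:
  assumes "y \<in> carrier alg_A"
  shows "\<ominus>\<^bsub>alg_A\<^esub> y = (\<lambda>t\<in>topspace Xt. - y t)"
proof -
  interpret A: ring alg_A by (rule ring_alg_A)
  have "\<ominus>\<^bsub>alg_A\<^esub> y = \<zero>\<^bsub>alg_A\<^esub> \<ominus>\<^bsub>alg_A\<^esub> y"
    using assms by (simp add: a_minus_def)
  then show ?thesis
    using assms by (simp add: alg_A_minus alg_A_zero_closed) (simp add: alg_A_sel fun_eq_iff restrict_def)
qed

text \<open>Each entry is linear and bounded by the norm, which settles sums, scalars and limits for
  all such sets together. Absorption depends on which entries are chosen and is left as an
  assumption.\<close>

lemma closed_ideal_vanishing:
  assumes Z: "\<And>t i j. (t, i, j) \<in> Z \<Longrightarrow> t \<in> topspace Xt"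
    and J: "J = {a \<in> carrier alg_A. \<forall>(t, i, j) \<in> Z. a t $ i $ j = 0}"
    and mult: "\<And>a x. a \<in> J \<Longrightarrow> x \<in> carrier alg_A \<Longrightarrow> x \<otimes>\<^bsub>alg_A\<^esub> a \<in> J \<and> a \<otimes>\<^bsub>alg_A\<^esub> x \<in> J"
  shows "closed_ideal alg_A J"
  unfolding closed_ideal_def
proof (intro conjI allI ballI impI)
  have mem: "a \<in> J \<longleftrightarrow> a \<in> carrier alg_A \<and> (\<forall>t i j. (t, i, j) \<in> Z \<longrightarrow> a t $ i $ j = 0)" for a
    unfolding J by auto
  show "ideal J alg_A"
  proof (rule idealI)
    show "subgroup J (add_monoid alg_A)"
    proof (rule subgroup.intro)
      show "x \<otimes>\<^bsub>add_monoid alg_A\<^esub> y \<in> J" if "x \<in> J" "y \<in> J" for x y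
        using that Z by (auto simp: mem alg_A_add_closed) (simp add: alg_A_sel)
      show "\<one>\<^bsub>add_monoid alg_A\<^esub> \<in> J"
        using Z by (auto simp: mem alg_A_zero_closed) (simp add: alg_A_sel)
      show "inv\<^bsub>add_monoid alg_A\<^esub> x \<in> J" if "x \<in> J" for x
      proof -
        have x: "x \<in> carrier alg_A"
          using that by (simp add: mem)
        then have "\<ominus>\<^bsub>alg_A\<^esub> x \<in> carrier alg_A"
          by (rule abelian_group.a_inv_closed[OF ring.is_abelian_group[OF ring_alg_A]])
        then show ?thesis
          using that Z unfolding mem a_inv_def[symmetric] by (auto simp: alg_A_a_inv[OF x])
      qed
    qed (auto simp: mem)
  qed (use mult in \<open>auto simp: ring_alg_A\<close>)
  show "c \<odot>\<^bsub>alg_A\<^esub> x \<in> J" if "x \<in> J" for c x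
    using that Z by (auto simp: mem alg_A_smult_closed) (simp add: alg_A_sel)
  fix f x
  assume fx: "(\<forall>n. f n \<in> J) \<and> x \<in> carrier alg_A \<and> (\<lambda>n. cstar_norm alg_A (f n \<ominus>\<^bsub>alg_A\<^esub> x)) \<longlonglongrightarrow> 0"
  have "x t $ i $ j = 0" if z: "(t, i, j) \<in> Z" for t i j
  proof -
    have "cmod (x t $ i $ j) \<le> cstar_norm alg_A (f n \<ominus>\<^bsub>alg_A\<^esub> x)" for n
    proof -
      have fn: "f n \<in> carrier alg_A" "f n t $ i $ j = 0"
        using fx z by (auto simp: mem)
      have "cmod ((f n \<ominus>\<^bsub>alg_A\<^esub> x) t $ i $ j) \<le> cstar_norm alg_A (f n \<ominus>\<^bsub>alg_A\<^esub> x)"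
        using fn fx Z[OF z] by (intro entry_le_norm alg_A_minus_closed) auto
      then show ?thesis
        using fn fx Z[OF z] by (simp add: alg_A_minus)
    qed
    then have "cmod (x t $ i $ j) \<le> 0"
      using fx by (intro LIMSEQ_le_const[of _ 0]) auto
    then show ?thesis by simp
  qed
  then show "x \<in> J"
    using fx by (simp add: mem)
qed

section \<open>Compressed point evaluations and their kernels\<close>

lemma l2_finite_iff:
  assumes "finite S"
  shows "v \<in> l2 S \<longleftrightarrow> (\<forall>i. i \<notin> S \<longrightarrow> v i = 0)"
proof -
  have "(\<lambda>i. (cmod (v i))\<^sup>2) summable_on UNIV" if "\<forall>i. i \<notin> S \<longrightarrow> v i = 0"
    using that summable_on_cong_neutral[of UNIV S "\<lambda>i. (cmod (v i))\<^sup>2" "\<lambda>i. (cmod (v i))\<^sup>2"] assms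
    by auto
  then show ?thesis
    by (auto simp: l2_def)
qed

lemma l2_inner_finite:
  assumes "finite S" "v \<in> l2 S"
  shows "l2_inner v w = (\<Sum>i\<in>S. v i * cnj (w i))"
proof -
  have "l2_inner v w = infsum (\<lambda>i. v i * cnj (w i)) S"
    unfolding l2_inner_def by (rule infsum_cong_neutral) (use assms l2_finite_iff in auto)
  then show ?thesis
    using assms by simp
qed

lemma l2_norm_finite:
  assumes "finite S" "v \<in> l2 S"
  shows "l2_norm v = L2_set (\<lambda>i. cmod (v i)) S"
proof -
  have "(\<Sum>\<^sub>\<infinity>i. (cmod (v i))\<^sup>2) = infsum (\<lambda>i. (cmod (v i))\<^sup>2) S"
    by (rule infsum_cong_neutral) (use assms l2_finite_iff in auto)
  then show ?thesis
    using assms by (simp add: l2_norm_def L2_set_def)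
qed

lemma closed_subspace_sum:
  assumes "closed_subspace S K" "finite F" "\<And>i. i \<in> F \<Longrightarrow> u i \<in> K"
  shows "(\<lambda>x. \<Sum>i\<in>F. c i * u i x) \<in> K"
  using assms(2,3)
proof (induction F rule: finite_induct)
  case (insert i F)
  then have "(\<lambda>x. c i * u i x) \<in> K" "(\<lambda>x. \<Sum>i\<in>F. c i * u i x) \<in> K"
    using assms(1) by (auto simp: closed_subspace_def)
  then show ?case
    using assms(1) insert(1,2) by (simp add: closed_subspace_def)
qed (use assms(1) in \<open>simp add: closed_subspace_def\<close>)

text \<open>\<^const>\<open>Prim\<close> asks for index sets of elements of the algebra's type; these label the basis of
  \<open>\<complex>\<^sup>2\<close>.\<close>

definition basis_label :: "2 \<Rightarrow> real option \<Rightarrow> m2" where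
  "basis_label i = (\<lambda>_. matrix_unit i i 1)"

lemma inj_basis_label: "inj basis_label"
  by (auto intro!: injI simp: basis_label_def fun_eq_iff vec_eq_iff matrix_unit_nth) (metis one_neq_zero)

text \<open>The labels are distinct, so at most one summand is nonzero at each \<open>x\<close>: the
  sum picks out a coordinate without an inverse of \<open>basis_label\<close> and gives 0 off the
  labels.\<close>

definition corner_rep ::
  "2 set \<Rightarrow> real option \<Rightarrow> (real option \<Rightarrow> m2) \<Rightarrow> ((real option \<Rightarrow> m2) \<Rightarrow> complex) \<Rightarrow> (real option \<Rightarrow> m2) \<Rightarrow> complex"
  where "corner_rep R t a v =
    (\<lambda>x. \<Sum>i\<in>R. if x = basis_label i then \<Sum>j\<in>R. a t $ i $ j * v (basis_label j) else 0)"

lemma corner_rep_nth: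
  "i \<in> R \<Longrightarrow> corner_rep R t a v (basis_label i) = (\<Sum>j\<in>R. a t $ i $ j * v (basis_label j))"
  by (simp add: corner_rep_def inj_eq[OF inj_basis_label])

lemma corner_rep_in_l2: "corner_rep R t a v \<in> l2 (basis_label ` R)"
  by (auto simp: l2_finite_iff corner_rep_def intro!: sum.neutral)

lemma l2_label_eqI:
  assumes "v \<in> l2 (basis_label ` R)" "w \<in> l2 (basis_label ` R)"
    and "\<And>i. i \<in> R \<Longrightarrow> v (basis_label i) = w (basis_label i)"
  shows "v = w"
proof
  fix x
  show "v x = w x"
    using assms by (cases "x \<in> basis_label ` R") (auto simp: l2_finite_iff)
qed

lemma sum_label: "(\<Sum>x\<in>basis_label ` R. f x) = (\<Sum>i\<in>R. f (basis_label i))"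
  using sum.reindex[OF inj_on_subset[OF inj_basis_label subset_UNIV], of f R] by (simp add: o_def)

lemma corner_rep_bounded: "bounded_operator (basis_label ` R) (corner_rep R t a)"
  unfolding bounded_operator_def
proof (intro conjI ballI allI)
  let ?S = "basis_label ` R"
  show "corner_rep R t a \<in> l2 ?S \<rightarrow> l2 ?S"
    using corner_rep_in_l2 by blast
  show "corner_rep R t a (\<lambda>i. v i + w i) = (\<lambda>i. corner_rep R t a v i + corner_rep R t a w i)" for v w
    by (rule l2_label_eqI[of _ R])
      (simp_all add: corner_rep_in_l2 l2_add corner_rep_nth sum.distrib distrib_left)
  show "corner_rep R t a (\<lambda>i. c * v i) = (\<lambda>i. c * corner_rep R t a v i)" for c v
    by (rule l2_label_eqI[of _ R])
      (simp_all add: corner_rep_in_l2 l2_scale corner_rep_nth sum_distrib_left mult_ac)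
  show "\<exists>C. \<forall>v\<in>l2 ?S. l2_norm (corner_rep R t a v) \<le> C * l2_norm v"
  proof (intro exI ballI)
    fix v assume v: "v \<in> l2 ?S"
    have le: "cmod (v (basis_label j)) \<le> l2_norm v" if "j \<in> R" for j
      using that member_le_L2_set[of ?S "basis_label j" "\<lambda>i. cmod (v i)"] v
      by (simp add: l2_norm_finite[of ?S])
    have "l2_norm (corner_rep R t a v) \<le> (\<Sum>x\<in>?S. cmod (corner_rep R t a v x))"
      using L2_set_le_sum[of ?S "\<lambda>x. cmod (corner_rep R t a v x)"]
      by (simp add: l2_norm_finite[of ?S] corner_rep_in_l2)
    also have "\<dots> = (\<Sum>i\<in>R. cmod (\<Sum>j\<in>R. a t $ i $ j * v (basis_label j)))"
      by (simp add: sum_label corner_rep_nth)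
    also have "\<dots> \<le> (\<Sum>i\<in>R. \<Sum>j\<in>R. cmod (a t $ i $ j) * l2_norm v)"
      by (intro sum_mono order_trans[OF norm_sum]) (simp add: norm_mult mult_left_mono le)
    finally show "l2_norm (corner_rep R t a v) \<le> (\<Sum>i\<in>R. \<Sum>j\<in>R. cmod (a t $ i $ j)) * l2_norm v"
      by (simp add: sum_distrib_right)
  qed
qed

text \<open>The compression of the evaluation at \<open>t\<close> to the corner \<open>R\<close> is multiplicative when
  \<open>R\<close> is everything, and also when \<open>t\<close> is an integer, where all values are diagonal.\<close>

lemma corner_rep_star_rep:
  assumes t: "t \<in> topspace Xt"
    and mult: "\<And>a b i j. a \<in> carrier alg_A \<Longrightarrow> b \<in> carrier alg_A \<Longrightarrow> i \<in> R \<Longrightarrow> j \<in> R \<Longrightarrow>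
      (a t ** b t) $ i $ j = (\<Sum>k\<in>R. a t $ i $ k * b t $ k $ j)"
  shows "star_rep alg_A (basis_label ` R) (corner_rep R t)"
  unfolding star_rep_def
proof (intro conjI ballI allI)
  let ?S = "basis_label ` R"
  show "bounded_operator ?S (corner_rep R t a)" for a
    by (rule corner_rep_bounded)
  show "corner_rep R t (a \<oplus>\<^bsub>alg_A\<^esub> b) v = (\<lambda>i. corner_rep R t a v i + corner_rep R t b v i)" for a b v
    by (rule l2_label_eqI[of _ R])
      (simp_all add: corner_rep_in_l2 l2_add corner_rep_nth sum.distrib distrib_right alg_A_sel t)
  show "corner_rep R t (c \<odot>\<^bsub>alg_A\<^esub> a) v = (\<lambda>i. c * corner_rep R t a v i)" for c a v
    by (rule l2_label_eqI[of _ R])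
      (simp_all add: corner_rep_in_l2 l2_scale corner_rep_nth sum_distrib_left mult_ac alg_A_sel t)
  show "corner_rep R t (a \<otimes>\<^bsub>alg_A\<^esub> b) v = corner_rep R t a (corner_rep R t b v)"
    if "a \<in> carrier alg_A" "b \<in> carrier alg_A" for a b v
  proof (rule l2_label_eqI[of _ R])
    fix i assume i: "i \<in> R"
    have "(\<Sum>j\<in>R. (\<Sum>k\<in>R. a t $ i $ k * b t $ k $ j) * v (basis_label j))
      = (\<Sum>k\<in>R. a t $ i $ k * (\<Sum>j\<in>R. b t $ k $ j * v (basis_label j)))"
      unfolding sum_distrib_left sum_distrib_right mult.assoc by (rule sum.swap)
    then show "corner_rep R t (a \<otimes>\<^bsub>alg_A\<^esub> b) v (basis_label i)
      = corner_rep R t a (corner_rep R t b v) (basis_label i)"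
      using i by (simp add: corner_rep_nth alg_A_sel t mult that)
  qed (simp_all add: corner_rep_in_l2)
  fix v a w assume v: "v \<in> l2 ?S" and w: "w \<in> l2 ?S"
  have "(\<Sum>i\<in>R. (\<Sum>j\<in>R. cnj (a t $ j $ i) * v (basis_label j)) * cnj (w (basis_label i)))
    = (\<Sum>j\<in>R. v (basis_label j) * cnj (\<Sum>i\<in>R. a t $ j $ i * w (basis_label i)))"
    by (simp add: sum_distrib_left sum_distrib_right mult_ac) (rule sum.swap)
  then show "l2_inner (corner_rep R t (adj alg_A a) v) w = l2_inner v (corner_rep R t a w)"
    by (simp add: l2_inner_finite[of ?S] corner_rep_in_l2 v sum_label corner_rep_nth alg_A_sel t)
qed

text \<open>Matrix units in the image suffice. If \<open>v\<close> has a nonzero coordinate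
  \<open>j\<close>, the unit \<open>E i j\<close> sends \<open>v\<close> to a nonzero multiple of
  the basis vector \<open>i\<close>, and combinations of these vectors yield every
  \<open>w\<close>.\<close>

lemma corner_rep_irreducible:
  assumes t: "t \<in> topspace Xt" and R: "R \<noteq> {}"
    and mult: "\<And>a b i j. a \<in> carrier alg_A \<Longrightarrow> b \<in> carrier alg_A \<Longrightarrow> i \<in> R \<Longrightarrow> j \<in> R \<Longrightarrow>
      (a t ** b t) $ i $ j = (\<Sum>k\<in>R. a t $ i $ k * b t $ k $ j)"
    and units: "\<And>i j. i \<in> R \<Longrightarrow> j \<in> R \<Longrightarrow> \<exists>a\<in>carrier alg_A. \<forall>i'\<in>R. \<forall>j'\<in>R.
      a t $ i' $ j' = (if i' = i \<and> j' = j then 1 else 0)"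
  shows "irreducible_rep alg_A (basis_label ` R) (corner_rep R t)"
proof -
  let ?S = "basis_label ` R"
  obtain E where E: "\<And>i j. i \<in> R \<Longrightarrow> j \<in> R \<Longrightarrow> E i j \<in> carrier alg_A"
    "\<And>i j i' j'. i \<in> R \<Longrightarrow> j \<in> R \<Longrightarrow> i' \<in> R \<Longrightarrow> j' \<in> R \<Longrightarrow>
      E i j t $ i' $ j' = (if i' = i \<and> j' = j then 1 else 0)"
    using units by metis
  have Ev: "corner_rep R t (E i j) v (basis_label k) = (if k = i then v (basis_label j) else 0)"
    if "i \<in> R" "j \<in> R" "k \<in> R" for i j k v
  proof -
    have "corner_rep R t (E i j) v (basis_label k)
      = (\<Sum>j'\<in>R. if j' = j then (if k = i then v (basis_label j) else 0) else 0)"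
      using that by (simp add: corner_rep_nth E(2) mult_delta_left)
    then show ?thesis
      using that by simp
  qed
  have "K = l2 ?S"
    if K: "closed_subspace ?S K" "\<forall>a\<in>carrier alg_A. \<forall>v\<in>K. corner_rep R t a v \<in> K" "K \<noteq> {\<lambda>_. 0}" for K
  proof -
    have sub: "K \<subseteq> l2 ?S"
      using K(1) by (simp add: closed_subspace_def)
    have "(\<lambda>_. 0) \<in> K"
      using K(1) by (simp add: closed_subspace_def)
    then obtain v where v: "v \<in> K" "v \<noteq> (\<lambda>_. 0)"
      using K(3) by auto
    then obtain j where j: "j \<in> R" "v (basis_label j) \<noteq> 0"
      using l2_label_eqI[of v R "\<lambda>_. 0"] sub l2_zero by auto
    have "w \<in> K" if w: "w \<in> l2 ?S" for w
    proof -
      define u where "u = (\<lambda>x. \<Sum>i\<in>R. w (basis_label i) / v (basis_label j) * corner_rep R t (E i j) v x)"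
      have "u \<in> K"
        unfolding u_def using K(2) E(1) j(1) v(1) by (intro closed_subspace_sum[OF K(1)]) auto
      moreover have "u = w"
      proof (rule l2_label_eqI[of _ R])
        show "u \<in> l2 ?S"
          using \<open>u \<in> K\<close> sub by auto
        fix k assume k: "k \<in> R"
        have "u (basis_label k) = (\<Sum>i\<in>R. if i = k then w (basis_label k) else 0)"
          unfolding u_def
        proof (rule sum.cong)
          fix i assume "i \<in> R"
          then show "w (basis_label i) / v (basis_label j) * corner_rep R t (E i j) v (basis_label k)
            = (if i = k then w (basis_label k) else 0)"
            using j k by (simp add: Ev)
        qed simp
        then show "u (basis_label k) = w (basis_label k)"
          using k by simp
      qed fact
      ultimately show ?thesis by simp
    qed
    then show ?thesis
      using sub by auto
  qed
  moreover have "\<exists>a\<in>carrier alg_A. \<exists>v\<in>l2 ?S. corner_rep R t a v \<noteq> (\<lambda>_. 0)"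
  proof -
    obtain i where i: "i \<in> R"
      using R by blast
    define v where "v = (\<lambda>x. if x = basis_label i then 1 else 0 :: complex)"
    have "v \<in> l2 ?S"
      using i by (auto simp: l2_finite_iff v_def)
    moreover have "corner_rep R t (E i i) v (basis_label i) \<noteq> 0"
      using i by (simp add: Ev v_def)
    ultimately show ?thesis
      using E(1)[OF i i] by (metis (no_types))
  qed
  moreover have "star_rep alg_A ?S (corner_rep R t)"
    by (rule corner_rep_star_rep[OF t]) (rule mult)
  ultimately show ?thesis
    by (auto simp: irreducible_rep_def)
qed

lemma corner_rep_kernel:
  "rep_kernel alg_A (basis_label ` R) (corner_rep R t)
    = {a \<in> carrier alg_A. \<forall>i\<in>R. \<forall>j\<in>R. a t $ i $ j = 0}"
proof (intro equalityI subsetI)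
  let ?S = "basis_label ` R"
  fix a assume a: "a \<in> rep_kernel alg_A ?S (corner_rep R t)"
  have "a t $ i $ j = 0" if "i \<in> R" "j \<in> R" for i j
  proof -
    define v where "v = (\<lambda>x. if x = basis_label j then 1 else 0 :: complex)"
    have "v \<in> l2 ?S"
      using that by (auto simp: l2_finite_iff v_def)
    then have "corner_rep R t a v (basis_label i) = 0"
      using a by (simp add: rep_kernel_def)
    then show ?thesis
      using that by (simp add: corner_rep_nth v_def inj_eq[OF inj_basis_label] if_distrib cong: if_cong)
  qed
  then show "a \<in> {a \<in> carrier alg_A. \<forall>i\<in>R. \<forall>j\<in>R. a t $ i $ j = 0}"
    using a by (simp add: rep_kernel_def)
next
  fix a assume a: "a \<in> {a \<in> carrier alg_A. \<forall>i\<in>R. \<forall>j\<in>R. a t $ i $ j = 0}"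
  have "corner_rep R t a v = (\<lambda>_. 0)" for v
    by (rule l2_label_eqI[of _ R]) (use a in \<open>simp_all add: corner_rep_in_l2 l2_zero corner_rep_nth\<close>)
  then show "a \<in> rep_kernel alg_A (basis_label ` R) (corner_rep R t)"
    using a by (simp add: rep_kernel_def)
qed

text \<open>The kernel of the character \<open>\<lambda>\<^sub>n\<close>. The lower entry at
  \<open>n\<close> is the upper entry at \<open>n + 1\<close>, so the upper entries account for all
  these characters.\<close>

definition char_ideal :: "nat \<Rightarrow> (real option \<Rightarrow> m2) set" where
  "char_ideal n = {a \<in> carrier alg_A. a (Some (real n)) $ 1 $ 1 = 0}"

definition point_ideal :: "real \<Rightarrow> (real option \<Rightarrow> m2) set" where
  "point_ideal s = {a \<in> carrier alg_A. a (Some s) = 0}"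

lemma vanishing_on_closed_ideal:
  assumes "T \<subseteq> topspace Xt"
  shows "closed_ideal alg_A {a \<in> carrier alg_A. \<forall>t\<in>T. a t = 0}" (is "closed_ideal alg_A ?J")
proof (rule closed_ideal_vanishing[where Z = "T \<times> UNIV"])
  show "?J = {a \<in> carrier alg_A. \<forall>(t, i, j)\<in>T \<times> UNIV. a t $ i $ j = 0}"
    by (auto simp: vec_eq_iff)
  show "x \<otimes>\<^bsub>alg_A\<^esub> a \<in> ?J \<and> a \<otimes>\<^bsub>alg_A\<^esub> x \<in> ?J" if "a \<in> ?J" "x \<in> carrier alg_A" for a x
    using that assms by (auto simp: alg_A_mult_closed) (auto simp: alg_A_sel subset_iff)
qed (use assms in auto)

lemma Some_in_Xt: "Some s \<in> topspace Xt \<longleftrightarrow> s \<ge> 1"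
  by (auto simp: topspace_Xt)

lemma alg_A_mult_corner:
  assumes "a \<in> carrier alg_A" "n \<ge> 1"
  shows "(a (Some (real n)) ** b) $ 1 $ 1 = a (Some (real n)) $ 1 $ 1 * b $ 1 $ 1"
  using alg_A_off_diag[OF assms, of 1 2] by (simp add: mult_m2_nth)

lemma char_ideal_closed_ideal:
  assumes "n \<ge> 1"
  shows "closed_ideal alg_A (char_ideal n)"
proof (rule closed_ideal_vanishing[where Z = "{(Some (real n), 1, 1)}"])
  show "x \<otimes>\<^bsub>alg_A\<^esub> a \<in> char_ideal n \<and> a \<otimes>\<^bsub>alg_A\<^esub> x \<in> char_ideal n"
    if "a \<in> char_ideal n" "x \<in> carrier alg_A" for a x
  proof -
    have a: "a \<in> carrier alg_A" "a (Some (real n)) $ 1 $ 1 = 0"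
      using that(1) by (auto simp: char_ideal_def)
    show ?thesis
      using assms a that(2) alg_A_mult_closed[of a x] alg_A_mult_closed[of x a]
      by (simp add: char_ideal_def) (simp add: alg_A_sel Some_in_Xt alg_A_mult_corner)
  qed
qed (use assms in \<open>auto simp: char_ideal_def Some_in_Xt\<close>)

lemma char_ideal_Prim:
  assumes "n \<ge> 1"
  shows "char_ideal n \<in> Prim alg_A"
proof -
  have "irreducible_rep alg_A (basis_label ` {1}) (corner_rep {1} (Some (real n)))"
  proof (rule corner_rep_irreducible)
    show "Some (real n) \<in> topspace Xt"
      using assms by (simp add: Some_in_Xt)
    show "\<exists>a\<in>carrier alg_A. \<forall>i'\<in>{1}. \<forall>j'\<in>{1}. a (Some (real n)) $ i' $ j' = (if i' = i \<and> j' = j then 1 else 0)"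
      if "i \<in> {1}" "j \<in> {1}" for i j
      using that assms
      by (intro bexI[OF _ alg_A_one_closed]) (simp add: alg_A_sel Some_in_Xt mat_def)
  qed (use assms in \<open>auto simp: alg_A_mult_corner\<close>)
  then show ?thesis
    unfolding Prim_def using char_ideal_closed_ideal[OF assms] corner_rep_kernel[of "{1}" "Some (real n)"]
    by (auto simp: char_ideal_def)
qed

lemma point_ideal_Prim:
  assumes s: "s > 1" "s \<notin> \<int>"
  shows "point_ideal s \<in> Prim alg_A"
proof -
  obtain \<phi> :: "real option \<Rightarrow> complex" where \<phi>: "continuous_map Xt euclidean \<phi>" "\<phi> None = 0"
    "\<And>n::nat. \<phi> (Some n) = 0" "\<phi> (Some s) = 1"
    using bump_exists[OF s(2)] by metis
  have "irreducible_rep alg_A (basis_label ` UNIV) (corner_rep UNIV (Some s))"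
  proof (rule corner_rep_irreducible)
    show "\<exists>a\<in>carrier alg_A. \<forall>i'\<in>UNIV. \<forall>j'\<in>UNIV. a (Some s) $ i' $ j' = (if i' = i \<and> j' = j then 1 else 0)"
      for i j
      using s \<phi> by (intro bexI[OF _ unit_element_closed[of \<phi> i j]])
        (simp_all add: unit_element_nth Some_in_Xt)
  qed (use s in \<open>auto simp: Some_in_Xt matrix_matrix_mult_def\<close>)
  moreover have "closed_ideal alg_A (point_ideal s)"
    using vanishing_on_closed_ideal[of "{Some s}"] s by (simp add: point_ideal_def Some_in_Xt)
  moreover have "rep_kernel alg_A (basis_label ` UNIV) (corner_rep UNIV (Some s)) = point_ideal s"
    by (simp add: corner_rep_kernel point_ideal_def vec_eq_iff)
  ultimately show ?thesis
    unfolding Prim_def by blast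
qed

lemma char_ideal_adjacent:
  assumes n: "n \<ge> 1"
  shows "adjacent alg_A (char_ideal n) (char_ideal (Suc n))"
  unfolding adjacent_def
proof (intro conjI notI)
  assume "\<exists>U V. openin (hull_kernel_topology alg_A) U \<and> openin (hull_kernel_topology alg_A) V \<and>
    char_ideal n \<in> U \<and> char_ideal (Suc n) \<in> V \<and> disjnt U V"
  then obtain I J where IJ: "closed_ideal alg_A I" "closed_ideal alg_A J"
    "char_ideal n \<in> hk_open I" "char_ideal (Suc n) \<in> hk_open J" "disjnt (hk_open I) (hk_open J)"
    unfolding openin_Prim_iff by auto
  obtain a where a: "a \<in> I" "a \<notin> char_ideal n"
    using IJ(3) by (auto simp: hk_open_def)
  obtain b where b: "b \<in> J" "b \<notin> char_ideal (Suc n)"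
    using IJ(4) by (auto simp: hk_open_def)
  have ac: "a \<in> carrier alg_A" and bc: "b \<in> carrier alg_A"
    using ideal.Icarr[OF closed_ideal_ideal[OF IJ(1)] a(1)] ideal.Icarr[OF closed_ideal_ideal[OF IJ(2)] b(1)] .
  have na: "a (Some (real n)) $ 1 $ 1 \<noteq> 0"
    using a(2) ac by (simp add: char_ideal_def)
  \<comment> \<open>The character with index \<open>n + 1\<close> is read off the lower corner at
    \<open>n\<close>, so both conditions concern the same point and persist at one nearby
    non-integer. The ideal of that point then lies in both open sets.\<close>
  have nb: "b (Some (real n)) $ 2 $ 2 \<noteq> 0"
    using b(2) bc alg_A_shift[OF bc n] by (simp add: char_ideal_def add.commute)
  have "Some (real n) \<in> topspace Xt"
    using n by (simp add: Some_in_Xt)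
  then obtain s where s: "\<And>k::nat. s k > 1" "\<And>k. s k \<notin> \<int>"
    "\<And>f :: real option \<Rightarrow> complex. continuous_map Xt euclidean f \<Longrightarrow>
      (\<lambda>k. f (Some (s k))) \<longlonglongrightarrow> f (Some (real n))"
    using Xt_nonintegers_dense by blast
  have "\<forall>\<^sub>F k in sequentially. a (Some (s k)) $ 1 $ 1 \<noteq> 0"
    using tendsto_imp_eventually_ne[OF s(3)[OF alg_A_continuous[OF ac]] na] .
  moreover have "\<forall>\<^sub>F k in sequentially. b (Some (s k)) $ 2 $ 2 \<noteq> 0"
    using tendsto_imp_eventually_ne[OF s(3)[OF alg_A_continuous[OF bc]] nb] .
  ultimately have "\<forall>\<^sub>F k in sequentially. a (Some (s k)) $ 1 $ 1 \<noteq> 0 \<and> b (Some (s k)) $ 2 $ 2 \<noteq> 0"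
    by eventually_elim simp
  then obtain k where k: "a (Some (s k)) $ 1 $ 1 \<noteq> 0" "b (Some (s k)) $ 2 $ 2 \<noteq> 0"
    unfolding eventually_sequentially by auto
  then have "a \<notin> point_ideal (s k)" "b \<notin> point_ideal (s k)"
    by (auto simp: point_ideal_def)
  then have "point_ideal (s k) \<in> hk_open I \<inter> hk_open J"
    using a(1) b(1) point_ideal_Prim[OF s(1,2)] by (auto simp: hk_open_def)
  then show False
    using IJ(5) by (auto simp: disjnt_def)
qed (use n char_ideal_Prim in auto)

section \<open>Lower bounds for path lengths\<close>

definition support_above :: "real \<Rightarrow> (real option \<Rightarrow> m2) set" where
  "support_above m = {a \<in> carrier alg_A. \<forall>t \<in> Some ` {1..m} \<inter> topspace Xt. a t = 0}"

definition support_below :: "real \<Rightarrow> (real option \<Rightarrow> m2) set" where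
  "support_below m = {a \<in> carrier alg_A. \<forall>t \<in> insert None (Some ` {m..}) \<inter> topspace Xt. a t = 0}"

lemma support_closed_ideal:
  "closed_ideal alg_A (support_below m)" "closed_ideal alg_A (support_above m)"
  unfolding support_below_def support_above_def by (rule vanishing_on_closed_ideal, rule Int_lower2)+

text \<open>An element of both ideals vanishes on either side of \<open>m\<close>, so their
  intersection is zero and is contained in every primitive ideal.\<close>

lemma hk_open_support_disjoint: "hk_open (support_below m) \<inter> hk_open (support_above m) = {}"
proof -
  have "x = \<zero>\<^bsub>alg_A\<^esub>" if x: "x \<in> support_below m \<inter> support_above m" for x
  proof (rule extensionalityI[of _ "topspace Xt"])
    show "x \<in> extensional (topspace Xt)"
      using that by (simp add: support_below_def extensional_alg_A)
    show "x t = \<zero>\<^bsub>alg_A\<^esub> t" if t: "t \<in> topspace Xt" for t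
      using x t by (cases t; cases "the t \<le> m")
        (auto simp: support_below_def support_above_def alg_A_sel Some_in_Xt)
  qed (simp add: alg_A_sel)
  then have "support_below m \<inter> support_above m \<subseteq> {\<zero>\<^bsub>alg_A\<^esub>}"
    by (intro subsetI) simp
  moreover have "\<zero>\<^bsub>alg_A\<^esub> \<in> P" if "P \<in> Prim alg_A" for P
    using additive_subgroup.zero_closed[OF ideal.axioms(1)[OF closed_ideal_ideal[OF Prim_closed_ideal[OF that]]]] .
  ultimately have "support_below m \<inter> support_above m \<subseteq> P" if "P \<in> Prim alg_A" for P
    using that by (meson empty_subsetI insert_subset order_trans)
  then show ?thesis
    unfolding hk_open_Int[OF support_closed_ideal] by (auto simp: hk_open_def)
qed

text \<open>The ramp is 1 up to \<open>m + 1\<close> and 0 from \<open>m + 2\<close> on. The first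
  unit is needed because the lower corner evaluates at \<open>s + 1\<close> and must still be 1 for
  \<open>s \<le> m\<close>; the second is the width of the ramp.\<close>

lemma partition_element:
  obtains p where "p \<in> support_below (m + 2)" "\<one>\<^bsub>alg_A\<^esub> \<ominus>\<^bsub>alg_A\<^esub> p \<in> support_above m"
    "m \<ge> 0 \<Longrightarrow> p (Some 1) $ 1 $ 1 = 1"
proof -
  define \<phi> where "\<phi> s = complex_of_real (max 0 (min 1 (m + 2 - s)))" for s
  have "\<forall>\<^sub>F s in at_top. \<phi> s = 0"
    using eventually_ge_at_top[of "m + 2"] by eventually_elim (simp add: \<phi>_def)
  then have p: "diag_element \<phi> \<in> carrier alg_A"
    unfolding \<phi>_def by (intro diag_element_closed tendsto_eventually continuous_intros)
  show ?thesis
  proof (rule that[of "diag_element \<phi>"])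
    show "diag_element \<phi> \<in> support_below (m + 2)"
      using p by (auto simp: support_below_def diag_element_simps Some_in_Xt \<phi>_def diag2_arith)
    show "\<one>\<^bsub>alg_A\<^esub> \<ominus>\<^bsub>alg_A\<^esub> diag_element \<phi> \<in> support_above m"
      using p alg_A_minus_closed[OF alg_A_one_closed p]
      by (auto simp: support_above_def alg_A_minus alg_A_one_closed)
        (auto simp: alg_A_sel Some_in_Xt diag_element_simps \<phi>_def diag2_arith)
    show "diag_element \<phi> (Some 1) $ 1 $ 1 = 1" if "m \<ge> 0"
      using that by (simp add: diag_element_simps \<phi>_def diag2_nth)
  qed
qed

text \<open>\<open>P\<close> lies in the open set of \<open>support_below m\<close>, which is
  disjoint from that of \<open>support_above m\<close>; adjacency therefore forces
  \<open>support_above m \<subseteq> Q\<close>. If \<open>Q\<close> contained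
  \<open>support_below (m + 2)\<close> as well, the partition element would put 1 into
  \<open>Q\<close>.\<close>

lemma adjacent_support_below:
  assumes adj: "adjacent alg_A P Q" and P: "\<not> support_below m \<subseteq> P"
  shows "\<not> support_below (m + 2) \<subseteq> Q"
proof
  assume sub: "support_below (m + 2) \<subseteq> Q"
  have Prim: "P \<in> Prim alg_A" "Q \<in> Prim alg_A"
    using adj by (auto simp: adjacent_def)
  interpret Q: ideal Q alg_A
    using closed_ideal_ideal[OF Prim_closed_ideal[OF Prim(2)]] .
  have "P \<in> hk_open (support_below m)"
    using P Prim by (simp add: hk_open_def)
  then have "Q \<notin> hk_open (support_above m)"
    using adj hk_open_support_disjoint[of m] support_closed_ideal[of m]
    unfolding adjacent_def openin_Prim_iff disjnt_def by metis
  then have sub2: "support_above m \<subseteq> Q"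
    using Prim by (simp add: hk_open_def)
  obtain p where p: "p \<in> support_below (m + 2)" "\<one>\<^bsub>alg_A\<^esub> \<ominus>\<^bsub>alg_A\<^esub> p \<in> support_above m"
    using partition_element by blast
  have pc: "p \<in> carrier alg_A"
    using p(1) by (simp add: support_below_def)
  have "(\<one>\<^bsub>alg_A\<^esub> \<ominus>\<^bsub>alg_A\<^esub> p) \<oplus>\<^bsub>alg_A\<^esub> p \<in> Q"
    using p sub sub2 by (intro additive_subgroup.a_closed[OF Q.additive_subgroup_axioms]) auto
  also have "(\<one>\<^bsub>alg_A\<^esub> \<ominus>\<^bsub>alg_A\<^esub> p) \<oplus>\<^bsub>alg_A\<^esub> p = \<one>\<^bsub>alg_A\<^esub>"
    by (simp add: alg_A_minus alg_A_one_closed pc) (simp add: alg_A_sel fun_eq_iff restrict_def)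
  finally have "Q = carrier alg_A"
    by (rule Q.one_imp_carrier)
  then show False
    using Prim_proper[OF Prim(2)] by simp
qed

lemma char_path_length:
  assumes "prim_path alg_A k (char_ideal 1) (char_ideal n) p" "n \<ge> 1"
  shows "n < 2 * k + 2"
proof -
  \<comment> \<open>The bound starts at 2, since the partition element for \<open>m = 0\<close> has
    value 1 at the first character, and it grows by 2 per step. At the end of the path it is
    contradicted once \<open>n\<close> reaches \<open>2 * k + 2\<close>, where all these elements
    vanish.\<close>
  have "\<not> support_below (2 * real i + 2) \<subseteq> p i" if "i \<le> k" for i
    using that
  proof (induction i)
    case 0
    obtain q where "q \<in> support_below (0 + 2)" "q (Some 1) $ 1 $ 1 = 1"
      using partition_element[of 0] by auto
    then have "\<not> support_below 2 \<subseteq> char_ideal 1"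
      by (auto simp: char_ideal_def)
    then show ?case
      using assms(1) by (simp add: prim_path_def)
  next
    case (Suc i)
    then have "adjacent alg_A (p i) (p (Suc i))" "\<not> support_below (2 * real i + 2) \<subseteq> p i"
      using assms(1) by (auto simp: prim_path_def)
    then show ?case
      using adjacent_support_below by (fastforce simp: algebra_simps)
  qed
  from this[of k] have not_sub: "\<not> support_below (2 * real k + 2) \<subseteq> char_ideal n"
    using assms(1) by (simp add: prim_path_def)
  show ?thesis
  proof (rule ccontr)
    assume "\<not> n < 2 * k + 2"
    then have "real n \<ge> 2 * real k + 2"
      by linarith
    then have "support_below (2 * real k + 2) \<subseteq> char_ideal n"
      by (auto simp: support_below_def char_ideal_def Some_in_Xt)
    then show False
      using not_sub by simp
  qed
qed

lemma Orc_alg_A: "Orc alg_A = \<infinity>"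
proof -
  have "enat N \<le> Orc alg_A" for N
  proof -
    \<comment> \<open>With this choice \<open>n < 2 * k + 2\<close> becomes \<open>N < k\<close>. It
      also rules out a path of length 0, so the endpoints differ and \<open>prim_dist\<close> is the
      infimum and not its default 1.\<close>
    define n where "n = 2 * N + 2"
    have ne: "char_ideal 1 \<noteq> char_ideal n"
    proof
      assume eq: "char_ideal 1 = char_ideal n"
      have "prim_path alg_A 0 (char_ideal 1) (char_ideal n) (\<lambda>_. char_ideal 1)"
        using eq char_ideal_Prim[of 1] by (simp add: prim_path_def)
      then show False
        using char_path_length[of 0 n] by (auto simp: n_def)
    qed
    have "prim_path alg_A (n - 1) (char_ideal 1) (char_ideal n) (\<lambda>i. char_ideal (Suc i))"
      using char_ideal_Prim char_ideal_adjacent by (auto simp: prim_path_def n_def)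
    then have "prim_dist alg_A (char_ideal 1) (char_ideal n) \<le> enat (n - 1)"
      using ne by (auto simp: prim_dist_def intro!: Inf_lower)
    then have fin: "prim_dist alg_A (char_ideal 1) (char_ideal n) < \<infinity>"
      using enat_ord_simps(4) le_less_trans by blast
    have "enat N \<le> prim_dist alg_A (char_ideal 1) (char_ideal n)"
    proof -
      have "enat N \<le> x" if mem: "x \<in> {enat k |k. \<exists>p. prim_path alg_A k (char_ideal 1) (char_ideal n) p}" for x
      proof -
        obtain k p where x: "x = enat k" "prim_path alg_A k (char_ideal 1) (char_ideal n) p"
          using mem by blast
        have "n < 2 * k + 2"
          by (rule char_path_length[OF x(2)]) (simp add: n_def)
        then show ?thesis
          by (simp add: x(1) n_def)
      qed
      then show ?thesis
        using ne by (simp only: prim_dist_def if_False) (rule Inf_greatest)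
    qed
    also have "\<dots> \<le> Orc alg_A"
      unfolding Orc_def using fin char_ideal_Prim[of 1] char_ideal_Prim[of n]
      by (intro Sup_upper) (auto simp: n_def)
    finally show ?thesis .
  qed
  then show ?thesis
    by (metis Suc_n_not_le_n enat_ord_simps(1) not_infinity_eq)
qed

section \<open>Symbols of elementary operators\<close>

text \<open>\<open>F t i j k l\<close> is the coefficient of \<open>e\<^sub>i\<^sub>j \<otimes> e\<^sub>k\<^sub>l\<close> at \<open>t\<close>, where \<open>a \<otimes> b\<close> acts by
  \<open>x \<mapsto> a x b\<close>.\<close>

type_synonym symbol = "real option \<Rightarrow> 2 \<Rightarrow> 2 \<Rightarrow> 2 \<Rightarrow> 2 \<Rightarrow> complex"

definition symbol_op :: "symbol \<Rightarrow> (real option \<Rightarrow> m2) \<Rightarrow> real option \<Rightarrow> m2" where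
  "symbol_op F x = (\<lambda>t\<in>topspace Xt. \<chi> i l. \<Sum>j\<in>UNIV. \<Sum>k\<in>UNIV. F t i j k l * x t $ j $ k)"

definition elementary_symbol :: "symbol \<Rightarrow> bool" where
  "elementary_symbol F \<longleftrightarrow> (\<exists>(d::nat) a b. 1 \<le> d \<and> a \<in> {1..d} \<rightarrow> carrier alg_A \<and> b \<in> {1..d} \<rightarrow> carrier alg_A \<and>
     (\<forall>t\<in>topspace Xt. \<forall>i j k l. F t i j k l = (\<Sum>m\<in>{1..d}. a m t $ i $ j * b m t $ k $ l)))"

text \<open>Only the corners \<open>1 1 1 1\<close> and \<open>2 2 2 2\<close> are tied between
  neighbouring integers, since there one character is paired with itself. A mixed corner at
  \<open>n\<close> pairs the characters \<open>n\<close> and \<open>n + 1\<close>, a pair that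
  occurs at no other integer, and so it is free there.\<close>

definition admissible_symbol :: "symbol \<Rightarrow> bool" where
  "admissible_symbol F \<longleftrightarrow>
     (\<forall>i j k l. continuous_map Xt euclidean (\<lambda>t. F t i j k l)) \<and>
     (\<forall>n::nat. 1 \<le> n \<longrightarrow> (\<forall>i j k l. \<not> (i = j \<and> k = l) \<longrightarrow> F (Some (real n)) i j k l = 0)) \<and>
     (\<forall>n::nat. 1 \<le> n \<longrightarrow> F (Some (real n)) 2 2 2 2 = F (Some (real n + 1)) 1 1 1 1) \<and>
     (\<forall>i j k l. F None i j k l = (if i = j \<and> k = l then F None 1 1 1 1 else 0))"

lemma admissible_symbolD:
  assumes "admissible_symbol F"
  shows "continuous_map Xt euclidean (\<lambda>t. F t i j k l)"
    and "1 \<le> n \<Longrightarrow> \<not> (i = j \<and> k = l) \<Longrightarrow> F (Some (real n)) i j k l = 0"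
    and "1 \<le> n \<Longrightarrow> F (Some (real n)) 2 2 2 2 = F (Some (real n + 1)) 1 1 1 1"
    and "F None i j k l = (if i = j \<and> k = l then F None 1 1 1 1 else 0)"
proof -
  note F = assms[unfolded admissible_symbol_def]
  show "continuous_map Xt euclidean (\<lambda>t. F t i j k l)"
    using conjunct1[OF F] by (elim allE)
  show "1 \<le> n \<Longrightarrow> \<not> (i = j \<and> k = l) \<Longrightarrow> F (Some (real n)) i j k l = 0"
    using conjunct1[OF conjunct2[OF F]] by (elim allE impE)
  show "1 \<le> n \<Longrightarrow> F (Some (real n)) 2 2 2 2 = F (Some (real n + 1)) 1 1 1 1"
    using conjunct1[OF conjunct2[OF conjunct2[OF F]]] by (elim allE impE)
  show "F None i j k l = (if i = j \<and> k = l then F None 1 1 1 1 else 0)"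
    using conjunct2[OF conjunct2[OF conjunct2[OF F]]] by (elim allE)
qed

lemma finsum_alg_A:
  assumes "f \<in> {1..d} \<rightarrow> carrier alg_A"
  shows "(\<Oplus>\<^bsub>alg_A\<^esub>k\<in>{1..d::nat}. f k) = (\<lambda>t\<in>topspace Xt. \<Sum>k\<in>{1..d}. f k t)"
  using assms
proof (induction d)
  case 0
  interpret A: ring alg_A by (rule ring_alg_A)
  show ?case
    by (simp add: A.finsum_empty) (simp add: alg_A_sel fun_eq_iff restrict_def)
next
  case (Suc d)
  interpret A: ring alg_A by (rule ring_alg_A)
  have f: "f \<in> {1..d} \<rightarrow> carrier alg_A" "f (Suc d) \<in> carrier alg_A"
    using Suc.prems by auto
  have eq: "{1..Suc d} = insert (Suc d) {1..d}"
    by auto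
  have "(\<Oplus>\<^bsub>alg_A\<^esub>k\<in>{1..Suc d}. f k) = f (Suc d) \<oplus>\<^bsub>alg_A\<^esub> (\<Oplus>\<^bsub>alg_A\<^esub>k\<in>{1..d}. f k)"
    unfolding eq using f by (intro A.finsum_insert) auto
  also have "\<dots> = f (Suc d) \<oplus>\<^bsub>alg_A\<^esub> (\<lambda>t\<in>topspace Xt. \<Sum>k\<in>{1..d}. f k t)"
    by (simp only: Suc.IH[OF f(1)])
  also have "\<dots> = (\<lambda>t\<in>topspace Xt. \<Sum>k\<in>{1..Suc d}. f k t)"
    unfolding eq by (simp add: alg_A_sel fun_eq_iff restrict_def)
  finally show ?case .
qed

lemma sandwich_nth:
  "((a :: m2) ** (x :: m2) ** (b :: m2)) $ i $ l = (\<Sum>j\<in>UNIV. \<Sum>k\<in>UNIV. a $ i $ j * b $ k $ l * x $ j $ k)"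
  unfolding mult_m2_nth sum_2 by (simp add: algebra_simps)

lemma finsum_sandwich:
  assumes a: "a \<in> {1..d} \<rightarrow> carrier alg_A" and b: "b \<in> {1..d} \<rightarrow> carrier alg_A"
    and x: "x \<in> carrier alg_A"
    and F: "\<And>t i j k l. t \<in> topspace Xt \<Longrightarrow> F t i j k l = (\<Sum>m\<in>{1..d}. a m t $ i $ j * b m t $ k $ l)"
  shows "(\<Oplus>\<^bsub>alg_A\<^esub>k\<in>{1..d::nat}. a k \<otimes>\<^bsub>alg_A\<^esub> x \<otimes>\<^bsub>alg_A\<^esub> b k) = symbol_op F x"
proof -
  have "(\<lambda>k. a k \<otimes>\<^bsub>alg_A\<^esub> x \<otimes>\<^bsub>alg_A\<^esub> b k) \<in> {1..d} \<rightarrow> carrier alg_A"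
    using a b x by (auto intro!: alg_A_mult_closed)
  then have "(\<Oplus>\<^bsub>alg_A\<^esub>k\<in>{1..d}. a k \<otimes>\<^bsub>alg_A\<^esub> x \<otimes>\<^bsub>alg_A\<^esub> b k)
    = (\<lambda>t\<in>topspace Xt. \<Sum>k\<in>{1..d}. (a k \<otimes>\<^bsub>alg_A\<^esub> x \<otimes>\<^bsub>alg_A\<^esub> b k) t)"
    by (rule finsum_alg_A)
  also have "\<dots> = symbol_op F x"
    unfolding symbol_op_def
  proof (rule restrict_ext)
    fix t assume t: "t \<in> topspace Xt"
    have "(\<Sum>k\<in>{1..d}. a k t ** x t ** b k t) $ i $ l
      = (\<Sum>j\<in>UNIV. \<Sum>k\<in>UNIV. F t i j k l * x t $ j $ k)" for i l
    proof -
      have "(\<Sum>k\<in>{1..d}. a k t ** x t ** b k t) $ i $ l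
        = (\<Sum>m\<in>{1..d}. \<Sum>j\<in>UNIV. \<Sum>k\<in>UNIV. a m t $ i $ j * b m t $ k $ l * x t $ j $ k)"
        by (simp add: sandwich_nth)
      also have "\<dots> = (\<Sum>j\<in>UNIV. \<Sum>k\<in>UNIV. F t i j k l * x t $ j $ k)"
        by (simp add: F[OF t] sum_2 sum.distrib sum_distrib_right)
      finally show ?thesis .
    qed
    then show "(\<Sum>k\<in>{1..d}. (a k \<otimes>\<^bsub>alg_A\<^esub> x \<otimes>\<^bsub>alg_A\<^esub> b k) t)
      = (\<chi> i l. \<Sum>j\<in>UNIV. \<Sum>k\<in>UNIV. F t i j k l * x t $ j $ k)"
      using t by (simp add: alg_A_sel vec_eq_iff)
  qed
  finally show ?thesis .
qed

lemma elementary_operators_symbol: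
  "elementary_operators alg_A = {\<lambda>x\<in>carrier alg_A. symbol_op F x |F. elementary_symbol F}"
proof (intro equalityI subsetI)
  fix T assume "T \<in> elementary_operators alg_A"
  then obtain d :: nat and a b where d: "1 \<le> d" "a \<in> {1..d} \<rightarrow> carrier alg_A" "b \<in> {1..d} \<rightarrow> carrier alg_A"
    and T: "T = (\<lambda>x\<in>carrier alg_A. (\<Oplus>\<^bsub>alg_A\<^esub>k\<in>{1..d}. a k \<otimes>\<^bsub>alg_A\<^esub> x \<otimes>\<^bsub>alg_A\<^esub> b k))"
    unfolding elementary_operators_def by blast
  define F :: symbol where "F t i j k l = (\<Sum>m\<in>{1..d}. a m t $ i $ j * b m t $ k $ l)" for t i j k l
  have "T = (\<lambda>x\<in>carrier alg_A. symbol_op F x)"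
    unfolding T by (rule restrict_ext) (rule finsum_sandwich[OF d(2,3)], auto simp: F_def)
  moreover have "elementary_symbol F"
    unfolding elementary_symbol_def using d F_def by blast
  ultimately show "T \<in> {\<lambda>x\<in>carrier alg_A. symbol_op F x |F. elementary_symbol F}"
    by blast
next
  fix T assume "T \<in> {\<lambda>x\<in>carrier alg_A. symbol_op F x |F. elementary_symbol F}"
  then obtain F where T: "T = (\<lambda>x\<in>carrier alg_A. symbol_op F x)" and "elementary_symbol F"
    by blast
  then obtain d :: nat and a b where d: "1 \<le> d" "a \<in> {1..d} \<rightarrow> carrier alg_A" "b \<in> {1..d} \<rightarrow> carrier alg_A"
    "\<And>t i j k l. t \<in> topspace Xt \<Longrightarrow> F t i j k l = (\<Sum>m\<in>{1..d}. a m t $ i $ j * b m t $ k $ l)"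
    unfolding elementary_symbol_def by blast
  have "T = (\<lambda>x\<in>carrier alg_A. (\<Oplus>\<^bsub>alg_A\<^esub>k\<in>{1..d}. a k \<otimes>\<^bsub>alg_A\<^esub> x \<otimes>\<^bsub>alg_A\<^esub> b k))"
    unfolding T by (rule restrict_ext) (rule finsum_sandwich[OF d(2,3) _ d(4), symmetric])
  then show "T \<in> elementary_operators alg_A"
    unfolding elementary_operators_def using d(1-3) by blast
qed

lemma elementary_imp_admissible:
  assumes "elementary_symbol F"
  shows "admissible_symbol F"
proof -
  obtain d :: nat and a b where "a \<in> {1..d} \<rightarrow> carrier alg_A" "b \<in> {1..d} \<rightarrow> carrier alg_A"
    and F: "\<And>t i j k l. t \<in> topspace Xt \<Longrightarrow> F t i j k l = (\<Sum>m\<in>{1..d}. a m t $ i $ j * b m t $ k $ l)"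
    using assms unfolding elementary_symbol_def by blast
  then have ab: "m \<in> {1..d} \<Longrightarrow> a m \<in> carrier alg_A" "m \<in> {1..d} \<Longrightarrow> b m \<in> carrier alg_A" for m
    by auto
  have 1: "continuous_map Xt euclidean (\<lambda>t. F t i j k l)" for i j k l
  proof (rule continuous_map_eq)
    have "continuous_map Xt euclidean (\<lambda>t. a m t $ i $ j)" "continuous_map Xt euclidean (\<lambda>t. b m t $ k $ l)"
      if "m \<in> {1..d}" for m
      using alg_A_continuous ab[OF that] by blast+
    then show "continuous_map Xt euclidean (\<lambda>t. \<Sum>m\<in>{1..d}. a m t $ i $ j * b m t $ k $ l)"
      unfolding continuous_map_atin limitin_canonical_iff
      by (intro ballI tendsto_sum tendsto_mult) auto
  qed (simp add: F)
  have 2: "F (Some (real n)) i j k l = 0" if "1 \<le> n" "\<not> (i = j \<and> k = l)" for n i j k l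
  proof -
    have "a m (Some (real n)) $ i $ j * b m (Some (real n)) $ k $ l = 0" if "m \<in> {1..d}" for m
      using alg_A_off_diag[OF ab(1)[OF that] \<open>1 \<le> n\<close>, of i j]
        alg_A_off_diag[OF ab(2)[OF that] \<open>1 \<le> n\<close>, of k l] \<open>\<not> (i = j \<and> k = l)\<close> by auto
    then have "(\<Sum>m\<in>{1..d}. a m (Some (real n)) $ i $ j * b m (Some (real n)) $ k $ l) = 0"
      by (intro sum.neutral ballI)
    then show ?thesis
      using that by (simp add: F Some_in_Xt)
  qed
  have 3: "F (Some (real n)) 2 2 2 2 = F (Some (real n + 1)) 1 1 1 1" if "1 \<le> n" for n
    using that by (simp add: F Some_in_Xt alg_A_shift[OF ab(1) that] alg_A_shift[OF ab(2) that])
  have 4: "F None i j k l = (if i = j \<and> k = l then F None 1 1 1 1 else 0)" for i j k l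
  proof -
    have N: "None \<in> topspace Xt"
      by (simp add: topspace_Xt)
    have "a m None $ i $ j * b m None $ k $ l =
        (if i = j \<and> k = l then a m None $ 1 $ 1 * b m None $ 1 $ 1 else 0)" if "m \<in> {1..d}" for m
      using alg_A_None[OF ab(1)[OF that], of i j] alg_A_None[OF ab(2)[OF that], of k l] by simp
    then have "F None i j k l
      = (\<Sum>m\<in>{1..d}. if i = j \<and> k = l then a m None $ 1 $ 1 * b m None $ 1 $ 1 else 0)"
      unfolding F[OF N] by (rule sum.cong[OF refl])
    then show ?thesis
      unfolding F[OF N, of 1 1 1 1] by (cases "i = j \<and> k = l") (simp_all only: if_True if_False sum.neutral_const simp_thms)
  qed
  show ?thesis
    unfolding admissible_symbol_def by (intro conjI allI impI 1 2 3 4)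
qed

lemma elementary_symbol_cong:
  "elementary_symbol F \<Longrightarrow> (\<And>t i j k l. t \<in> topspace Xt \<Longrightarrow> G t i j k l = F t i j k l) \<Longrightarrow> elementary_symbol G"
  unfolding elementary_symbol_def by simp

lemma elementary_symbol_tensor:
  assumes "a \<in> carrier alg_A" "b \<in> carrier alg_A"
  shows "elementary_symbol (\<lambda>t i j k l. a t $ i $ j * b t $ k $ l)"
  unfolding elementary_symbol_def
  by (rule exI[of _ 1], rule exI[of _ "\<lambda>_. a"], rule exI[of _ "\<lambda>_. b"]) (use assms in simp)

lemma elementary_symbol_add:
  assumes "elementary_symbol F" "elementary_symbol G"
  shows "elementary_symbol (\<lambda>t i j k l. F t i j k l + G t i j k l)"
proof -
  obtain d :: nat and a b where F: "1 \<le> d" "a \<in> {1..d} \<rightarrow> carrier alg_A" "b \<in> {1..d} \<rightarrow> carrier alg_A"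
    "\<And>t i j k l. t \<in> topspace Xt \<Longrightarrow> F t i j k l = (\<Sum>m\<in>{1..d}. a m t $ i $ j * b m t $ k $ l)"
    using assms(1) unfolding elementary_symbol_def by blast
  obtain e :: nat and a' b' where G: "1 \<le> e" "a' \<in> {1..e} \<rightarrow> carrier alg_A" "b' \<in> {1..e} \<rightarrow> carrier alg_A"
    "\<And>t i j k l. t \<in> topspace Xt \<Longrightarrow> G t i j k l = (\<Sum>m\<in>{1..e}. a' m t $ i $ j * b' m t $ k $ l)"
    using assms(2) unfolding elementary_symbol_def by blast
  define A where "A m = (if m \<le> d then a m else a' (m - d))" for m
  define B where "B m = (if m \<le> d then b m else b' (m - d))" for m
  have "(\<Sum>m\<in>{1..d + e}. A m t $ i $ j * B m t $ k $ l) = F t i j k l + G t i j k l"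
    if "t \<in> topspace Xt" for t i j k l
  proof -
    have "(\<Sum>m\<in>{1..d + e}. A m t $ i $ j * B m t $ k $ l)
      = (\<Sum>m\<in>{1..d}. A m t $ i $ j * B m t $ k $ l) + (\<Sum>m\<in>{d + 1..d + e}. A m t $ i $ j * B m t $ k $ l)"
      by (rule sum.ub_add_nat) simp
    also have "(\<Sum>m\<in>{1..d}. A m t $ i $ j * B m t $ k $ l) = F t i j k l"
      by (simp add: F(4)[OF that] A_def B_def)
    also have "(\<Sum>m\<in>{d + 1..d + e}. A m t $ i $ j * B m t $ k $ l)
      = (\<Sum>m\<in>{1..e}. A (m + d) t $ i $ j * B (m + d) t $ k $ l)"
      using sum.shift_bounds_cl_nat_ivl[of "\<lambda>m. A m t $ i $ j * B m t $ k $ l" 1 d e]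
      by (simp add: add.commute)
    also have "\<dots> = G t i j k l"
      unfolding G(4)[OF that] by (rule sum.cong) (auto simp: A_def B_def)
    finally show ?thesis .
  qed
  moreover have "A \<in> {1..d + e} \<rightarrow> carrier alg_A" "B \<in> {1..d + e} \<rightarrow> carrier alg_A"
    using F G by (fastforce simp: A_def B_def Pi_iff)+
  ultimately show ?thesis
    unfolding elementary_symbol_def using F(1)
    by (intro exI[of _ "d + e"] exI[of _ A] exI[of _ B]) simp
qed

lemma elementary_symbol_sum:
  assumes "finite M" "\<And>m. m \<in> M \<Longrightarrow> elementary_symbol (F m)"
  shows "elementary_symbol (\<lambda>t i j k l. \<Sum>m\<in>M. F m t i j k l)"
  using assms
proof (induction M rule: finite_induct)
  case empty
  \<comment> \<open>Elementary operators need at least one summand, so the empty sum is represented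
    by a tensor of zeros.\<close>
  show ?case
    using elementary_symbol_tensor[OF alg_A_zero_closed alg_A_zero_closed]
    by (rule elementary_symbol_cong) (simp add: alg_A_sel)
next
  case (insert m M)
  have "elementary_symbol (\<lambda>t i j k l. F m t i j k l + (\<Sum>m\<in>M. F m t i j k l))"
    using insert by (intro elementary_symbol_add) auto
  then show ?case
    by (rule elementary_symbol_cong) (simp add: insert)
qed

section \<open>Factoring admissible symbols into tensors\<close>

definition root_mod :: "complex \<Rightarrow> complex" where
  "root_mod z = complex_of_real (sqrt (cmod z))"

text \<open>At \<open>0\<close> the division gives \<open>0\<close>, so that \<open>root_arg\<close> is continuous.\<close>

definition root_arg :: "complex \<Rightarrow> complex" where
  "root_arg z = z / root_mod z"

lemma root_mod_arg: "root_mod z * root_arg z = z"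
  by (simp add: root_mod_def root_arg_def)

lemma root_0: "root_mod 0 = 0" "root_arg 0 = 0"
  by (simp_all add: root_mod_def root_arg_def)

lemma continuous_root_mod: "continuous_on UNIV root_mod"
  unfolding root_mod_def by (intro continuous_intros)

lemma continuous_root_arg: "continuous_on UNIV root_arg"
  unfolding continuous_on_eq_continuous_at[OF open_UNIV]
proof
  fix z :: complex
  show "isCont root_arg z"
  proof (cases "z = 0")
    case True
    have "cmod (root_arg w) = sqrt (cmod w)" for w
      by (simp add: root_arg_def root_mod_def norm_divide real_div_sqrt)
    moreover have "((\<lambda>w. sqrt (cmod w)) \<longlongrightarrow> 0) (at 0)"
      using tendsto_real_sqrt[OF tendsto_norm_zero[OF tendsto_ident_at[of "0::complex" UNIV]]] by simp
    ultimately have "((\<lambda>w. cmod (root_arg w)) \<longlongrightarrow> 0) (at 0)"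
      by simp
    then have "(root_arg \<longlongrightarrow> 0) (at 0)"
      by (rule tendsto_norm_zero_cancel)
    then show ?thesis
      by (simp add: True isCont_def root_0)
  next
    case False
    have "isCont root_mod z"
      using continuous_root_mod by (simp add: continuous_on_eq_continuous_at)
    moreover have "root_mod z \<noteq> 0"
      using False by (simp add: root_mod_def)
    ultimately show ?thesis
      unfolding root_arg_def by (intro continuous_intros)
  qed
qed

lemma continuous_map_compose_UNIV:
  "continuous_map X euclidean f \<Longrightarrow> continuous_on UNIV h \<Longrightarrow> continuous_map X euclidean (\<lambda>t. h (f t))"
  using continuous_map_compose[of X euclidean f euclidean h] by (simp add: o_def)

text \<open>Tents of radius 1 around the naturals of one residue class; any other natural is at
  distance at least 1 from them.\<close>

definition cutoff :: "nat \<Rightarrow> real \<Rightarrow> real" where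
  "cutoff r s = max 0 (1 - infdist s {real n |n. n mod 3 = r})"

lemma cutoff_nat:
  assumes "r < 3"
  shows "cutoff r (real n) = (if r = n mod 3 then 1 else 0)"
proof (cases "n mod 3 = r")
  case True
  then have "infdist (real n) {real n |n. n mod 3 = r} = 0"
    by (intro infdist_zero) auto
  then show ?thesis
    using True by (simp add: cutoff_def)
next
  case False
  \<comment> \<open>For \<open>r \<ge> 3\<close> the class is empty, \<open>infdist\<close> is 0 by
    convention and the cutoff would be constantly 1; this is why residues are reduced modulo 3 in
    \<open>pair_symbol\<close>.\<close>
  have ne: "{real n |n. n mod 3 = r} \<noteq> {}"
    using assms by (auto intro!: exI[of _ r])
  have "1 \<le> infdist (real n) {real n |n. n mod 3 = r}"
    unfolding infdist_notempty[OF ne]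
  proof (rule cINF_greatest[OF ne])
    fix a assume "a \<in> {real n |n. n mod 3 = r}"
    then obtain m where m: "a = real m" "m mod 3 = r" by blast
    have "m \<noteq> n"
      using m(2) False by blast
    then have "\<bar>int n - int m\<bar> \<ge> 1"
      by simp
    then have "real_of_int \<bar>int n - int m\<bar> \<ge> 1"
      by linarith
    then show "1 \<le> dist (real n) a"
      by (simp add: m dist_real_def)
  qed
  then show ?thesis
    using False by (auto simp: cutoff_def)
qed

lemma cutoff_bounds: "0 \<le> cutoff r s" "cutoff r s \<le> 1"
  by (simp_all add: cutoff_def infdist_nonneg)

lemma cutoff_times:
  assumes "continuous_on {1..} p" "(p \<longlongrightarrow> (0::complex)) at_top"
  shows "diag_element (\<lambda>s. complex_of_real (cutoff r s) * p s) \<in> carrier alg_A"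
proof (rule diag_element_closed)
  show "continuous_on {1..} (\<lambda>s. complex_of_real (cutoff r s) * p s)"
    unfolding cutoff_def using assms(1) by (intro continuous_intros)
  show "((\<lambda>s. complex_of_real (cutoff r s) * p s) \<longlongrightarrow> 0) at_top"
  proof (rule Lim_null_comparison)
    show "\<forall>\<^sub>F s in at_top. norm (complex_of_real (cutoff r s) * p s) \<le> norm (p s)"
      using cutoff_bounds by (intro always_eventually allI) (simp add: norm_mult mult_left_le_one_le)
    show "((\<lambda>s. norm (p s)) \<longlongrightarrow> 0) at_top"
      using assms(2) by (rule tendsto_norm_zero)
  qed
qed

text \<open>Without the cutoffs, the tensor of the two diagonal elements would carry all four
  products \<open>p u * q w\<close> at \<open>n\<close>. Matching the residue class of
  \<open>u\<close> with the class of \<open>w\<close> shifted by \<open>e\<close> filters them by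
  \<open>w - u\<close>.\<close>

definition pair_symbol :: "nat \<Rightarrow> (real \<Rightarrow> complex) \<Rightarrow> (real \<Rightarrow> complex) \<Rightarrow> symbol" where
  "pair_symbol e p q = (\<lambda>t i j k l. \<Sum>r<3.
     diag_element (\<lambda>s. complex_of_real (cutoff r s) * p s) t $ i $ j *
     diag_element (\<lambda>s. complex_of_real (cutoff ((r + e) mod 3) s) * q s) t $ k $ l)"

lemma pair_symbol_elementary:
  assumes "continuous_on {1..} p" "(p \<longlongrightarrow> 0) at_top" "continuous_on {1..} q" "(q \<longlongrightarrow> 0) at_top"
  shows "elementary_symbol (pair_symbol e p q)"
  unfolding pair_symbol_def
proof (rule elementary_symbol_sum[OF finite_lessThan])
  fix r :: nat
  show "elementary_symbol (\<lambda>t i j k l.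
     diag_element (\<lambda>s. complex_of_real (cutoff r s) * p s) t $ i $ j *
     diag_element (\<lambda>s. complex_of_real (cutoff ((r + e) mod 3) s) * q s) t $ k $ l)"
    by (rule elementary_symbol_tensor[OF cutoff_times[OF assms(1,2)] cutoff_times[OF assms(3,4)]])
qed

lemma cutoff_sum:
  "(\<Sum>r<3. complex_of_real (cutoff r (real u)) * complex_of_real (cutoff ((r + e) mod 3) (real w)))
    = (if (u + e) mod 3 = w mod 3 then 1 else 0)"
proof -
  have "(\<Sum>r<3. complex_of_real (cutoff r (real u)) * complex_of_real (cutoff ((r + e) mod 3) (real w)))
    = (\<Sum>r<3. if r = u mod 3 then (if (r + e) mod 3 = w mod 3 then 1 else 0) else 0)"
    by (rule sum.cong) (auto simp: cutoff_nat)
  then show ?thesis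
    by (simp add: mod_simps)
qed

text \<open>For \<open>n \<ge> 1\<close> only the pair \<open>(u, w)\<close> of neighbours in \<open>{n, n + 1}\<close> with \<open>w - u\<close> congruent
  to \<open>e\<close> modulo 3 survives: this is how the shift \<open>e\<close> selects one diagonal entry.\<close>

lemma pair_symbol_at_nat:
  assumes "n \<ge> 1"
  shows "pair_symbol e p q (Some (real n)) i j k l =
    (if i = j \<and> k = l then
      (let u = (if i = 1 then n else n + 1); w = (if k = 1 then n else n + 1)
       in if (u + e) mod 3 = w mod 3 then p (real u) * q (real w) else 0)
     else 0)"
proof -
  define u where "u = (if i = 1 then n else n + 1)"
  define w where "w = (if k = 1 then n else n + 1)"
  have d: "diag_element f (Some (real n)) $ i' $ j' = (if i' = j' then f (real (if i' = 1 then n else n + 1)) else 0)"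
    for f :: "real \<Rightarrow> complex" and i' j'
    using assms by (simp add: diag_element_simps diag2_nth add.commute)
  show ?thesis
  proof (cases "i = j \<and> k = l")
    case True
    then have "pair_symbol e p q (Some (real n)) i j k l = (\<Sum>r<3.
      (complex_of_real (cutoff r (real u)) * p (real u)) *
      (complex_of_real (cutoff ((r + e) mod 3) (real w)) * q (real w)))"
      unfolding pair_symbol_def d u_def w_def by simp
    also have "\<dots> = (\<Sum>r<3. complex_of_real (cutoff r (real u)) * complex_of_real (cutoff ((r + e) mod 3) (real w)))
      * (p (real u) * q (real w))"
      unfolding sum_distrib_right by (rule sum.cong) (simp_all add: mult_ac)
    also have "\<dots> = (if (u + e) mod 3 = w mod 3 then p (real u) * q (real w) else 0)"
      unfolding cutoff_sum by simp
    finally show ?thesis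
      using True by (simp add: u_def w_def Let_def)
  next
    case False
    then have "pair_symbol e p q (Some (real n)) i j k l = 0"
      unfolding pair_symbol_def d by (intro sum.neutral) auto
    then show ?thesis
      unfolding if_not_P[OF False] .
  qed
qed

lemma pair_symbol_None: "pair_symbol e p q None i j k l = 0"
  by (simp add: pair_symbol_def diag_element_simps)

text \<open>No condition links the entries any more, so each of the sixteen is split on its own into
  two unit elements, both vanishing wherever the entry does.\<close>

lemma elementary_symbol_vanishing:
  assumes cont: "\<And>i j k l. continuous_map Xt euclidean (\<lambda>t. G t i j k l)"
    and zero: "\<And>i j k l. G None i j k l = 0" "\<And>(n::nat) i j k l. n \<ge> 1 \<Longrightarrow> G (Some (real n)) i j k l = 0"
  shows "elementary_symbol G"
proof -
  define H :: "2 \<times> 2 \<times> 2 \<times> 2 \<Rightarrow> symbol" where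
    "H = (\<lambda>(i, j, k, l) t i' j' k' l'. unit_element i j (\<lambda>t. root_mod (G t i j k l)) t $ i' $ j' *
      unit_element k l (\<lambda>t. root_arg (G t i j k l)) t $ k' $ l')"
  have "elementary_symbol (H m)" for m
    unfolding H_def using zero
    by (cases m)
      (simp, intro elementary_symbol_tensor unit_element_closed
        continuous_map_compose_UNIV[OF cont] continuous_root_mod continuous_root_arg; simp add: root_0)
  then have "elementary_symbol (\<lambda>t i j k l. \<Sum>m\<in>UNIV. H m t i j k l)"
    by (intro elementary_symbol_sum) auto
  then show ?thesis
  proof (rule elementary_symbol_cong)
    fix t i j k l assume t: "t \<in> topspace Xt"
    have "H m t i j k l = (if m = (i, j, k, l) then G t i j k l else 0)" for m
      using t by (cases m) (auto simp: H_def unit_element_nth root_mod_arg)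
    then show "G t i j k l = (\<Sum>m\<in>UNIV. H m t i j k l)"
      by simp
  qed
qed

text \<open>It is enough to find an elementary \<open>D\<close> agreeing with \<open>F\<close> at
  the integers and at infinity; the remainder is covered by
  \<open>elementary_symbol_vanishing\<close>.\<close>

lemma admissible_imp_elementary:
  assumes "admissible_symbol F"
  shows "elementary_symbol F"
proof -
  note cont = admissible_symbolD(1)[OF assms] and off = admissible_symbolD(2)[OF assms]
    and shift = admissible_symbolD(3)[OF assms] and None = admissible_symbolD(4)[OF assms]
  define c where "c = F None 1 1 1 1"
  define \<gamma> where "\<gamma> i k s = F (Some s) i i k k - c" for i k s
  have \<gamma>: "continuous_on {1..} (\<gamma> i k)" "(\<gamma> i k \<longlongrightarrow> 0) at_top" for i k
  proof -
    have "continuous_on {1..} (\<lambda>s. F (Some s) i i k k)" "((\<lambda>s. F (Some s) i i k k) \<longlongrightarrow> F None i i k k) at_top"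
      using cont[of i i k k] by (simp_all add: continuous_Xt_iff)
    moreover have "F None i i k k = c"
      by (subst None) (simp add: c_def)
    ultimately show "continuous_on {1..} (\<gamma> i k)" "(\<gamma> i k \<longlongrightarrow> 0) at_top"
      unfolding \<gamma>_def using LIM_zero[of "\<lambda>s. F (Some s) i i k k" c at_top]
      by (simp_all add: continuous_on_diff)
  qed
  \<comment> \<open>A mixed corner at \<open>n\<close> must factor as \<open>p n * q (n + 1)\<close>
    or \<open>p (n + 1) * q n\<close>, so the factor sitting at \<open>n + 1\<close> looks up its
    value at \<open>n\<close>. The maximum keeps the argument inside the half-line.\<close>
  define pred :: "real \<Rightarrow> real" where "pred s = max 1 (s - 1)" for s
  have pred: "continuous_on {1..} (\<lambda>s. \<gamma> i k (pred s))" "((\<lambda>s. \<gamma> i k (pred s)) \<longlongrightarrow> 0) at_top" for i k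
  proof -
    show "continuous_on {1..} (\<lambda>s. \<gamma> i k (pred s))"
      by (rule continuous_on_compose2[OF \<gamma>(1)]) (auto simp: pred_def intro!: continuous_intros)
    have "filterlim (\<lambda>s::real. - 1 + s) at_top at_top"
      by (rule filterlim_tendsto_add_at_top[OF tendsto_const filterlim_ident])
    then have "filterlim pred at_top at_top"
      by (rule filterlim_at_top_mono) (simp add: pred_def)
    then show "((\<lambda>s. \<gamma> i k (pred s)) \<longlongrightarrow> 0) at_top"
      by (rule filterlim_compose[OF \<gamma>(2)])
  qed
  have root: "continuous_on {1..} (\<lambda>s. h (f s))" "((\<lambda>s. h (f s)) \<longlongrightarrow> 0) at_top"
    if "continuous_on {1..} f" "(f \<longlongrightarrow> 0) at_top" "h = root_mod \<or> h = root_arg"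
    for f :: "real \<Rightarrow> complex" and h
  proof -
    have h: "continuous_on UNIV h" "h 0 = 0"
      using that(3) continuous_root_mod continuous_root_arg root_0 by auto
    show "continuous_on {1..} (\<lambda>s. h (f s))"
      by (rule continuous_on_compose2[OF h(1) that(1)]) simp
    have "isCont h 0"
      using h(1) by (simp add: continuous_on_eq_continuous_at)
    then show "((\<lambda>s. h (f s)) \<longlongrightarrow> 0) at_top"
      using isCont_tendsto_compose[of 0 h f at_top] that(2) h(2) by simp
  qed
  note root_mod_null = root[OF _ _ disjI1[OF refl]] and root_arg_null = root[OF _ _ disjI2[OF refl]]
  \<comment> \<open>Shift 0 selects both equal corners: at \<open>2 2 2 2\<close> it yields
    \<open>\<gamma> 1 1 (n + 1)\<close>, which is the required value by the compatibility of
    \<open>F\<close>. Shifts 1 and 2, the latter being -1 modulo 3, select the two mixed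
    corners.\<close>
  define P0 where "P0 = pair_symbol 0 (\<lambda>s. root_mod (\<gamma> 1 1 s)) (\<lambda>s. root_arg (\<gamma> 1 1 s))"
  define P1 where "P1 = pair_symbol 1 (\<lambda>s. root_mod (\<gamma> 1 2 s)) (\<lambda>s. root_arg (\<gamma> 1 2 (pred s)))"
  define P2 where "P2 = pair_symbol 2 (\<lambda>s. root_mod (\<gamma> 2 1 (pred s))) (\<lambda>s. root_arg (\<gamma> 2 1 s))"
  define C :: symbol where "C t i j k l = (c \<odot>\<^bsub>alg_A\<^esub> \<one>\<^bsub>alg_A\<^esub>) t $ i $ j * \<one>\<^bsub>alg_A\<^esub> t $ k $ l" for t i j k l
  define D :: symbol where "D t i j k l = C t i j k l + (P0 t i j k l + (P1 t i j k l + P2 t i j k l))" for t i j k l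
  define G :: symbol where "G t i j k l = F t i j k l - D t i j k l" for t i j k l
  have P: "elementary_symbol P0" "elementary_symbol P1" "elementary_symbol P2"
    unfolding P0_def P1_def P2_def
    by (rule pair_symbol_elementary root_mod_null(1)[OF \<gamma>] root_mod_null(2)[OF \<gamma>]
        root_arg_null(1)[OF \<gamma>] root_arg_null(2)[OF \<gamma>] root_mod_null(1)[OF pred]
        root_mod_null(2)[OF pred] root_arg_null(1)[OF pred] root_arg_null(2)[OF pred])+
  have "elementary_symbol C"
    unfolding C_def by (intro elementary_symbol_tensor alg_A_smult_closed alg_A_one_closed)
  then have D: "elementary_symbol D"
    unfolding D_def by (intro elementary_symbol_add P)
  have C: "C t i j k l = (if i = j \<and> k = l then c else 0)" if "t \<in> topspace Xt" for t i j k l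
    using that by (simp add: C_def alg_A_sel mat_def)
  have "elementary_symbol G"
  proof (rule elementary_symbol_vanishing)
    have "continuous_map Xt euclidean (\<lambda>t. D t i j k l)" for i j k l
      by (rule admissible_symbolD(1)[OF elementary_imp_admissible[OF D]])
    then show "continuous_map Xt euclidean (\<lambda>t. G t i j k l)" for i j k l
      using cont unfolding G_def continuous_map_atin limitin_canonical_iff
      by (intro ballI tendsto_diff) auto
    show "G None i j k l = 0" for i j k l
      using None[of i j k l]
      by (simp add: G_def D_def C topspace_Xt P0_def P1_def P2_def pair_symbol_None c_def)
    fix n :: nat and i j k l :: 2
    assume n: "n \<ge> 1"
    have Cn: "C (Some (real n)) i j k l = (if i = j \<and> k = l then c else 0)"
      using n by (intro C) (simp add: Some_in_Xt)
    have pn: "pred (1 + real n) = real n"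
      using n by (simp add: pred_def)
    have m3: "(n + 1) mod 3 \<noteq> n mod 3" "(n + 2) mod 3 \<noteq> n mod 3" "(n + 2) mod 3 \<noteq> (n + 1) mod 3"
      "(n + 1 + 1) mod 3 \<noteq> n mod 3" "(n + 1 + 1) mod 3 \<noteq> (n + 1) mod 3"
      "(n + 1 + 2) mod 3 = n mod 3" "(n + 1 + 2) mod 3 \<noteq> (n + 1) mod 3"
      by presburger+
    have P0n: "P0 (Some (real n)) i j k l = (if i = j \<and> k = l \<and> i = k then \<gamma> 1 1 (if i = 1 then n else n + 1) else 0)"
      unfolding P0_def pair_symbol_at_nat[OF n] Let_def
      using m3 exhaust_2[of i] exhaust_2[of k] by (auto simp: root_mod_arg)
    have P1n: "P1 (Some (real n)) i j k l = (if i = j \<and> k = l \<and> i = 1 \<and> k = 2 then \<gamma> 1 2 n else 0)"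
      unfolding P1_def pair_symbol_at_nat[OF n] Let_def
      using m3 exhaust_2[of i] exhaust_2[of k] pn by (auto simp: root_mod_arg)
    have P2n: "P2 (Some (real n)) i j k l = (if i = j \<and> k = l \<and> i = 2 \<and> k = 1 then \<gamma> 2 1 n else 0)"
      unfolding P2_def pair_symbol_at_nat[OF n] Let_def
      using m3 exhaust_2[of i] exhaust_2[of k] pn by (auto simp: root_mod_arg)
    show "G (Some (real n)) i j k l = 0"
    proof (cases "i = j \<and> k = l")
      case True
      then show ?thesis
        using exhaust_2[of i] exhaust_2[of k] shift[OF n]
        unfolding G_def D_def Cn P0n P1n P2n \<gamma>_def by (auto simp: add.commute)
    next
      case False
      then show ?thesis
        using off[OF n, of i j k l] unfolding G_def D_def Cn P0n P1n P2n by auto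
    qed
  qed
  from elementary_symbol_add[OF D this] show ?thesis
  proof (rule elementary_symbol_cong)
    show "F t i j k l = D t i j k l + G t i j k l" for t i j k l
      by (simp add: G_def)
  qed
qed

lemma elementary_symbol_iff_admissible: "elementary_symbol F \<longleftrightarrow> admissible_symbol F"
  using admissible_imp_elementary elementary_imp_admissible by (rule iffI[rotated])

lemma elementary_operators_admissible:
  "elementary_operators alg_A = {\<lambda>x\<in>carrier alg_A. symbol_op F x |F. admissible_symbol F}"
  unfolding elementary_operators_symbol elementary_symbol_iff_admissible ..

section \<open>Completely bounded norms and closedness\<close>

lemma block_norm_cong:
  "(\<And>i j. i < n \<Longrightarrow> j < n \<Longrightarrow> M i j = N i j) \<Longrightarrow> block_norm n M = block_norm n N"
proof -
  assume eq: "\<And>i j. i < n \<Longrightarrow> j < n \<Longrightarrow> M i j = N i j"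
  have "L2_set (\<lambda>i. norm (\<Sum>j<n. M i j *v v j)) {..<n} = L2_set (\<lambda>i. norm (\<Sum>j<n. N i j *v v j)) {..<n}"
    for v :: "nat \<Rightarrow> complex^2"
    by (rule L2_set_cong) (simp_all add: eq)
  then show ?thesis
    by (simp add: block_norm_def)
qed

lemma block_norm_zero: "block_norm n (\<lambda>i j. 0) = 0"
  using block_norm_le_entry_sum[of n "\<lambda>i j. 0"] block_norm_nonneg[of n "\<lambda>i j. 0"]
  by (simp add: entry_sum_def)

lemma block_norm_sum:
  assumes "finite I"
  shows "block_norm n (\<lambda>i j. \<Sum>m\<in>I. M m i j) \<le> (\<Sum>m\<in>I. block_norm n (M m))"
  using assms
proof (induction I rule: finite_induct)
  case empty
  show ?case
    by (simp add: block_norm_zero)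
next
  case (insert m I)
  have "block_norm n (\<lambda>i j. \<Sum>m\<in>insert m I. M m i j) \<le> block_norm n (M m) + block_norm n (\<lambda>i j. \<Sum>m\<in>I. M m i j)"
    using block_norm_add[of n "M m" "\<lambda>i j. \<Sum>m\<in>I. M m i j"] insert(1,2) by simp
  then show ?case
    using insert by simp
qed

lemma finsum_in_ideal:
  assumes J: "ideal J alg_A" and f: "f \<in> {1..d} \<rightarrow> J"
  shows "(\<Oplus>\<^bsub>alg_A\<^esub>k\<in>{1..d::nat}. f k) \<in> J"
  using f
proof (induction d)
  interpret A: ring alg_A by (rule ring_alg_A)
  interpret J: additive_subgroup J alg_A by (rule ideal.axioms(1)[OF J])
  {
    case 0
    show ?case
      using J.zero_closed by (simp add: A.finsum_empty)
  next
    case (Suc d)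
    have eq: "{1..Suc d} = insert (Suc d) {1..d}"
      by auto
    have fJ: "f m \<in> J" if "m \<in> {1..Suc d}" for m
      using Suc.prems that by (rule funcset_mem)
    then have "f m \<in> carrier alg_A" if "m \<in> {1..Suc d}" for m
      using ideal.Icarr[OF J] that by simp
    then have f: "f (Suc d) \<in> J" "f \<in> {1..d} \<rightarrow> J" "f \<in> {1..d} \<rightarrow> carrier alg_A" "f (Suc d) \<in> carrier alg_A"
      using fJ by auto
    have "(\<Oplus>\<^bsub>alg_A\<^esub>k\<in>{1..Suc d}. f k) = f (Suc d) \<oplus>\<^bsub>alg_A\<^esub> (\<Oplus>\<^bsub>alg_A\<^esub>k\<in>{1..d}. f k)"
      unfolding eq using f by (intro A.finsum_insert) auto
    then show ?case
      using J.a_closed[OF f(1) Suc.IH[OF f(2)]] by simp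
  }
qed

lemma symbol_op_linear:
  "symbol_op F (x \<oplus>\<^bsub>alg_A\<^esub> y) = symbol_op F x \<oplus>\<^bsub>alg_A\<^esub> symbol_op F y"
  "symbol_op F (c \<odot>\<^bsub>alg_A\<^esub> x) = c \<odot>\<^bsub>alg_A\<^esub> symbol_op F x"
proof -
  show "symbol_op F (x \<oplus>\<^bsub>alg_A\<^esub> y) = symbol_op F x \<oplus>\<^bsub>alg_A\<^esub> symbol_op F y"
    unfolding symbol_op_def alg_A_sel
    by (rule restrict_ext) (simp add: vec_eq_iff distrib_left sum.distrib)
  show "symbol_op F (c \<odot>\<^bsub>alg_A\<^esub> x) = c \<odot>\<^bsub>alg_A\<^esub> symbol_op F x"
    unfolding symbol_op_def alg_A_sel
    by (rule restrict_ext) (simp add: vec_eq_iff sum_distrib_left mult_ac)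
qed

text \<open>Ideals are preserved term by term, and the sandwich estimate bounds all amplifications
  at once by a constant formed from the coefficients only.\<close>

lemma elementary_subset_ICB: "elementary_operators alg_A \<subseteq> ICB alg_A"
proof
  fix T assume "T \<in> elementary_operators alg_A"
  then obtain d :: nat and a b where d: "1 \<le> d" "a \<in> {1..d} \<rightarrow> carrier alg_A" "b \<in> {1..d} \<rightarrow> carrier alg_A"
    and T: "T = (\<lambda>x\<in>carrier alg_A. (\<Oplus>\<^bsub>alg_A\<^esub>k\<in>{1..d}. a k \<otimes>\<^bsub>alg_A\<^esub> x \<otimes>\<^bsub>alg_A\<^esub> b k))"
    unfolding elementary_operators_def by blast
  have ab: "a m \<in> carrier alg_A" "b m \<in> carrier alg_A" if "m \<in> {1..d}" for m
    using d(2,3) that by auto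
  have closed: "(\<lambda>k. a k \<otimes>\<^bsub>alg_A\<^esub> x \<otimes>\<^bsub>alg_A\<^esub> b k) \<in> {1..d} \<rightarrow> J"
    if J: "ideal J alg_A" and "x \<in> J" for x J
    using that ab ideal.I_l_closed[OF J] ideal.I_r_closed[OF J] by simp
  have TJ: "T x \<in> J" if J: "ideal J alg_A" and x: "x \<in> J" for x J
  proof -
    have "x \<in> carrier alg_A"
      by (rule ideal.Icarr[OF J x])
    then show ?thesis
      using finsum_in_ideal[OF J closed[OF J x]] by (simp add: T)
  qed
  \<comment> \<open>The whole algebra is one of the ideals just treated.\<close>
  have Tc: "T x \<in> carrier alg_A" if "x \<in> carrier alg_A" for x
    using TJ[OF ring.oneideal[OF ring_alg_A] that] .
  obtain F where F: "T = (\<lambda>x\<in>carrier alg_A. symbol_op F x)"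
    using \<open>T \<in> elementary_operators alg_A\<close> unfolding elementary_operators_symbol by auto
  have "T \<in> linear_maps alg_A"
    unfolding linear_maps_def
  proof (intro CollectI conjI ballI allI)
    show "T \<in> carrier alg_A \<rightarrow>\<^sub>E carrier alg_A"
      using Tc by (simp add: T PiE_iff)
  qed (simp_all add: F alg_A_add_closed alg_A_smult_closed symbol_op_linear)
  moreover have "bdd_above (amplification_norms alg_A T)"
  proof -
    have "\<exists>K\<ge>0. \<forall>t\<in>topspace Xt. entry_sum (x t) \<le> K" if "x \<in> carrier alg_A" for x
      using entry_sum_bounded[OF alg_A_continuous[OF that]] by metis
    then obtain K where K: "\<And>x. x \<in> carrier alg_A \<Longrightarrow> K x \<ge> 0"
      "\<And>x t. x \<in> carrier alg_A \<Longrightarrow> t \<in> topspace Xt \<Longrightarrow> entry_sum (x t) \<le> K x"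
      by metis
    show ?thesis
    proof (rule bdd_aboveI)
      fix r assume "r \<in> amplification_norms alg_A T"
      then obtain n x where r: "r = mat_norm alg_A n (\<lambda>i j. T (x i j))"
        and x: "\<And>i j. i < n \<Longrightarrow> j < n \<Longrightarrow> x i j \<in> carrier alg_A" and x1: "mat_norm alg_A n x \<le> 1"
        unfolding amplification_norms_def by auto
      show "r \<le> (\<Sum>m\<in>{1..d}. K (a m) * K (b m))"
        unfolding r
      proof (rule mat_norm_least)
        fix t assume t: "t \<in> topspace Xt"
        have "T (x i j) t = (\<Sum>m\<in>{1..d}. a m t ** x i j t ** b m t)" if "i < n" "j < n" for i j
        proof -
          have "T (x i j) = (\<lambda>t\<in>topspace Xt. \<Sum>k\<in>{1..d}. (a k \<otimes>\<^bsub>alg_A\<^esub> x i j \<otimes>\<^bsub>alg_A\<^esub> b k) t)"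
            using finsum_alg_A[OF closed[OF ring.oneideal[OF ring_alg_A] x[OF that]]] x[OF that]
            by (simp add: T)
          then show ?thesis
            using t by (simp add: alg_A_sel)
        qed
        then have "block_norm n (\<lambda>i j. T (x i j) t) = block_norm n (\<lambda>i j. \<Sum>m\<in>{1..d}. a m t ** x i j t ** b m t)"
          by (rule block_norm_cong)
        also have "\<dots> \<le> (\<Sum>m\<in>{1..d}. block_norm n (\<lambda>i j. a m t ** x i j t ** b m t))"
          by (rule block_norm_sum) simp
        also have "\<dots> \<le> (\<Sum>m\<in>{1..d}. K (a m) * K (b m))"
        proof (rule sum_mono)
          fix m assume m: "m \<in> {1..d}"
          have "block_norm n (\<lambda>i j. x i j t) \<le> 1"
            using block_norm_le_mat_norm[where a = x and n = n, OF x t] x1 by linarith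
          then have "entry_sum (a m t) * entry_sum (b m t) * block_norm n (\<lambda>i j. x i j t) \<le> K (a m) * K (b m) * 1"
            using K ab[OF m] t by (intro mult_mono mult_nonneg_nonneg) (auto simp: entry_sum_nonneg block_norm_nonneg)
          then show "block_norm n (\<lambda>i j. a m t ** x i j t ** b m t) \<le> K (a m) * K (b m)"
            using block_norm_sandwich[of n "a m t" "\<lambda>i j. x i j t" "b m t"] by linarith
        qed
        finally show "block_norm n (\<lambda>i j. T (x i j) t) \<le> (\<Sum>m\<in>{1..d}. K (a m) * K (b m))" .
      qed
    qed
  qed
  ultimately show "T \<in> ICB alg_A"
    unfolding ICB_def CB_def using TJ closed_ideal_ideal by auto
qed

lemma admissible_symbol_scale:
  assumes "admissible_symbol F"
  shows "admissible_symbol (\<lambda>t i j k l. c * F t i j k l)"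
  unfolding admissible_symbol_def
proof (intro conjI allI impI)
  show "continuous_map Xt euclidean (\<lambda>t. c * F t i j k l)" for i j k l
    using continuous_map_compose_UNIV[OF admissible_symbolD(1)[OF assms], of "\<lambda>z. c * z"]
    by (simp add: continuous_on_mult_left continuous_on_id)
  show "c * F None i j k l = (if i = j \<and> k = l then c * F None 1 1 1 1 else 0)" for i j k l
    by (subst admissible_symbolD(4)[OF assms]) simp
  show "c * F (Some (real n)) i j k l = 0" if "1 \<le> n" "\<not> (i = j \<and> k = l)" for n i j k l
    by (simp only: admissible_symbolD(2)[OF assms that] mult_zero_right)
qed (simp only: admissible_symbolD(3)[OF assms])

lemma elementary_map_subspace: "map_subspace alg_A (elementary_operators alg_A) (ICB alg_A)"
  unfolding map_subspace_def
proof (intro conjI ballI allI)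
  have "elementary_symbol (\<lambda>t i j k l. \<zero>\<^bsub>alg_A\<^esub> t $ i $ j * \<zero>\<^bsub>alg_A\<^esub> t $ k $ l)"
    by (rule elementary_symbol_tensor[OF alg_A_zero_closed alg_A_zero_closed])
  moreover have "(\<lambda>x\<in>carrier alg_A. \<zero>\<^bsub>alg_A\<^esub>)
    = (\<lambda>x\<in>carrier alg_A. symbol_op (\<lambda>t i j k l. \<zero>\<^bsub>alg_A\<^esub> t $ i $ j * \<zero>\<^bsub>alg_A\<^esub> t $ k $ l) x)"
    by (rule restrict_ext) (simp add: symbol_op_def alg_A_sel fun_eq_iff restrict_def vec_eq_iff)
  ultimately show "(\<lambda>x\<in>carrier alg_A. \<zero>\<^bsub>alg_A\<^esub>) \<in> elementary_operators alg_A"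
    unfolding elementary_operators_symbol by (intro CollectI exI conjI)
next
  fix S T assume "S \<in> elementary_operators alg_A" "T \<in> elementary_operators alg_A"
  then obtain F G where FG: "S = (\<lambda>x\<in>carrier alg_A. symbol_op F x)" "elementary_symbol F"
    "T = (\<lambda>x\<in>carrier alg_A. symbol_op G x)" "elementary_symbol G"
    unfolding elementary_operators_symbol by auto
  have "(\<lambda>x\<in>carrier alg_A. S x \<oplus>\<^bsub>alg_A\<^esub> T x)
    = (\<lambda>x\<in>carrier alg_A. symbol_op (\<lambda>t i j k l. F t i j k l + G t i j k l) x)"
    unfolding FG
    by (rule restrict_ext)
      (simp add: symbol_op_def alg_A_sel fun_eq_iff restrict_def vec_eq_iff distrib_right sum.distrib)
  then show "(\<lambda>x\<in>carrier alg_A. S x \<oplus>\<^bsub>alg_A\<^esub> T x) \<in> elementary_operators alg_A"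
    unfolding elementary_operators_symbol using elementary_symbol_add[OF FG(2,4)]
    by (intro CollectI exI conjI)
next
  fix c T assume "T \<in> elementary_operators alg_A"
  then obtain F where F: "T = (\<lambda>x\<in>carrier alg_A. symbol_op F x)" "admissible_symbol F"
    unfolding elementary_operators_admissible by auto
  have "(\<lambda>x\<in>carrier alg_A. c \<odot>\<^bsub>alg_A\<^esub> T x)
    = (\<lambda>x\<in>carrier alg_A. symbol_op (\<lambda>t i j k l. c * F t i j k l) x)"
    unfolding F
    by (rule restrict_ext)
      (simp add: symbol_op_def alg_A_sel fun_eq_iff restrict_def vec_eq_iff sum_distrib_left mult_ac)
  then show "(\<lambda>x\<in>carrier alg_A. c \<odot>\<^bsub>alg_A\<^esub> T x) \<in> elementary_operators alg_A"
    unfolding elementary_operators_admissible using admissible_symbol_scale[OF F(2)]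
    by (intro CollectI exI conjI)
qed (rule elementary_subset_ICB)

section \<open>Closedness in the cb-norm\<close>

lemma amplification_norms_diff:
  assumes S: "S \<in> CB alg_A" and T: "T \<in> CB alg_A"
  shows "bdd_above (amplification_norms alg_A (\<lambda>x\<in>carrier alg_A. S x \<ominus>\<^bsub>alg_A\<^esub> T x))"
\<comment> \<open>A difference of completely bounded maps must be shown to be bounded first:
  \<open>cb_norm\<close> is a supremum of reals and dominates nothing otherwise.\<close>
proof -
  have Sc: "S x \<in> carrier alg_A" and Tc: "T x \<in> carrier alg_A" if "x \<in> carrier alg_A" for x
    using S T that by (auto simp: CB_def linear_maps_def)
  obtain A B where AB: "\<And>r. r \<in> amplification_norms alg_A S \<Longrightarrow> r \<le> A"
    "\<And>r. r \<in> amplification_norms alg_A T \<Longrightarrow> r \<le> B"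
    using S T unfolding CB_def bdd_above_def by auto
  show ?thesis
  proof (rule bdd_aboveI)
    fix r assume "r \<in> amplification_norms alg_A (\<lambda>x\<in>carrier alg_A. S x \<ominus>\<^bsub>alg_A\<^esub> T x)"
    then obtain n x where r: "r = mat_norm alg_A n (\<lambda>i j. (\<lambda>x\<in>carrier alg_A. S x \<ominus>\<^bsub>alg_A\<^esub> T x) (x i j))"
      and n: "1 \<le> n" and x: "\<forall>i<n. \<forall>j<n. x i j \<in> carrier alg_A" and x1: "mat_norm alg_A n x \<le> 1"
      unfolding amplification_norms_def by auto
    have "mat_norm alg_A n (\<lambda>i j. S (x i j)) \<in> amplification_norms alg_A S"
      "mat_norm alg_A n (\<lambda>i j. T (x i j)) \<in> amplification_norms alg_A T"
      unfolding amplification_norms_def using n x x1 by auto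
    then have le: "mat_norm alg_A n (\<lambda>i j. S (x i j)) \<le> A" "mat_norm alg_A n (\<lambda>i j. T (x i j)) \<le> B"
      by (auto intro: AB)
    show "r \<le> A + B"
      unfolding r
    proof (rule mat_norm_least)
      fix t assume t: "t \<in> topspace Xt"
      have "block_norm n (\<lambda>i j. (\<lambda>x\<in>carrier alg_A. S x \<ominus>\<^bsub>alg_A\<^esub> T x) (x i j) t)
        = block_norm n (\<lambda>i j. S (x i j) t + - T (x i j) t)"
        by (rule block_norm_cong) (use x t in \<open>simp add: alg_A_minus Sc Tc\<close>)
      also have "\<dots> \<le> block_norm n (\<lambda>i j. S (x i j) t) + block_norm n (\<lambda>i j. T (x i j) t)"
        using block_norm_add[of n "\<lambda>i j. S (x i j) t" "\<lambda>i j. - T (x i j) t"]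
          block_norm_minus[of n "\<lambda>i j. T (x i j) t"] by simp
      also have "\<dots> \<le> mat_norm alg_A n (\<lambda>i j. S (x i j)) + mat_norm alg_A n (\<lambda>i j. T (x i j))"
        by (intro add_mono block_norm_le_mat_norm t) (use x in \<open>simp_all add: Sc Tc\<close>)
      finally show "block_norm n (\<lambda>i j. (\<lambda>x\<in>carrier alg_A. S x \<ominus>\<^bsub>alg_A\<^esub> T x) (x i j) t) \<le> A + B"
        using le by linarith
    qed
  qed
qed

text \<open>The amplification with \<open>n = 1\<close> already controls every entry.\<close>

lemma entry_diff_le_cb_norm:
  assumes "S \<in> CB alg_A" "T \<in> CB alg_A" and x: "x \<in> carrier alg_A" "cstar_norm alg_A x \<le> 1"
    and t: "t \<in> topspace Xt"
  shows "cmod (S x t $ i $ j - T x t $ i $ j) \<le> cb_norm alg_A (\<lambda>x\<in>carrier alg_A. S x \<ominus>\<^bsub>alg_A\<^esub> T x)"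
proof -
  let ?D = "\<lambda>x\<in>carrier alg_A. S x \<ominus>\<^bsub>alg_A\<^esub> T x"
  have c: "S x \<in> carrier alg_A" "T x \<in> carrier alg_A"
    using assms by (auto simp: CB_def linear_maps_def)
  have "cmod (S x t $ i $ j - T x t $ i $ j) = cmod (?D x t $ i $ j)"
    using x t c by (simp add: alg_A_minus)
  also have "\<dots> \<le> cstar_norm alg_A (?D x)"
    using x t c by (intro entry_le_norm) (simp_all add: alg_A_minus_closed)
  also have "\<dots> \<le> cb_norm alg_A ?D"
    unfolding cb_norm_def
  proof (rule cSup_upper[OF _ amplification_norms_diff[OF assms(1,2)]])
    show "cstar_norm alg_A (?D x) \<in> amplification_norms alg_A ?D"
      unfolding amplification_norms_def cstar_norm_def
      by (rule CollectI, rule exI[of _ 1], rule exI[of _ "\<lambda>_ _. x"])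
        (use x in \<open>simp add: cstar_norm_def\<close>)
  qed
  finally show ?thesis .
qed

lemma cstar_norm_le:
  assumes "\<And>t. t \<in> topspace Xt \<Longrightarrow> entry_sum (x t) \<le> K"
  shows "cstar_norm alg_A x \<le> K"
  unfolding cstar_norm_def
proof (rule mat_norm_least)
  fix t assume "t \<in> topspace Xt"
  then show "block_norm 1 (\<lambda>i j. x t) \<le> K"
    using assms block_norm_le_entry_sum[of 1 "\<lambda>i j. x t"] by fastforce
qed

text \<open>Uniformity is used for continuity; the equations at the integers and at infinity pass to
  pointwise limits.\<close>

lemma admissible_symbol_limit:
  assumes adm: "\<And>n. admissible_symbol (F n)"
    and unif: "\<And>i j k l. uniform_limit (topspace Xt) (\<lambda>n t. F n t i j k l) (\<lambda>t. G t i j k l) sequentially"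
  shows "admissible_symbol G"
proof -
  have lim: "(\<lambda>n. F n t i j k l) \<longlonglongrightarrow> G t i j k l" if "t \<in> topspace Xt" for t i j k l
    using tendsto_uniform_limitI[OF unif that] .
  have N: "None \<in> topspace Xt"
    by (simp add: topspace_Xt)
  have 1: "continuous_map Xt euclidean (\<lambda>t. G t i j k l)" for i j k l
    unfolding continuous_map_atin limitin_canonical_iff
  proof
    fix t assume t: "t \<in> topspace Xt"
    have "((\<lambda>t. F n t i j k l) \<longlongrightarrow> F n t i j k l) (atin Xt t)" for n
      using admissible_symbolD(1)[OF adm] t unfolding continuous_map_atin limitin_canonical_iff by blast
    moreover have "\<forall>\<^sub>F x in atin Xt t. x \<in> topspace Xt"
      using openin_topspace t unfolding eventually_atin by blast
    ultimately show "((\<lambda>t. G t i j k l) \<longlongrightarrow> G t i j k l) (atin Xt t)"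
      by (intro swap_uniform_limit'[OF always_eventually lim[OF t] unif]) auto
  qed
  have 2: "G (Some (real n)) i j k l = 0" if "1 \<le> n" "\<not> (i = j \<and> k = l)" for n i j k l
    using lim[of "Some (real n)" i j k l] that admissible_symbolD(2)[OF adm that]
    by (simp add: Some_in_Xt LIMSEQ_const_iff)
  have 3: "G (Some (real n)) 2 2 2 2 = G (Some (real n + 1)) 1 1 1 1" if "1 \<le> n" for n
  proof (rule LIMSEQ_unique)
    show "(\<lambda>m. F m (Some (real n)) 2 2 2 2) \<longlonglongrightarrow> G (Some (real n)) 2 2 2 2"
      using that by (intro lim) (simp add: Some_in_Xt)
    show "(\<lambda>m. F m (Some (real n)) 2 2 2 2) \<longlonglongrightarrow> G (Some (real n + 1)) 1 1 1 1"
      unfolding admissible_symbolD(3)[OF adm that] by (intro lim) (simp add: Some_in_Xt)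
  qed
  have 4: "G None i j k l = (if i = j \<and> k = l then G None 1 1 1 1 else 0)" for i j k l
  proof (rule LIMSEQ_unique[OF lim[OF N]])
    have "(\<lambda>m. if i = j \<and> k = l then F m None 1 1 1 1 else 0)
      \<longlonglongrightarrow> (if i = j \<and> k = l then G None 1 1 1 1 else 0)"
      using lim[OF N, of 1 1 1 1] by (cases "i = j \<and> k = l") (simp_all only: if_True if_False simp_thms tendsto_const)
    moreover have "(\<lambda>m. F m None i j k l) = (\<lambda>m. if i = j \<and> k = l then F m None 1 1 1 1 else 0)"
      by (rule ext) (rule admissible_symbolD(4)[OF adm])
    ultimately show "(\<lambda>m. F m None i j k l) \<longlonglongrightarrow> (if i = j \<and> k = l then G None 1 1 1 1 else 0)"
      by (simp only:)
  qed
  show ?thesis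
    unfolding admissible_symbol_def by (intro conjI allI impI 1 2 3 4)
qed

lemma elementary_cb_closed: "cb_closed_in alg_A (elementary_operators alg_A) (ICB alg_A)"
  unfolding cb_closed_in_def
proof (intro conjI allI impI)
  fix S :: "nat \<Rightarrow> (real option \<Rightarrow> m2) \<Rightarrow> real option \<Rightarrow> m2" and T
  assume "(\<forall>n. S n \<in> elementary_operators alg_A) \<and> T \<in> ICB alg_A \<and>
    (\<lambda>n. cb_norm alg_A (\<lambda>x\<in>carrier alg_A. S n x \<ominus>\<^bsub>alg_A\<^esub> T x)) \<longlonglongrightarrow> 0"
  then have S: "\<And>n. S n \<in> elementary_operators alg_A" and T: "T \<in> ICB alg_A"
    and lim: "(\<lambda>n. cb_norm alg_A (\<lambda>x\<in>carrier alg_A. S n x \<ominus>\<^bsub>alg_A\<^esub> T x)) \<longlonglongrightarrow> 0"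
    by auto
  define e where "e = (\<lambda>n. cb_norm alg_A (\<lambda>x\<in>carrier alg_A. S n x \<ominus>\<^bsub>alg_A\<^esub> T x))"
  have e: "e \<longlonglongrightarrow> 0"
    using lim by (simp add: e_def)
  have "\<exists>F. S n = (\<lambda>x\<in>carrier alg_A. symbol_op F x) \<and> admissible_symbol F" for n
    using S[of n] unfolding elementary_operators_admissible by auto
  then obtain F where F: "\<And>n. S n = (\<lambda>x\<in>carrier alg_A. symbol_op (F n) x)" "\<And>n. admissible_symbol (F n)"
    by metis
  have CB: "S n \<in> CB alg_A" "T \<in> CB alg_A" for n
    using subsetD[OF elementary_subset_ICB S[of n]] T by (auto simp: ICB_def)
  have bound: "cmod (S n x t $ i $ j - T x t $ i $ j) \<le> e n"
    if "x \<in> carrier alg_A" "cstar_norm alg_A x \<le> 1" "t \<in> topspace Xt" for x t n i j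
    unfolding e_def by (rule entry_diff_le_cb_norm[OF CB that])
  \<comment> \<open>\<open>T\<close> has no symbol yet, so \<open>F n\<close> and \<open>F m\<close>
    are compared through the value of \<open>T\<close> at one bump unit, whose only nonzero entry
    \<open>j k\<close> isolates the coefficient.\<close>
  have at_nonint: "cmod (F n (Some s) i j k l - F m (Some s) i j k l) \<le> e n + e m"
    if s: "s > 1" "s \<notin> \<int>" for s n m i j k l
  proof -
    obtain \<phi> :: "real option \<Rightarrow> complex" where \<phi>: "continuous_map Xt euclidean \<phi>" "\<phi> None = 0"
      "\<And>n::nat. \<phi> (Some n) = 0" "\<phi> (Some s) = 1" "\<And>t. cmod (\<phi> t) \<le> 1"
      using bump_exists[OF s(2)] by metis
    define x where "x = unit_element j k \<phi>"
    have x: "x \<in> carrier alg_A"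
      unfolding x_def by (rule unit_element_closed) (use \<phi> in auto)
    have "entry_sum (x t) \<le> 1" if "t \<in> topspace Xt" for t
    proof -
      have "cmod (x t $ i' $ j') = (if i' = j then if j' = k then cmod (\<phi> t) else 0 else 0)" for i' j'
        using that by (simp add: x_def unit_element_nth)
      then have "entry_sum (x t) = (\<Sum>i'\<in>UNIV. if i' = j then (\<Sum>j'\<in>UNIV. if j' = k then cmod (\<phi> t) else 0) else 0)"
        unfolding entry_sum_def by (intro sum.cong refl) simp
      then show ?thesis
        using \<phi>(5) by simp
    qed
    then have x1: "cstar_norm alg_A x \<le> 1"
      by (rule cstar_norm_le)
    have t: "Some s \<in> topspace Xt"
      using s by (simp add: Some_in_Xt)
    have val: "S n x (Some s) $ i $ l = F n (Some s) i j k l" for n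
    proof -
      have "S n x (Some s) $ i $ l = (\<Sum>j'\<in>UNIV. \<Sum>k'\<in>UNIV. F n (Some s) i j' k' l * x (Some s) $ j' $ k')"
        using x t by (simp add: F(1) symbol_op_def)
      also have "\<dots> = (\<Sum>j'\<in>UNIV. if j' = j then (\<Sum>k'\<in>UNIV. if k' = k then F n (Some s) i j k l else 0) else 0)"
        using t \<phi>(4) by (intro sum.cong refl) (simp add: x_def unit_element_nth mult_delta_right)
      finally show ?thesis by simp
    qed
    have "cmod (F n (Some s) i j k l - T x (Some s) $ i $ l) \<le> e n"
      "cmod (F m (Some s) i j k l - T x (Some s) $ i $ l) \<le> e m"
      using bound[OF x x1 t, of n i l] bound[OF x x1 t, of m i l] by (simp_all add: val)
    then show ?thesis
      using norm_triangle_ineq4[of "F n (Some s) i j k l - T x (Some s) $ i $ l" "F m (Some s) i j k l - T x (Some s) $ i $ l"]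
      by simp
  qed
  \<comment> \<open>At an integer all elements are diagonal and coefficients with
    \<open>j \<noteq> k\<close> are invisible; continuity carries the bound there from nearby
    non-integers.\<close>
  have cauchy: "cmod (F n t i j k l - F m t i j k l) \<le> e n + e m"
    if t: "t \<in> topspace Xt" for t n m i j k l
  proof -
    obtain s where s: "\<And>k::nat. s k > 1" "\<And>k. s k \<notin> \<int>"
      "\<And>f :: real option \<Rightarrow> complex. continuous_map Xt euclidean f \<Longrightarrow> (\<lambda>k. f (Some (s k))) \<longlonglongrightarrow> f t"
      using Xt_nonintegers_dense[OF t] by metis
    have "(\<lambda>r. cmod (F n (Some (s r)) i j k l - F m (Some (s r)) i j k l)) \<longlonglongrightarrow> cmod (F n t i j k l - F m t i j k l)"
      by (intro tendsto_norm tendsto_diff s(3)[OF admissible_symbolD(1)[OF F(2)]])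
    then show ?thesis
      by (rule LIMSEQ_le_const2) (use at_nonint[OF s(1,2)] in blast)
  qed
  define G :: symbol where "G t i j k l = lim (\<lambda>n. F n t i j k l)" for t i j k l
  have Glim: "(\<lambda>n. F n t i j k l) \<longlonglongrightarrow> G t i j k l" if t: "t \<in> topspace Xt" for t i j k l
  proof -
    have "Cauchy (\<lambda>n. F n t i j k l)"
    proof (rule metric_CauchyI)
      fix \<epsilon> :: real assume "\<epsilon> > 0"
      then have "\<forall>\<^sub>F n in sequentially. e n < \<epsilon> / 2"
        using e by (intro order_tendstoD(2)) auto
      then obtain N where N: "\<And>n. n \<ge> N \<Longrightarrow> e n < \<epsilon> / 2"
        unfolding eventually_sequentially by blast
      have "dist (F m t i j k l) (F n t i j k l) < \<epsilon>" if "m \<ge> N" "n \<ge> N" for m n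
        using cauchy[OF t, of m i j k l n] N[OF that(1)] N[OF that(2)] by (simp add: dist_norm)
      then show "\<exists>M. \<forall>m\<ge>M. \<forall>n\<ge>M. dist (F m t i j k l) (F n t i j k l) < \<epsilon>"
        by blast
    qed
    then show ?thesis
      unfolding G_def by (simp add: Cauchy_convergent_iff convergent_LIMSEQ_iff)
  qed
  have close: "cmod (F n t i j k l - G t i j k l) \<le> e n" if t: "t \<in> topspace Xt" for t n i j k l
  proof (rule LIMSEQ_le)
    show "(\<lambda>m. cmod (F n t i j k l - F m t i j k l)) \<longlonglongrightarrow> cmod (F n t i j k l - G t i j k l)"
      by (intro tendsto_intros Glim t)
    show "(\<lambda>m. e n + e m) \<longlonglongrightarrow> e n"
      using tendsto_add[OF tendsto_const e, of "e n"] by simp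
  qed (use cauchy[OF t] in blast)
  have "uniform_limit (topspace Xt) (\<lambda>n t. F n t i j k l) (\<lambda>t. G t i j k l) sequentially" for i j k l
  proof (rule uniform_limitI)
    fix \<epsilon> :: real assume "\<epsilon> > 0"
    then have "\<forall>\<^sub>F n in sequentially. e n < \<epsilon>"
      using e by (intro order_tendstoD(2)) auto
    then show "\<forall>\<^sub>F n in sequentially. \<forall>t\<in>topspace Xt. dist (F n t i j k l) (G t i j k l) < \<epsilon>"
    proof eventually_elim
      case (elim n)
      then show ?case
        using close le_less_trans unfolding dist_norm by blast
    qed
  qed
  then have G: "admissible_symbol G"
    by (rule admissible_symbol_limit[OF F(2)])
  have "T x = symbol_op G x" if x: "x \<in> carrier alg_A" for x
  proof (rule extensionalityI[of _ "topspace Xt"])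
    have Tlin: "T \<in> linear_maps alg_A"
      using CB by (simp add: CB_def)
    then have "T x \<in> carrier alg_A"
      using x by (auto simp: linear_maps_def)
    then show "T x \<in> extensional (topspace Xt)"
      by (rule extensional_alg_A)
    show "symbol_op G x \<in> extensional (topspace Xt)"
      by (simp add: symbol_op_def)
    fix t assume t: "t \<in> topspace Xt"
    obtain K where K: "K \<ge> 0" "\<And>t. t \<in> topspace Xt \<Longrightarrow> entry_sum (x t) \<le> K"
      using entry_sum_bounded[OF alg_A_continuous[OF x]] by metis
    \<comment> \<open>The estimate \<open>bound\<close> is for norm at most 1, so \<open>x\<close>
      is rescaled; adding 1 keeps the divisor positive when \<open>K = 0\<close>.\<close>
    define c where "c = inverse (complex_of_real (K + 1))"
    have "K + 1 > 0"
      using K(1) by linarith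
    then have c: "c \<noteq> 0" "cmod c = inverse (K + 1)"
      unfolding c_def by (simp_all only: nonzero_imp_inverse_nonzero norm_inverse norm_of_real abs_of_pos
          of_real_eq_0_iff inverse_nonzero_iff_nonzero less_imp_neq[symmetric] not_False_eq_True)
    define y where "y = c \<odot>\<^bsub>alg_A\<^esub> x"
    have y: "y \<in> carrier alg_A"
      unfolding y_def by (rule alg_A_smult_closed[OF x])
    have "entry_sum (y t) \<le> 1" if "t \<in> topspace Xt" for t
    proof -
      have "entry_sum (y t) = cmod c * entry_sum (x t)"
        using that by (simp add: y_def alg_A_sel entry_sum_def norm_mult sum_distrib_left)
      also have "\<dots> \<le> inverse (K + 1) * (K + 1)"
        unfolding c(2) using K(1) K(2)[OF that] by (intro mult_left_mono) auto
      finally show ?thesis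
        using K(1) by simp
    qed
    then have y1: "cstar_norm alg_A y \<le> 1"
      by (rule cstar_norm_le)
    have "S n y t $ i $ l = c * symbol_op (F n) x t $ i $ l" for n i l
      using t y x by (simp add: F(1) y_def symbol_op_linear) (simp add: alg_A_sel)
    moreover have "T y t $ i $ l = c * T x t $ i $ l" for i l
    proof -
      have "T y = c \<odot>\<^bsub>alg_A\<^esub> T x"
        unfolding y_def using Tlin x by (simp add: linear_maps_def)
      then show ?thesis
        using t by (simp add: alg_A_sel)
    qed
    ultimately have le: "cmod (c * (symbol_op (F n) x t $ i $ l - T x t $ i $ l)) \<le> e n" for n i l
      using bound[OF y y1 t, of n i l] by (simp add: algebra_simps)
    show "T x t = symbol_op G x t"
      unfolding vec_eq_iff
    proof (intro allI)
      fix i l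
      have "(\<lambda>n. c * (symbol_op (F n) x t $ i $ l - T x t $ i $ l)) \<longlonglongrightarrow> 0"
        by (rule Lim_null_comparison[OF _ e]) (use le in simp)
      moreover have "(\<lambda>n. c * (symbol_op (F n) x t $ i $ l - T x t $ i $ l))
        \<longlonglongrightarrow> c * (symbol_op G x t $ i $ l - T x t $ i $ l)"
        using t unfolding symbol_op_def by simp (intro tendsto_intros Glim t)
      ultimately have "c * (symbol_op G x t $ i $ l - T x t $ i $ l) = 0"
        using LIMSEQ_unique by blast
      then show "T x t $ i $ l = symbol_op G x t $ i $ l"
        using c(1) by simp
    qed
  qed
  moreover have "T \<in> extensional (carrier alg_A)"
    using CB by (auto simp: CB_def linear_maps_def PiE_def)
  ultimately have "T = (\<lambda>x\<in>carrier alg_A. symbol_op G x)"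
    by (intro extensionalityI[of T "carrier alg_A"]) auto
  then show "T \<in> elementary_operators alg_A"
    unfolding elementary_operators_admissible using G by (intro CollectI exI conjI)
qed (rule elementary_subset_ICB)

section \<open>The outer derivation\<close>

text \<open>Continuous and diagonal, yet outside the algebra: its lower entry at \<open>n\<close> is
  0, while its upper entry at \<open>n + 1\<close> is not.\<close>

definition reciprocal_corner :: "real option \<Rightarrow> m2" where
  "reciprocal_corner t = matrix_unit 1 1 (case t of None \<Rightarrow> 0 | Some s \<Rightarrow> complex_of_real (1 / s))"

lemma reciprocal_corner_continuous: "continuous_map Xt euclidean (\<lambda>t. reciprocal_corner t $ i $ j)"
proof -
  have "((\<lambda>s::real. 1 / s) \<longlongrightarrow> 0) at_top"
    by (intro tendsto_divide_0[OF tendsto_const] filterlim_at_top_imp_at_infinity filterlim_ident)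
  then have "((\<lambda>s. complex_of_real (1 / s)) \<longlongrightarrow> complex_of_real 0) at_top"
    by (rule tendsto_of_real)
  moreover have "continuous_on {1..} (\<lambda>s. complex_of_real (1 / s))"
    by (intro continuous_intros) auto
  ultimately show ?thesis
    by (cases "i = 1 \<and> j = 1") (simp_all add: continuous_Xt_iff reciprocal_corner_def matrix_unit_nth)
qed

definition commutator_symbol :: symbol where
  "commutator_symbol t i j k l =
    reciprocal_corner t $ i $ j * (mat 1 :: m2) $ k $ l - (mat 1 :: m2) $ i $ j * reciprocal_corner t $ k $ l"

text \<open>In the two corners tied between neighbouring integers the terms of the commutator
  cancel. What remains on the diagonal is \<open>1 / n\<close> and \<open>- 1 / n\<close> in the
  mixed corners, which are free at integers and tend to 0.\<close>

lemma commutator_symbol_admissible: "admissible_symbol commutator_symbol"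
  unfolding admissible_symbol_def
proof (intro conjI allI impI)
  show "continuous_map Xt euclidean (\<lambda>t. commutator_symbol t i j k l)" for i j k l
    using reciprocal_corner_continuous
    unfolding commutator_symbol_def continuous_map_atin limitin_canonical_iff
    by (intro ballI tendsto_diff tendsto_mult tendsto_const) auto
qed (auto simp: commutator_symbol_def reciprocal_corner_def matrix_unit_nth mat_def)

lemma commutator_symbol_op:
  "symbol_op commutator_symbol x = (\<lambda>t\<in>topspace Xt. reciprocal_corner t ** x t - x t ** reciprocal_corner t)"
proof -
  have "(\<Sum>j\<in>UNIV. \<Sum>k\<in>UNIV. (a $ i $ j * (mat 1 :: m2) $ k $ l - (mat 1 :: m2) $ i $ j * a $ k $ l) * y $ j $ k)
    = (a ** y - y ** a) $ i $ l" for a y :: m2 and i l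
    using exhaust_2[of i] exhaust_2[of l]
    by (auto simp: mult_m2_nth sum_2 mat_def algebra_simps)
  then show ?thesis
    unfolding symbol_op_def commutator_symbol_def by (intro restrict_ext) (simp add: vec_eq_iff)
qed

lemma commutator_Leibniz:
  "w ** (a ** b) - (a ** b) ** w = (w ** a - a ** w) ** b + a ** (w ** b - b ** w)" for a b w :: m2
  by (simp add: vec_eq_iff mult_m2_nth algebra_simps)

definition outer_derivation :: "(real option \<Rightarrow> m2) \<Rightarrow> real option \<Rightarrow> m2" where
  "outer_derivation = (\<lambda>x\<in>carrier alg_A. symbol_op commutator_symbol x)"

lemma outer_derivation_elementary: "outer_derivation \<in> elementary_operators alg_A"
  unfolding outer_derivation_def elementary_operators_admissible
  by (rule CollectI, rule exI[of _ commutator_symbol]) (simp add: commutator_symbol_admissible)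

lemma outer_derivation_derivation: "outer_derivation \<in> derivations alg_A"
  unfolding derivations_def
proof (intro CollectI conjI ballI)
  show "outer_derivation \<in> linear_maps alg_A"
    using subsetD[OF elementary_subset_ICB outer_derivation_elementary] by (simp add: ICB_def CB_def)
  fix a b assume ab: "a \<in> carrier alg_A" "b \<in> carrier alg_A"
  then have "outer_derivation (a \<otimes>\<^bsub>alg_A\<^esub> b) = symbol_op commutator_symbol (a \<otimes>\<^bsub>alg_A\<^esub> b)"
    by (simp add: outer_derivation_def alg_A_mult_closed)
  also have "\<dots> = symbol_op commutator_symbol a \<otimes>\<^bsub>alg_A\<^esub> b \<oplus>\<^bsub>alg_A\<^esub> a \<otimes>\<^bsub>alg_A\<^esub> symbol_op commutator_symbol b"
    unfolding commutator_symbol_op alg_A_sel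
    by (rule restrict_ext) (simp add: commutator_Leibniz)
  finally show "outer_derivation (a \<otimes>\<^bsub>alg_A\<^esub> b)
    = outer_derivation a \<otimes>\<^bsub>alg_A\<^esub> b \<oplus>\<^bsub>alg_A\<^esub> a \<otimes>\<^bsub>alg_A\<^esub> outer_derivation b"
    using ab by (simp add: outer_derivation_def)
qed

text \<open>Comparing the two commutators with a bump times \<open>e_12\<close> in the entry
  \<open>1 2\<close> gives the equation at non-integers. At integers all commutators vanish and
  reveal nothing, so the equation arrives there by density.\<close>

lemma implementing_diagonal_difference:
  assumes a: "a \<in> carrier alg_A"
    and inner: "\<And>x. x \<in> carrier alg_A \<Longrightarrow> outer_derivation x = a \<otimes>\<^bsub>alg_A\<^esub> x \<ominus>\<^bsub>alg_A\<^esub> x \<otimes>\<^bsub>alg_A\<^esub> a"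
    and t: "t \<in> topspace Xt"
  shows "a t $ 1 $ 1 - a t $ 2 $ 2 = reciprocal_corner t $ 1 $ 1"
proof -
  have nonint: "a (Some s) $ 1 $ 1 - a (Some s) $ 2 $ 2 = reciprocal_corner (Some s) $ 1 $ 1"
    if s: "s > 1" "s \<notin> \<int>" for s
  proof -
    obtain \<phi> :: "real option \<Rightarrow> complex" where \<phi>: "continuous_map Xt euclidean \<phi>" "\<phi> None = 0"
      "\<And>n::nat. \<phi> (Some n) = 0" "\<phi> (Some s) = 1"
      using bump_exists[OF s(2)] by metis
    define x where "x = unit_element 1 2 \<phi>"
    have x: "x \<in> carrier alg_A"
      unfolding x_def by (rule unit_element_closed) (use \<phi> in auto)
    have st: "Some s \<in> topspace Xt"
      using s by (simp add: Some_in_Xt)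
    have "outer_derivation x (Some s) = reciprocal_corner (Some s) ** x (Some s) - x (Some s) ** reciprocal_corner (Some s)"
      using x st by (simp add: outer_derivation_def commutator_symbol_op)
    moreover have "outer_derivation x (Some s) = a (Some s) ** x (Some s) - x (Some s) ** a (Some s)"
      unfolding inner[OF x] using st alg_A_minus[OF alg_A_mult_closed[OF a x] alg_A_mult_closed[OF x a]]
      by (simp add: alg_A_sel)
    ultimately have "(reciprocal_corner (Some s) ** x (Some s) - x (Some s) ** reciprocal_corner (Some s)) $ 1 $ 2
      = (a (Some s) ** x (Some s) - x (Some s) ** a (Some s)) $ 1 $ 2"
      by simp
    then show ?thesis
      using st \<phi>(4) by (simp add: mult_m2_nth x_def unit_element_nth) (simp add: reciprocal_corner_def matrix_unit_nth)
  qed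
  obtain s where s: "\<And>k::nat. s k > 1" "\<And>k. s k \<notin> \<int>"
    "\<And>f :: real option \<Rightarrow> complex. continuous_map Xt euclidean f \<Longrightarrow> (\<lambda>k. f (Some (s k))) \<longlonglongrightarrow> f t"
    using Xt_nonintegers_dense[OF t] by metis
  have "(\<lambda>k. a (Some (s k)) $ 1 $ 1 - a (Some (s k)) $ 2 $ 2) \<longlonglongrightarrow> a t $ 1 $ 1 - a t $ 2 $ 2"
    by (intro tendsto_diff s(3) alg_A_continuous a)
  then have "(\<lambda>k. reciprocal_corner (Some (s k)) $ 1 $ 1) \<longlonglongrightarrow> a t $ 1 $ 1 - a t $ 2 $ 2"
    by (simp only: nonint[OF s(1,2)])
  moreover have "(\<lambda>k. reciprocal_corner (Some (s k)) $ 1 $ 1) \<longlonglongrightarrow> reciprocal_corner t $ 1 $ 1"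
    by (intro s(3) reciprocal_corner_continuous)
  ultimately show ?thesis
    by (rule LIMSEQ_unique)
qed

lemma outer_derivation_not_inner: "\<not> inner_derivation alg_A outer_derivation"
proof
  assume "inner_derivation alg_A outer_derivation"
  then obtain a where a: "a \<in> carrier alg_A"
    and inner: "\<And>x. x \<in> carrier alg_A \<Longrightarrow> outer_derivation x = a \<otimes>\<^bsub>alg_A\<^esub> x \<ominus>\<^bsub>alg_A\<^esub> x \<otimes>\<^bsub>alg_A\<^esub> a"
    unfolding inner_derivation_def by blast
  \<comment> \<open>Indexed from 0, so that the differences are the terms \<open>1 / (n + 1)\<close>
    of \<open>harm\<close> and telescope to its partial sums.\<close>
  define p where "p n = a (Some (real n + 1)) $ 1 $ 1" for n :: nat
  have step: "p n - p (Suc n) = 1 / of_nat (Suc n)" for n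
  proof -
    have "a (Some (real (Suc n))) $ 1 $ 1 - a (Some (real (Suc n))) $ 2 $ 2
      = reciprocal_corner (Some (real (Suc n))) $ 1 $ 1"
      by (rule implementing_diagonal_difference[OF a inner]) (simp_all add: Some_in_Xt)
    then show ?thesis
      using alg_A_shift[OF a, of "Suc n"]
      by (simp add: p_def reciprocal_corner_def matrix_unit_nth add.commute)
  qed
  have harm: "harm n = p 0 - p n" for n
  proof (induction n)
    case (Suc n)
    then show ?case
      by (simp only: harm_Suc inverse_eq_divide step[symmetric]) simp
  qed (simp add: harm_def)
  have "p \<longlonglongrightarrow> a None $ 1 $ 1"
  proof -
    have "((\<lambda>s. a (Some s) $ 1 $ 1) \<longlongrightarrow> a None $ 1 $ 1) at_top"
      using alg_A_continuous[OF a, of 1 1] by (simp add: continuous_Xt_iff)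
    moreover have "filterlim (\<lambda>n. real n + 1) at_top sequentially"
      by (rule filterlim_at_top_mono[OF filterlim_real_sequentially]) simp
    ultimately have "(\<lambda>n. a (Some (real n + 1)) $ 1 $ 1) \<longlonglongrightarrow> a None $ 1 $ 1"
      by (rule filterlim_compose)
    then show ?thesis
      by (simp add: p_def[abs_def])
  qed
  then have "(\<lambda>n. p 0 - p n) \<longlonglongrightarrow> p 0 - a None $ 1 $ 1"
    by (intro tendsto_diff tendsto_const)
  then have "(\<lambda>n. harm n :: complex) \<longlonglongrightarrow> p 0 - a None $ 1 $ 1"
    by (simp only: harm)
  then show False
    using not_convergent_harm[where 'a = complex] by (auto simp: convergent_def)
qed

theorem mainTheorem4:
  shows "Orc alg_A = \<infinity> \<and>
    map_subspace alg_A (elementary_operators alg_A) (ICB alg_A) \<and>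
    cb_closed_in alg_A (elementary_operators alg_A) (ICB alg_A) \<and>
    (\<exists>\<delta> \<in> derivations alg_A. \<delta> \<in> elementary_operators alg_A \<and> \<not> inner_derivation alg_A \<delta>)"
  using Orc_alg_A elementary_map_subspace elementary_cb_closed outer_derivation_derivation
    outer_derivation_elementary outer_derivation_not_inner by blast

end
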